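(* The formula $$\langle f,g\rangle_{QR}=\frac1{8\pi^2}\int_{X\in S^3_R}\bigl(\deg g(X)\bigr)\cdot\nabla f(X)\,\frac{dS}R-\frac1{8\pi^2}\int_{X\in S^3_R}g(X)\cdot\deg\nabla f(X)\,\frac{dS}R-\frac R{8\pi^2}\int_{X\in S^3_R}\bigl(\square g(X)\bigr)\cdot X^{-1}\cdot f(X)\,dS$$ defines an $SU(2)\times SU(2)$-invariant and $\mathfrak{gl}(2,\mathbb H_{\mathbb C})$-invariant bilinear pairing between $(\pi'_l,{\cal U}^+)$ and $(\pi'_r,{\cal U}'^-)$ and also between $(\pi'_l,{\cal U}^-)$ and $(\pi'_r,{\cal U}'^+)$. This pairing is non-degenerate and independent of the choice of $R>0$.
   Context: $\mathbb H_{\mathbb C}=\mathbb C\otimes_{\mathbb R}\mathbb H$ is identified with $2\times2$ complex matrices $Z=z^0e_0+z^1e_1+z^2e_2+z^3e_3$, $z^j\in\mathbb C$, with $e_0=1$, $e_1=\bigl(\begin{smallmatrix}0&-i\\-i&0\end{smallmatrix}\bigr)$, $e_2=\bigl(\begin{smallmatrix}0&-1\\1&0\end{smallmatrix}\bigr)$, $e_3=\bigl(\begin{smallmatrix}-i&0\\0&i\end{smallmatrix}\bigr)$; $\mathbb H$ is the subset with real $z^j$; $N(Z)=\det Z$. $\mathbb S$, $\mathbb S'$ are the spaces of complex $2$-columns and $2$-rows; a row times a column is a scalar. $S^3_R=\{X\in\mathbb H;N(X)=R^2\}$ with Euclidean volume element $dS$. $\deg=\sum_jz^j\partial_{z^j}$.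 $\nabla=e_0\partial_{z^0}-e_1\partial_{z^1}-e_2\partial_{z^2}-e_3\partial_{z^3}$, $\square=\sum_j\partial_{z^j}^2$, $g\overleftarrow\nabla$ is $\nabla$ acting from the right. ${\cal U}=\{f\in\mathbb C[z^0,z^1,z^2,z^3,N(Z)^{-1}]\otimes\mathbb S;\nabla\square f=0\}$, ${\cal U}'=\{g\in\mathbb C[z^0,z^1,z^2,z^3,N(Z)^{-1}]\otimes\mathbb S';(\square g)\overleftarrow\nabla=0\}$. ${\cal U}^+$, ${\cal U}'^+$ (resp. ${\cal U}^-$, ${\cal U}'^-$) are the spans of the homogeneous elements of degree $\ge0$ (resp. $<0$). Actions, for $h=\bigl(\begin{smallmatrix}a'&b'\\c'&d'\end{smallmatrix}\bigr)$, $h^{-1}=\bigl(\begin{smallmatrix}a&b\\c&d\end{smallmatrix}\bigr)$ in $GL(2,\mathbb H_{\mathbb C})$: $(\pi'_l(h)f)(Z)=\frac{a'-Zc'}{N(a'-Zc')}f\bigl((a'-Zc')^{-1}(-b'+Zd')\bigr)$, $(\pi'_r(h)g)(Z)=g\bigl((aZ+b)(cZ+d)^{-1}\bigr)\frac{cZ+d}{N(cZ+d)}$; $\mathfrak{gl}(2,\mathbb H_{\mathbb C})$ acts by differentiation. $SU(2)\times SU(2)$ is the group of diagonal $\bigl(\begin{smallmatrix}a&0\\0&d\end{smallmatrix}\bigr)$, $a,d\in\mathbb H$, $N(a)=N(d)=1$. Invariance means $\langle\pi'_l(h)f,\pi'_r(h)g\rangle_{QR}=\langle f,g\rangle_{QR}$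 for the group and $\langle\pi'_l(Y)f,g\rangle_{QR}+\langle f,\pi'_r(Y)g\rangle_{QR}=0$ for the Lie algebra. *)

theory Defs
  imports "HOL-Analysis.Analysis"
begin

section \<open>Complexified quaternions as complex two by two matrices\<close>

text \<open>The index type \<open>4\<close> has the elements \<open>0, 1, 2, 3\<close> (with \<open>4 = 0\<close>).\<close>

definition qunit :: "4 \<Rightarrow> complex^2^2" where
  "qunit j =
    (if j = 0 then mat 1
     else if j = 1 then vector [vector [0, - \<i>], vector [- \<i>, 0]]
     else if j = 2 then vector [vector [0, - 1], vector [1, 0]]
     else vector [vector [- \<i>, 0], vector [0, \<i>]])"

definition qcoord :: "4 \<Rightarrow> complex^2^2 \<Rightarrow> complex" where
  "qcoord j Z =
    (if j = 0 then (Z $ 1 $ 1 + Z $ 2 $ 2) / 2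
     else if j = 1 then \<i> * (Z $ 1 $ 2 + Z $ 2 $ 1) / 2
     else if j = 2 then (Z $ 2 $ 1 - Z $ 1 $ 2) / 2
     else \<i> * (Z $ 1 $ 1 - Z $ 2 $ 2) / 2)"

definition cscale :: "complex \<Rightarrow> complex^2^2 \<Rightarrow> complex^2^2" where
  "cscale c Z = (\<chi> i k. c * Z $ i $ k)"

abbreviation qnorm :: "complex^2^2 \<Rightarrow> complex" where
  "qnorm Z \<equiv> det Z"

definition real_quaternions :: "(complex^2^2) set" where
  "real_quaternions = {Z. \<forall>j. qcoord j Z \<in> \<real>}"

definition quat :: "real^4 \<Rightarrow> complex^2^2" where
  "quat x = (\<Sum>j\<in>UNIV. cscale (of_real (x $ j)) (qunit j))"

lemma UNIV_4_zero: "(UNIV :: 4 set) = {0, 1, 2, 3}"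
proof -
  have "(4::4) = 0" by simp
  then show ?thesis using UNIV_4 by auto
qed

lemma distinct_4_zero [simp]:
  "(0::4) \<noteq> 1" "(0::4) \<noteq> 2" "(0::4) \<noteq> 3" "(1::4) \<noteq> 2" "(1::4) \<noteq> 3" "(2::4) \<noteq> 3"
  "(1::4) \<noteq> 0" "(2::4) \<noteq> 0" "(3::4) \<noteq> 0" "(2::4) \<noteq> 1" "(3::4) \<noteq> 1" "(3::4) \<noteq> 2"
  by simp_all

lemma sum_UNIV_4_zero: "sum f (UNIV :: 4 set) = f 0 + f 1 + f 2 + f 3"
  unfolding UNIV_4_zero by (simp add: add.assoc)

lemma qcoord_expansion: "Z = (\<Sum>j\<in>UNIV. cscale (qcoord j Z) (qunit j))"
  by (simp add: sum_UNIV_4_zero vec_eq_iff forall_2 cscale_def qcoord_def qunit_def mat_def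
      algebra_simps add_divide_distrib diff_divide_distrib)

lemma qcoord_sum: "qcoord k (\<Sum>j\<in>UNIV. cscale (w j) (qunit j)) = w k"
proof -
  have "k = 0 \<or> k = 1 \<or> k = 2 \<or> k = 3" using UNIV_4_zero by auto
  then show ?thesis
    by (auto simp: sum_UNIV_4_zero cscale_def qcoord_def qunit_def mat_def algebra_simps)
qed

lemma qnorm_eq_sum_squares: "qnorm Z = (\<Sum>j\<in>UNIV. (qcoord j Z)\<^sup>2)"
  by (simp add: det_2 sum_UNIV_4_zero qcoord_def power2_eq_square field_simps)

definition S3 :: "real \<Rightarrow> (complex^2^2) set" where
  "S3 R = {X \<in> real_quaternions. qnorm X = of_real (R\<^sup>2)}"

lemma qcoord_quat: "qcoord j (quat x) = of_real (x $ j)"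
  unfolding quat_def by (rule qcoord_sum)

lemma qnorm_quat: "qnorm (quat x) = of_real ((norm x)\<^sup>2)"
  unfolding qnorm_eq_sum_squares qcoord_quat
  by (simp add: norm_vec_def L2_set_def sum_nonneg)

lemma quat_sphere:
  assumes "R > 0"
  shows "quat ` sphere 0 R = S3 R"
proof (intro equalityI subsetI)
  fix X assume "X \<in> quat ` sphere 0 R"
  then show "X \<in> S3 R"
    by (auto simp: S3_def real_quaternions_def qcoord_quat qnorm_quat)
next
  fix X assume X: "X \<in> S3 R"
  define x :: "real^4" where "x = (\<chi> j. Re (qcoord j X))"
  have "of_real (x $ j) = qcoord j X" for j
    using X by (auto simp: S3_def real_quaternions_def x_def elim!: Reals_cases)
  then have q: "quat x = X"
    using qcoord_expansion[of X] by (simp add: quat_def)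
  then have "complex_of_real ((norm x)\<^sup>2) = complex_of_real (R\<^sup>2)"
    using X qnorm_quat[of x] by (simp only: S3_def mem_Collect_eq)
  then have "(norm x)\<^sup>2 = R\<^sup>2"
    by (simp only: of_real_eq_iff)
  then have "norm x = R"
    using assms by simp
  then show "X \<in> quat ` sphere 0 R"
    using q by (auto simp: image_iff intro!: bexI[of _ x])
qed


section \<open>The Euclidean volume element on the sphere\<close>

text \<open>
  Surface measure of the sphere of radius \<open>R\<close> about the origin, as in the theory of polar
  coordinates: the measure of a set \<open>E\<close> of points of the sphere is \<open>DIM('a) / R\<close> times the Lebesgue
  measure of the cone over \<open>E\<close> inside the ball of radius \<open>R\<close>.  The lemmas below show that in \<open>real^4\<close>
  this is the rotation invariant Borel measure carried by the sphere of total mass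
  \<open>2 * pi\<^sup>2 * R ^ 3\<close>.
\<close>

definition sphere_measure :: "real \<Rightarrow> 'a::euclidean_space measure" where
  "sphere_measure R =
    scale_measure (ennreal (DIM('a) / R))
      (distr (restrict_space lborel (ball 0 R - {0})) borel (\<lambda>x. (R / norm x) *\<^sub>R x))"

lemma sets_sphere_measure [simp, measurable_cong]: "sets (sphere_measure R) = sets borel"
  and space_sphere_measure [simp]: "space (sphere_measure R) = UNIV"
  by (simp_all add: sphere_measure_def space_scale_measure)

lemma radial_projection_measurable [measurable]:
  "(\<lambda>x::'a::euclidean_space. (R / norm x) *\<^sub>R x) \<in> borel_measurable borel"
  by measurable

lemma emeasure_sphere_measure:
  fixes E :: "'a::euclidean_space set"
  assumes "E \<in> sets borel"
  shows "emeasure (sphere_measure R) E =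
    ennreal (DIM('a) / R) * emeasure lborel {x \<in> ball 0 R - {0}. (R / norm x) *\<^sub>R x \<in> E}"
proof -
  let ?B = "ball 0 R - {0} :: 'a set"
  have m: "(\<lambda>x::'a. (R / norm x) *\<^sub>R x) \<in> restrict_space lborel ?B \<rightarrow>\<^sub>M borel"
    by (intro measurable_restrict_space1) simp
  have s: "{x \<in> ?B. (R / norm x) *\<^sub>R x \<in> E} = (\<lambda>x. (R / norm x) *\<^sub>R x) -` E \<inter> space (restrict_space lborel ?B)"
    by (auto simp: space_restrict_space)
  show ?thesis
    unfolding sphere_measure_def emeasure_scale_measure emeasure_distr[OF m assms] s
    by (subst emeasure_restrict_space) (auto simp: space_restrict_space)
qed

lemma sphere_measure_carrier:
  assumes "R > 0"
  shows "emeasure (sphere_measure R :: 'a::euclidean_space measure) (- sphere 0 R) = 0"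
proof -
  have e: "{x \<in> ball 0 R - {0}. (R / norm x) *\<^sub>R x \<in> - sphere 0 R} = ({} :: 'a set)"
    using assms by auto
  have "- sphere 0 R \<in> sets (borel :: 'a measure)"
    by (intro borel_comp borel_closed) simp
  then show ?thesis by (simp only: emeasure_sphere_measure e) simp
qed

lemma sphere_measure_total:
  assumes "R > 0"
  shows "emeasure (sphere_measure R :: (real^4) measure) UNIV = ennreal (2 * pi\<^sup>2 * R ^ 3)"
proof -
  have "emeasure lborel (ball 0 R - {0} :: (real^4) set) = emeasure lborel (ball (0 :: real^4) R)"
    using assms by (subst emeasure_Diff) auto
  also have "\<dots> = ennreal (pi\<^sup>2 / 2 * R ^ 4)"
    using assms by (simp add: emeasure_ball unit_ball_vol_4)
  finally have v: "emeasure lborel (ball 0 R - {0} :: (real^4) set) = ennreal (pi\<^sup>2 / 2 * R ^ 4)" .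
  have e: "{x \<in> ball 0 R - {0}. (R / norm x) *\<^sub>R x \<in> UNIV} = (ball 0 R - {0} :: (real^4) set)"
    by auto
  have "emeasure (sphere_measure R :: (real^4) measure) UNIV =
      ennreal (4 / R) * ennreal (pi\<^sup>2 / 2 * R ^ 4)"
    by (subst emeasure_sphere_measure) (simp_all only: e v, simp_all)
  also have "\<dots> = ennreal (2 * pi\<^sup>2 * R ^ 3)"
    using assms by (simp flip: ennreal_mult add: field_simps power_numeral_reduce)
  finally show ?thesis .
qed

lemma sphere_measure_rotation:
  fixes T :: "real^4 \<Rightarrow> real^4"
  assumes T: "orthogonal_transformation T"
  shows "distr (sphere_measure R) borel T = sphere_measure R"
proof (rule measure_eqI)
  fix E assume "E \<in> sets (distr (sphere_measure R) borel T)"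
  then have E: "E \<in> sets borel" by simp
  have lin: "linear T" using T by (rule orthogonal_transformation_linear)
  have Tm [measurable]: "T \<in> borel_measurable borel"
    using lin by (intro borel_measurable_continuous_onI linear_continuous_on linear_conv_bounded_linear[THEN iffD1])
  let ?C = "\<lambda>E. {x \<in> ball 0 R - {0}. (R / norm x) *\<^sub>R x \<in> E}"
  have C: "?C E \<in> sets borel" using E by measurable
  have TE: "T -` E \<in> sets borel" using measurable_sets[OF Tm E] by simp
  then have C': "?C (T -` E) \<in> sets borel" by measurable
  have eq: "T ` ?C (T -` E) = ?C E"
  proof (intro equalityI subsetI)
    fix y assume y: "y \<in> ?C E"
    obtain x where x: "y = T x"
      using orthogonal_transformation_surj[OF T] by (metis surjD)
    have "x \<in> ?C (T -` E)"
      using y T lin by (auto simp: x orthogonal_transformation_norm linear_scale linear_0)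
    then show "y \<in> T ` ?C (T -` E)" using x by blast
  next
    fix y assume "y \<in> T ` ?C (T -` E)"
    then show "y \<in> ?C E"
      using T lin orthogonal_transformation_norm[OF T]
      by (auto simp: linear_scale) (metis norm_eq_zero)
  qed
  have bd: "bounded (?C F)" for F
    by (rule bounded_subset[of "ball 0 R"]) auto
  have L: "?C (T -` E) \<in> lmeasurable"
    using C' by (intro bounded_set_imp_lmeasurable[OF bd] sets_completionI_sets) (simp only: sets_lborel)
  have "measure lebesgue (?C E) = measure lebesgue (?C (T -` E))"
    using measure_orthogonal_image[OF T L] by (simp only: eq)
  then have "measure lborel (?C E) = measure lborel (?C (T -` E))"
    using C C' by (simp only: measure_completion sets_lborel)
  moreover have fin: "emeasure lborel (?C F) = ennreal (measure lborel (?C F))" for F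
    using emeasure_bounded_finite[OF bd, of F]
    by (intro emeasure_eq_ennreal_measure less_imp_neq) (simp only: top_ennreal.rep_eq infinity_ennreal_def)
  ultimately have meq: "emeasure lborel (?C (T -` E)) = emeasure lborel (?C E)"
    by (simp only: fin)
  have "emeasure (distr (sphere_measure R) borel T) E = emeasure (sphere_measure R) (T -` E)"
    using emeasure_distr[of T "sphere_measure R" borel E] E Tm
    by (simp only: space_sphere_measure Int_UNIV_right measurable_cong_sets[OF sets_sphere_measure refl])
  then show "emeasure (distr (sphere_measure R) borel T) E = emeasure (sphere_measure R) E"
    unfolding emeasure_sphere_measure[OF E] emeasure_sphere_measure[OF TE] meq .
qed (simp only: sets_distr sets_sphere_measure)

definition S3_measure :: "real \<Rightarrow> (complex^2^2) measure" where
  "S3_measure R = distr (sphere_measure R) borel quat"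


section \<open>Differential operators\<close>

text \<open>
  Columns and rows are both of type \<open>complex^2\<close>; matrices act by \<open>*v\<close> on columns and by \<open>v*\<close> on
  rows.
\<close>

definition row_col :: "complex^2 \<Rightarrow> complex^2 \<Rightarrow> complex" where
  "row_col u v = (\<Sum>i\<in>UNIV. u $ i * v $ i)"

definition qpartial :: "4 \<Rightarrow> (complex^2^2 \<Rightarrow> complex^2) \<Rightarrow> complex^2^2 \<Rightarrow> complex^2" where
  "qpartial j f Z = (\<chi> i. deriv (\<lambda>t. f (Z + cscale t (qunit j)) $ i) 0)"

definition nabla :: "(complex^2^2 \<Rightarrow> complex^2) \<Rightarrow> complex^2^2 \<Rightarrow> complex^2" where
  "nabla f Z = qunit 0 *v qpartial 0 f Z - qunit 1 *v qpartial 1 f Z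
    - qunit 2 *v qpartial 2 f Z - qunit 3 *v qpartial 3 f Z"

definition nabla_right :: "(complex^2^2 \<Rightarrow> complex^2) \<Rightarrow> complex^2^2 \<Rightarrow> complex^2" where
  "nabla_right g Z = qpartial 0 g Z v* qunit 0 - qpartial 1 g Z v* qunit 1
    - qpartial 2 g Z v* qunit 2 - qpartial 3 g Z v* qunit 3"

definition qbox :: "(complex^2^2 \<Rightarrow> complex^2) \<Rightarrow> complex^2^2 \<Rightarrow> complex^2" where
  "qbox f Z = (\<Sum>j\<in>UNIV. qpartial j (qpartial j f) Z)"

definition qdeg :: "(complex^2^2 \<Rightarrow> complex^2) \<Rightarrow> complex^2^2 \<Rightarrow> complex^2" where
  "qdeg f Z = (\<Sum>j\<in>UNIV. qcoord j Z *s qpartial j f Z)"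


section \<open>The function spaces\<close>

text \<open>
  Elements of \<open>\<complex>[z0, z1, z2, z3, N(Z)\<^sup>-\<^sup>1]\<close> are functions on the open set \<open>qnorm Z \<noteq> 0\<close>.  They are
  represented by total functions with value \<open>0\<close> off that set, so that equality of functions is
  equality in the ring.  The exponent \<open>(m, k)\<close> stands for the monomial
  \<open>z0 ^ m 0 * z1 ^ m 1 * z2 ^ m 2 * z3 ^ m 3 * (N(Z)\<^sup>-\<^sup>1) ^ k\<close>.
\<close>

definition laurent_polynomials :: "(complex^2^2 \<Rightarrow> complex) set" where
  "laurent_polynomials =
    {F. \<exists>(M :: ((4 \<Rightarrow> nat) \<times> nat) set) c. finite M \<and>
      (\<forall>Z. F Z = (if qnorm Z = 0 then 0
        else \<Sum>(m, k)\<in>M. c (m, k) * (\<Prod>j\<in>UNIV. qcoord j Z ^ m j) * inverse (qnorm Z) ^ k))}"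

definition U_space :: "(complex^2^2 \<Rightarrow> complex^2) set" where
  "U_space = {f. (\<forall>i. (\<lambda>Z. f Z $ i) \<in> laurent_polynomials) \<and>
    (\<forall>Z. qnorm Z \<noteq> 0 \<longrightarrow> nabla (qbox f) Z = 0)}"

definition U'_space :: "(complex^2^2 \<Rightarrow> complex^2) set" where
  "U'_space = {g. (\<forall>i. (\<lambda>Z. g Z $ i) \<in> laurent_polynomials) \<and>
    (\<forall>Z. qnorm Z \<noteq> 0 \<longrightarrow> nabla_right (qbox g) Z = 0)}"

definition homogeneous :: "int \<Rightarrow> (complex^2^2 \<Rightarrow> complex^2) \<Rightarrow> bool" where
  "homogeneous n f \<longleftrightarrow> (\<forall>c Z. c \<noteq> 0 \<longrightarrow> f (cscale c Z) = (c powi n) *s f Z)"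

definition complex_span :: "(complex^2^2 \<Rightarrow> complex^2) set \<Rightarrow> (complex^2^2 \<Rightarrow> complex^2) set" where
  "complex_span S = {f. \<exists>T c. finite T \<and> T \<subseteq> S \<and> f = (\<lambda>Z. \<Sum>u\<in>T. c u *s u Z)}"

definition U_plus :: "(complex^2^2 \<Rightarrow> complex^2) set" where
  "U_plus = complex_span {f \<in> U_space. \<exists>n\<ge>0. homogeneous n f}"

definition U_minus :: "(complex^2^2 \<Rightarrow> complex^2) set" where
  "U_minus = complex_span {f \<in> U_space. \<exists>n<0. homogeneous n f}"

definition U'_plus :: "(complex^2^2 \<Rightarrow> complex^2) set" where
  "U'_plus = complex_span {g \<in> U'_space. \<exists>n\<ge>0. homogeneous n g}"

definition U'_minus :: "(complex^2^2 \<Rightarrow> complex^2) set" where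
  "U'_minus = complex_span {g \<in> U'_space. \<exists>n<0. homogeneous n g}"


section \<open>Group and Lie algebra actions\<close>

text \<open>
  \<open>GL(2, H\<^sub>C)\<close> and \<open>gl(2, H\<^sub>C)\<close> consist of complex four by four matrices, indexed by the sum type
  \<open>2 + 2\<close> so that \<open>Inl\<close> and \<open>Inr\<close> select the blocks.
\<close>

definition block_a :: "complex^(2 + 2)^(2 + 2) \<Rightarrow> complex^2^2" where
  "block_a h = (\<chi> i j. h $ Inl i $ Inl j)"

definition block_b :: "complex^(2 + 2)^(2 + 2) \<Rightarrow> complex^2^2" where
  "block_b h = (\<chi> i j. h $ Inl i $ Inr j)"

definition block_c :: "complex^(2 + 2)^(2 + 2) \<Rightarrow> complex^2^2" where
  "block_c h = (\<chi> i j. h $ Inr i $ Inl j)"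

definition block_d :: "complex^(2 + 2)^(2 + 2) \<Rightarrow> complex^2^2" where
  "block_d h = (\<chi> i j. h $ Inr i $ Inr j)"

definition pi_l :: "complex^(2 + 2)^(2 + 2) \<Rightarrow> (complex^2^2 \<Rightarrow> complex^2) \<Rightarrow> complex^2^2 \<Rightarrow> complex^2" where
  "pi_l h f Z =
    (let W = block_a h - Z ** block_c h
     in inverse (qnorm W) *s (W *v f (matrix_inv W ** (Z ** block_d h - block_b h))))"

text \<open>The blocks in \<open>pi_r\<close> are those of the inverse of \<open>h\<close>.\<close>

definition pi_r :: "complex^(2 + 2)^(2 + 2) \<Rightarrow> (complex^2^2 \<Rightarrow> complex^2) \<Rightarrow> complex^2^2 \<Rightarrow> complex^2" where
  "pi_r h g Z =
    (let k = matrix_inv h; W = block_c k ** Z + block_d k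
     in inverse (qnorm W) *s (g ((block_a k ** Z + block_b k) ** matrix_inv W) v* W))"

definition matrix_exp :: "complex^'n^'n \<Rightarrow> complex^'n^'n" where
  "matrix_exp A = (\<Sum>n. (1 / fact n) *\<^sub>R (((**) A ^^ n) (mat 1)))"

definition pi_l_Lie :: "complex^(2 + 2)^(2 + 2) \<Rightarrow> (complex^2^2 \<Rightarrow> complex^2) \<Rightarrow> complex^2^2 \<Rightarrow> complex^2" where
  "pi_l_Lie Y f Z = (if qnorm Z = 0 then 0
    else vector_derivative (\<lambda>t. pi_l (matrix_exp (t *\<^sub>R Y)) f Z) (at 0))"

definition pi_r_Lie :: "complex^(2 + 2)^(2 + 2) \<Rightarrow> (complex^2^2 \<Rightarrow> complex^2) \<Rightarrow> complex^2^2 \<Rightarrow> complex^2" where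
  "pi_r_Lie Y g Z = (if qnorm Z = 0 then 0
    else vector_derivative (\<lambda>t. pi_r (matrix_exp (t *\<^sub>R Y)) g Z) (at 0))"

definition SU2_SU2 :: "(complex^(2 + 2)^(2 + 2)) set" where
  "SU2_SU2 = {h. block_b h = 0 \<and> block_c h = 0 \<and>
    block_a h \<in> real_quaternions \<and> qnorm (block_a h) = 1 \<and>
    block_d h \<in> real_quaternions \<and> qnorm (block_d h) = 1}"


section \<open>The pairing\<close>

definition QR_pairing :: "real \<Rightarrow> (complex^2^2 \<Rightarrow> complex^2) \<Rightarrow> (complex^2^2 \<Rightarrow> complex^2) \<Rightarrow> complex" where
  "QR_pairing R f g =
    1 / (8 * of_real pi ^ 2) *
      (LINT X|S3_measure R. row_col (qdeg g X) (nabla f X) / of_real R)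
    - 1 / (8 * of_real pi ^ 2) *
      (LINT X|S3_measure R. row_col (g X) (qdeg (nabla f) X) / of_real R)
    - of_real R / (8 * of_real pi ^ 2) *
      (LINT X|S3_measure R. row_col (qbox g X v* matrix_inv X) (f X))"

definition bilinear_on ::
  "(complex^2^2 \<Rightarrow> complex^2) set \<Rightarrow> (complex^2^2 \<Rightarrow> complex^2) set \<Rightarrow>
    ((complex^2^2 \<Rightarrow> complex^2) \<Rightarrow> (complex^2^2 \<Rightarrow> complex^2) \<Rightarrow> complex) \<Rightarrow> bool" where
  "bilinear_on A B \<beta> \<longleftrightarrow>
    (\<forall>f1\<in>A. \<forall>f2\<in>A. \<forall>g\<in>B. \<forall>c1 c2.
      \<beta> (\<lambda>Z. c1 *s f1 Z + c2 *s f2 Z) g = c1 * \<beta> f1 g + c2 * \<beta> f2 g) \<and>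
    (\<forall>f\<in>A. \<forall>g1\<in>B. \<forall>g2\<in>B. \<forall>c1 c2.
      \<beta> f (\<lambda>Z. c1 *s g1 Z + c2 *s g2 Z) = c1 * \<beta> f g1 + c2 * \<beta> f g2)"

definition nondegenerate_on ::
  "(complex^2^2 \<Rightarrow> complex^2) set \<Rightarrow> (complex^2^2 \<Rightarrow> complex^2) set \<Rightarrow>
    ((complex^2^2 \<Rightarrow> complex^2) \<Rightarrow> (complex^2^2 \<Rightarrow> complex^2) \<Rightarrow> complex) \<Rightarrow> bool" where
  "nondegenerate_on A B \<beta> \<longleftrightarrow>
    (\<forall>f\<in>A. (\<forall>g\<in>B. \<beta> f g = 0) \<longrightarrow> f = (\<lambda>Z. 0)) \<and>
    (\<forall>g\<in>B. (\<forall>f\<in>A. \<beta> f g = 0) \<longrightarrow> g = (\<lambda>Z. 0))"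

end

theory Submission
  imports Defs "HOL-Complex_Analysis.Complex_Singularities"
begin

text \<open>
  In the matrix entries \<open>z\<^sub>a\<^sub>b\<close> the operator \<open>\<nabla>\<close> is the matrix with entries \<open>2 \<partial>/\<partial>z\<^sub>b\<^sub>a\<close> and
  \<open>\<box>\<close> is four times the determinant of the partial derivatives, so the statement turns into algebra in the
  ring \<open>\<complex>[z\<^sub>a\<^sub>b, N\<^sup>-\<^sup>1]\<close> together with linear functionals on it, the integrals over the spheres.
  Up to the constant \<open>1/(4 \<pi>\<^sup>2 R)\<close> the pairing is the integral over \<open>S3 R\<close> of the bilinear differential
  expression \<open>Q f g\<close> (\<open>QR_pairing_fn\<close>), and the pairing of elements of degrees \<open>m\<close> and \<open>n\<close> scales like
  \<open>R\<close> to the power \<open>m + n + 1\<close>.  So everything but the decomposition into degrees happens on the unit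
  sphere.  Invariance under the compact group is the equivariance of \<open>Q\<close> (\<open>Q_rot\<close>).

  The other claims rest on the divergence theorem \<open>divergence_theorem\<close> for homogeneous Laurent
  polynomials, which follows from the rotation invariance of the integral, and on its invariance under
  quaternionic conjugation.
  The expression \<open>Q f g\<close> is the radial component of a current (\<open>current_radial\<close>) whose
  divergence vanishes when \<open>f\<close> and \<open>g\<close> satisfy the differential equations of the two spaces
  (\<open>current_divergence\<close>).  Hence the integral of \<open>Q f g\<close> is zero unless \<open>m + n = -1\<close>
  (\<open>sint_Q_degree\<close>), and in that case it does not depend on the radius.

  The Lie algebra acts by vector fields with coefficients of degree 0, 1 and 2 in \<open>Z\<close>, according to the blocks.
  Translations commute with the formation of the current, so their invariance is again the
  divergence theorem (\<open>sint_Q_translation\<close>); for the diagonal blocks \<open>Q\<close> is equivariant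
  pointwise, and the total contribution is proportional to \<open>m + n + 1\<close> (\<open>sint_Q_diag\<close>);
  the inversion \<open>Z \<mapsto> Z\<^sup>-\<^sup>1\<close> exchanges degree \<open>m\<close> with \<open>-1 - m\<close>, preserves the pairing
  (\<open>sint_Q_inversion\<close>) and carries translations to the remaining block (\<open>sint_Q_quad\<close>).

  For non-degeneracy, the derivatives of an element in the radical are in the radical, so degree \<open>m > 0\<close> descends
  to degree \<open>0\<close>.  There all elements are constants, because a biharmonic Laurent
  polynomial of degree 0 has no denominator (\<open>biharmonic_degree_zero\<close>), and constants are
  detected by the columns and rows of \<open>Z / N(Z)\<close>.  Negative degrees follow by inversion.
\<close>

section \<open>The ring of Laurent polynomials\<close>

definition laurent_monomial :: "(4 \<Rightarrow> nat) \<times> nat \<Rightarrow> complex^2^2 \<Rightarrow> complex" where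
  "laurent_monomial p Z = (if qnorm Z = 0 then 0
     else (\<Prod>j\<in>UNIV. qcoord j Z ^ fst p j) * inverse (qnorm Z) ^ snd p)"

lemma laurent_iff_sum_monomials:
  "F \<in> laurent_polynomials \<longleftrightarrow> (\<exists>M c. finite M \<and> F = (\<lambda>Z. \<Sum>p\<in>M. c p * laurent_monomial p Z))"
proof -
  have "(if qnorm Z = 0 then 0 else \<Sum>(m, k)\<in>M. c (m, k) * (\<Prod>j\<in>UNIV. qcoord j Z ^ m j) * inverse (qnorm Z) ^ k)
     = (\<Sum>p\<in>M. c p * laurent_monomial p Z)" for M c Z
    by (auto simp: laurent_monomial_def case_prod_unfold mult.assoc intro!: sum.cong)
  then show ?thesis by (simp add: laurent_polynomials_def fun_eq_iff)
qed

lemma laurent_monomial_in: "laurent_monomial p \<in> laurent_polynomials"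
  unfolding laurent_iff_sum_monomials by (rule exI[of _ "{p}"], rule exI[of _ "\<lambda>_. 1"]) simp

lemma laurent_zero: "(\<lambda>Z. 0) \<in> laurent_polynomials"
  unfolding laurent_iff_sum_monomials by (rule exI[of _ "{}"]) simp

lemma laurent_scale:
  assumes "F \<in> laurent_polynomials" shows "(\<lambda>Z. c * F Z) \<in> laurent_polynomials"
proof -
  obtain M b where "finite M" "F = (\<lambda>Z. \<Sum>p\<in>M. b p * laurent_monomial p Z)"
    using assms unfolding laurent_iff_sum_monomials by auto
  then show ?thesis unfolding laurent_iff_sum_monomials
    by (intro exI[of _ M] exI[of _ "\<lambda>p. c * b p"]) (simp add: sum_distrib_left mult.assoc)
qed

lemma laurent_add:
  assumes "F \<in> laurent_polynomials" "G \<in> laurent_polynomials"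
  shows "(\<lambda>Z. F Z + G Z) \<in> laurent_polynomials"
proof -
  obtain M b where F: "finite M" "F = (\<lambda>Z. \<Sum>p\<in>M. b p * laurent_monomial p Z)"
    using assms unfolding laurent_iff_sum_monomials by auto
  obtain K c where G: "finite K" "G = (\<lambda>Z. \<Sum>p\<in>K. c p * laurent_monomial p Z)"
    using assms unfolding laurent_iff_sum_monomials by auto
  let ?e = "\<lambda>p. (if p \<in> M then b p else 0) + (if p \<in> K then c p else 0)"
  have "(\<Sum>p\<in>M \<union> K. (if p \<in> M then b p else 0) * laurent_monomial p Z) = F Z" for Z
    unfolding F(2) using F(1) G(1) by (intro sum.mono_neutral_cong_right) auto
  moreover have "(\<Sum>p\<in>M \<union> K. (if p \<in> K then c p else 0) * laurent_monomial p Z) = G Z" for Z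
    unfolding G(2) using F(1) G(1) by (intro sum.mono_neutral_cong_right) auto
  ultimately have "(\<lambda>Z. F Z + G Z) = (\<lambda>Z. \<Sum>p\<in>M \<union> K. ?e p * laurent_monomial p Z)"
    by (simp add: distrib_right sum.distrib)
  then show ?thesis unfolding laurent_iff_sum_monomials using F(1) G(1)
    by (intro exI[of _ "M \<union> K"] exI[of _ ?e]) simp
qed

lemma laurent_sum:
  assumes "\<And>i. i \<in> S \<Longrightarrow> F i \<in> laurent_polynomials"
  shows "(\<lambda>Z. \<Sum>i\<in>S. F i Z) \<in> laurent_polynomials"
  using assms by (induction S rule: infinite_finite_induct) (simp_all add: laurent_zero laurent_add)

lemma laurent_mult_monomial:
  assumes "F \<in> laurent_polynomials"
  shows "(\<lambda>Z. laurent_monomial q Z * F Z) \<in> laurent_polynomials"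
proof -
  obtain M b where F: "finite M" "F = (\<lambda>Z. \<Sum>p\<in>M. b p * laurent_monomial p Z)"
    using assms unfolding laurent_iff_sum_monomials by auto
  let ?s = "\<lambda>p::(4 \<Rightarrow> nat) \<times> nat. ((\<lambda>j. fst q j + fst p j), snd q + snd p)"
  have "laurent_monomial q Z * laurent_monomial p Z = laurent_monomial (?s p) Z" for p Z
    by (simp add: laurent_monomial_def power_add prod.distrib)
  then have "laurent_monomial q Z * F Z = (\<Sum>p\<in>M. b p * laurent_monomial (?s p) Z)" for Z
    unfolding F(2) sum_distrib_left by (simp add: mult.left_commute[of "laurent_monomial q Z"])
  then have "(\<lambda>Z. laurent_monomial q Z * F Z) = (\<lambda>Z. \<Sum>p\<in>M. b p * laurent_monomial (?s p) Z)"
    by (rule ext)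
  moreover have "(\<lambda>Z. \<Sum>p\<in>M. b p * laurent_monomial (?s p) Z) \<in> laurent_polynomials"
    by (intro laurent_sum laurent_scale laurent_monomial_in)
  ultimately show ?thesis by simp
qed

lemma laurent_mult:
  assumes "F \<in> laurent_polynomials" "G \<in> laurent_polynomials"
  shows "(\<lambda>Z. F Z * G Z) \<in> laurent_polynomials"
proof -
  obtain M b where F: "finite M" "F = (\<lambda>Z. \<Sum>p\<in>M. b p * laurent_monomial p Z)"
    using assms unfolding laurent_iff_sum_monomials by auto
  have "(\<lambda>Z. F Z * G Z) = (\<lambda>Z. \<Sum>p\<in>M. b p * (laurent_monomial p Z * G Z))"
    by (simp add: F(2) sum_distrib_right mult.assoc)
  also have "\<dots> \<in> laurent_polynomials"
    by (intro laurent_sum laurent_scale laurent_mult_monomial assms)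
  finally show ?thesis .
qed

lemma laurent_const: "(\<lambda>Z. if qnorm Z = 0 then 0 else c) \<in> laurent_polynomials"
proof -
  have "(\<lambda>Z. if qnorm Z = 0 then 0 else c) = (\<lambda>Z. c * laurent_monomial ((\<lambda>_. 0), 0) Z)"
    by (auto simp: laurent_monomial_def)
  then show ?thesis by (simp only: laurent_scale laurent_monomial_in)
qed

lemma laurent_entry: "(\<lambda>Z. if qnorm Z = 0 then 0 else Z $ a $ b) \<in> laurent_polynomials"
proof -
  have "(\<Prod>j\<in>UNIV. qcoord j Z ^ (if j = k then 1 else 0)) = qcoord k Z" for k Z
    by (subst prod.remove[of _ k]) auto
  then have m: "laurent_monomial ((\<lambda>j. if j = k then 1 else 0), 0) Z = (if qnorm Z = 0 then 0 else qcoord k Z)" for k Z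
    by (simp add: laurent_monomial_def)
  have e: "Z $ a $ b = (\<Sum>k\<in>UNIV. qunit k $ a $ b * qcoord k Z)" for Z
    by (subst qcoord_expansion) (simp add: cscale_def mult.commute)
  have "(\<lambda>Z. if qnorm Z = 0 then 0 else Z $ a $ b) =
     (\<lambda>Z. \<Sum>k\<in>UNIV. qunit k $ a $ b * laurent_monomial ((\<lambda>j. if j = k then 1 else 0), 0) Z)"
  proof
    fix Z :: "complex^2^2"
    show "(if qnorm Z = 0 then 0 else Z $ a $ b) =
      (\<Sum>k\<in>UNIV. qunit k $ a $ b * laurent_monomial ((\<lambda>j. if j = k then 1 else 0), 0) Z)"
      unfolding m e[of Z] by simp
  qed
  then show ?thesis by (simp only: laurent_sum laurent_scale laurent_monomial_in)
qed

lemma laurent_inverse_norm: "(\<lambda>Z. inverse (qnorm Z)) \<in> laurent_polynomials"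
proof -
  have "(\<lambda>Z. inverse (qnorm Z)) = laurent_monomial ((\<lambda>_. 0), 1)"
    by (auto simp: laurent_monomial_def)
  then show ?thesis by (simp only: laurent_monomial_in)
qed

text \<open>As a type of its own, the ring of Laurent polynomials is open to the simplifier and to
  Groebner bases; every pointwise side condition \<open>qnorm Z \<noteq> 0\<close> disappears.\<close>

typedef laurent = laurent_polynomials
  morphisms ev Abs_laurent
  by (rule exI, rule laurent_zero)

setup_lifting type_definition_laurent

instantiation laurent :: comm_ring_1
begin
lift_definition zero_laurent :: laurent is "\<lambda>Z. 0" by (rule laurent_zero)
lift_definition one_laurent :: laurent is "\<lambda>Z. if qnorm Z = 0 then 0 else 1" by (rule laurent_const)
lift_definition plus_laurent :: "laurent \<Rightarrow> laurent \<Rightarrow> laurent" is "\<lambda>F G Z. F Z + G Z" by (rule laurent_add)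
lift_definition times_laurent :: "laurent \<Rightarrow> laurent \<Rightarrow> laurent" is "\<lambda>F G Z. F Z * G Z" by (rule laurent_mult)
lift_definition uminus_laurent :: "laurent \<Rightarrow> laurent" is "\<lambda>F Z. (-1) * F Z" by (rule laurent_scale)
lift_definition minus_laurent :: "laurent \<Rightarrow> laurent \<Rightarrow> laurent" is "\<lambda>F G Z. F Z + (-1) * G Z"
  by (intro laurent_add laurent_scale)
lemma laurent_off_cone: "F \<in> laurent_polynomials \<Longrightarrow> qnorm Z = 0 \<Longrightarrow> F Z = 0"
  unfolding laurent_polynomials_def by auto
instance
proof
  fix F G H :: laurent
  show "1 * F = F"
    by transfer (auto simp: laurent_off_cone)
  show "(0::laurent) \<noteq> 1"
  proof
    assume "(0::laurent) = 1"
    then have "(0::complex) = (if qnorm (mat 1 :: complex^2^2) = 0 then 0 else 1)"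
      by transfer metis
    then show False by simp
  qed
qed (transfer; simp add: algebra_simps)+
end

lift_definition cst :: "complex \<Rightarrow> laurent" is "\<lambda>c Z. if qnorm Z = 0 then 0 else c" by (rule laurent_const)
lift_definition zz :: "2 \<Rightarrow> 2 \<Rightarrow> laurent" is "\<lambda>a b Z. if qnorm Z = 0 then 0 else Z $ a $ b" by (rule laurent_entry)
lift_definition Ninv :: laurent is "\<lambda>Z. inverse (qnorm Z)" by (rule laurent_inverse_norm)

definition NN :: laurent where "NN = zz 1 1 * zz 2 2 - zz 1 2 * zz 2 1"

lemma ev_off_cone [simp]: "qnorm Z = 0 \<Longrightarrow> ev F Z = 0"
  by transfer (rule laurent_off_cone)

lemma ev_simps [simp]:
  "ev 0 Z = 0" "ev (F + G) Z = ev F Z + ev G Z" "ev (F - G) Z = ev F Z - ev G Z"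
  "ev (- F) Z = - ev F Z" "ev (F * G) Z = ev F Z * ev G Z" "ev Ninv Z = inverse (qnorm Z)"
  by (transfer; simp)+

lemma ev_on [simp]:
  assumes "qnorm Z \<noteq> 0"
  shows "ev 1 Z = 1" "ev (cst c) Z = c" "ev (zz a b) Z = Z $ a $ b"
  using assms by (transfer; simp)+

lemma ev_sum [simp]: "ev (\<Sum>i\<in>S. F i) Z = (\<Sum>i\<in>S. ev (F i) Z)"
  by (induction S rule: infinite_finite_induct) auto

lemma ev_NN [simp]: "qnorm Z \<noteq> 0 \<Longrightarrow> ev NN Z = qnorm Z"
  by (simp add: NN_def det_2)

lemma ev_of_nat: "qnorm Z \<noteq> 0 \<Longrightarrow> ev (of_nat n) Z = of_nat n"
  by (induction n) auto

lemma ev_of_int [simp]: "qnorm Z \<noteq> 0 \<Longrightarrow> ev (of_int n) Z = of_int n"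
  by (cases n rule: int_diff_cases) (simp add: ev_of_nat)

lemma ev_numeral [simp]: "qnorm Z \<noteq> 0 \<Longrightarrow> ev (numeral n) Z = numeral n"
  using ev_of_nat[of Z "numeral n"] by simp

lemma ev_power [simp]: "qnorm Z \<noteq> 0 \<Longrightarrow> ev (F ^ n) Z = ev F Z ^ n"
  by (induction n) auto

lemma laurent_eqI: "(\<And>Z. qnorm Z \<noteq> 0 \<Longrightarrow> ev F Z = ev G Z) \<Longrightarrow> F = G"
  by (metis ev_inject ev_off_cone ext)

lemma cst_simps [simp]:
  "cst 0 = 0" "cst 1 = 1" "cst (a + b) = cst a + cst b" "cst (a - b) = cst a - cst b"
  "cst (- a) = - cst a" "cst (a * b) = cst a * cst b" "cst (of_int n) = of_int n" "cst (numeral k) = numeral k"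
  by (auto intro!: laurent_eqI)

lemma NN_Ninv [simp]: "NN * Ninv = 1" "Ninv * NN = 1"
  by (auto intro!: laurent_eqI)

text \<open>A property of all Laurent polynomials may be checked on generators.  This is how identities for
  derivations and substitutions are proved below.\<close>

lemma laurent_induct [case_names cst zz Ninv add mult]:
  assumes c: "\<And>c. P (cst c)" and z: "\<And>a b. P (zz a b)" and i: "P Ninv"
    and a: "\<And>F G. P F \<Longrightarrow> P G \<Longrightarrow> P (F + G)" and m: "\<And>F G. P F \<Longrightarrow> P G \<Longrightarrow> P (F * G)"
  shows "P F"
proof -
  have one: "P 1" using c[of 1] by simp
  have zero: "P 0" using c[of 0] by simp
  have sm: "P (\<Sum>i\<in>S. G i)" if "\<And>i. P (G i)" for S :: "'b set" and G
    by (induction S rule: infinite_finite_induct) (auto intro: a zero that)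
  have pr: "P (\<Prod>i\<in>S. G i)" if "\<And>i. P (G i)" for S :: "'b set" and G
    by (induction S rule: infinite_finite_induct) (auto intro: m one that)
  have pw: "P (G ^ n)" if "P G" for G n
    by (induction n) (auto intro: m one that)
  define q where "q j = (if j = 0 then cst (1/2) * (zz 1 1 + zz 2 2)
     else if j = 1 then cst (\<i>/2) * (zz 1 2 + zz 2 1)
     else if j = 2 then cst (1/2) * (zz 2 1 + cst (-1) * zz 1 2)
     else cst (\<i>/2) * (zz 1 1 + cst (-1) * zz 2 2))" for j :: 4
  have Pq: "P (q j)" for j
    unfolding q_def by (auto intro!: m a c z simp del: cst_simps)
  have evq: "ev (q j) Z = qcoord j Z" if "qnorm Z \<noteq> 0" for j Z
    using that by (simp add: q_def qcoord_def)
  have evp: "ev (\<Prod>j\<in>S. G j) Z = (\<Prod>j\<in>S. ev (G j) Z)" if "qnorm Z \<noteq> 0" for G Z and S :: "4 set"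
    using that by (induction S rule: infinite_finite_induct) auto
  obtain M b where F: "finite M" "ev F = (\<lambda>Z. \<Sum>p\<in>M. b p * laurent_monomial p Z)"
    using ev[of F] unfolding laurent_iff_sum_monomials by auto
  have "F = (\<Sum>p\<in>M. cst (b p) * ((\<Prod>j\<in>UNIV. q j ^ fst p j) * Ninv ^ snd p))"
    by (rule laurent_eqI) (simp add: F(2) evp evq laurent_monomial_def)
  also have "P \<dots>"
    by (intro sm m c pr pw Pq i)
  finally show ?thesis .
qed

section \<open>Partial derivatives\<close>

text \<open>The gradient is introduced through the Frechet derivative, so that the chain rule applies to
  complex lines, to real curves and to one-parameter groups alike.\<close>

definition lin :: "(2 \<Rightarrow> 2 \<Rightarrow> complex) \<Rightarrow> complex^2^2 \<Rightarrow> complex" where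
  "lin G H = (\<Sum>a\<in>UNIV. \<Sum>b\<in>UNIV. H $ a $ b * G a b)"

definition has_gradient :: "laurent \<Rightarrow> (2 \<Rightarrow> 2 \<Rightarrow> laurent) \<Rightarrow> bool" where
  "has_gradient F G \<longleftrightarrow> (\<forall>Z. qnorm Z \<noteq> 0 \<longrightarrow> (ev F has_derivative lin (\<lambda>a b. ev (G a b) Z)) (at Z))"

lemma open_off_cone: "open {Z :: complex^2^2. qnorm Z \<noteq> 0}"
proof -
  have "continuous_on UNIV (\<lambda>Z :: complex^2^2. qnorm Z)"
    unfolding det_2 by (intro continuous_intros)
  from open_Collect_neq[OF this continuous_on_const[of _ 0]] show ?thesis by simp
qed

lemma eventually_off_cone: "qnorm Z \<noteq> 0 \<Longrightarrow> eventually (\<lambda>W :: complex^2^2. qnorm W \<noteq> 0) (nhds Z)"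
  using eventually_nhds_in_open[OF open_off_cone, of Z] by simp

lemma has_derivative_off_cone:
  assumes "qnorm Z \<noteq> 0" and "(f has_derivative f') (at Z)" and "\<And>W. qnorm W \<noteq> 0 \<Longrightarrow> f W = g W"
  shows "(g has_derivative f') (at Z)"
  using assms(2)
  by (rule has_derivative_transform_eventually)
     (use assms eventually_off_cone[OF assms(1)] in \<open>auto simp: eventually_at_filter elim: eventually_mono\<close>)

lemma entry_has_derivative: "((\<lambda>Z :: complex^2^2. Z $ a $ b) has_derivative (\<lambda>H. H $ a $ b)) (at Z)"
  by (rule bounded_linear_imp_has_derivative)
     (rule bounded_linear_compose[OF bounded_linear_vec_nth bounded_linear_vec_nth])

lemma lin_zero [simp]: "lin (\<lambda>a b. 0) = (\<lambda>H. 0)"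
  by (simp add: lin_def[abs_def] fun_eq_iff)

lemma has_gradient_cst: "has_gradient (cst c) (\<lambda>a b. 0)"
  unfolding has_gradient_def
  by (intro allI impI, rule has_derivative_off_cone[where f="\<lambda>_. c"]) auto

lemma has_gradient_zz: "has_gradient (zz c d) (\<lambda>a b. if a = c \<and> b = d then 1 else 0)"
  unfolding has_gradient_def
proof (intro allI impI, rule has_derivative_off_cone[where f="\<lambda>Z. Z $ c $ d"])
  fix Z :: "complex^2^2" assume Z: "qnorm Z \<noteq> 0"
  have "lin (\<lambda>a b. ev (if a = c \<and> b = d then 1 else 0) Z) = (\<lambda>H. H $ c $ d)"
    using Z exhaust_2[of c] exhaust_2[of d] by (auto simp: lin_def fun_eq_iff sum_2)
  then show "((\<lambda>Z. Z $ c $ d) has_derivative lin (\<lambda>a b. ev (if a = c \<and> b = d then 1 else 0) Z)) (at Z)"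
    by (simp only: entry_has_derivative)
qed auto

lemma has_gradient_add:
  assumes "has_gradient F F'" "has_gradient G G'"
  shows "has_gradient (F + G) (\<lambda>a b. F' a b + G' a b)"
  unfolding has_gradient_def
proof (intro allI impI, rule has_derivative_off_cone[where f="\<lambda>Z. ev F Z + ev G Z"])
  fix Z :: "complex^2^2" assume Z: "qnorm Z \<noteq> 0"
  have "((\<lambda>Z. ev F Z + ev G Z) has_derivative (\<lambda>H. lin (\<lambda>a b. ev (F' a b) Z) H + lin (\<lambda>a b. ev (G' a b) Z) H)) (at Z)"
    using assms Z unfolding has_gradient_def by (intro has_derivative_add) auto
  then show "((\<lambda>Z. ev F Z + ev G Z) has_derivative lin (\<lambda>a b. ev (F' a b + G' a b) Z)) (at Z)"
    by (simp add: lin_def[abs_def] sum.distrib algebra_simps)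
qed auto

lemma has_gradient_mult:
  assumes "has_gradient F F'" "has_gradient G G'"
  shows "has_gradient (F * G) (\<lambda>a b. F' a b * G + F * G' a b)"
  unfolding has_gradient_def
proof (intro allI impI, rule has_derivative_off_cone[where f="\<lambda>Z. ev F Z * ev G Z"])
  fix Z :: "complex^2^2" assume Z: "qnorm Z \<noteq> 0"
  have "((\<lambda>Z. ev F Z * ev G Z) has_derivative (\<lambda>H. ev F Z * lin (\<lambda>a b. ev (G' a b) Z) H + lin (\<lambda>a b. ev (F' a b) Z) H * ev G Z)) (at Z)"
    using assms Z unfolding has_gradient_def by (intro has_derivative_mult) auto
  then show "((\<lambda>Z. ev F Z * ev G Z) has_derivative lin (\<lambda>a b. ev (F' a b * G + F * G' a b) Z)) (at Z)"
    by (simp add: lin_def[abs_def] sum_2 algebra_simps)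
qed auto

lemma has_gradient_uminus:
  assumes "has_gradient F F'" shows "has_gradient (- F) (\<lambda>a b. - F' a b)"
  using has_gradient_mult[OF has_gradient_cst[of "-1"] assms] by simp

lemma has_gradient_NN: "\<exists>G. has_gradient NN G"
  unfolding NN_def diff_conv_add_uminus
  by (rule exI, rule has_gradient_add[OF has_gradient_mult[OF has_gradient_zz has_gradient_zz]
        has_gradient_uminus[OF has_gradient_mult[OF has_gradient_zz has_gradient_zz]]])

lemma has_gradient_Ninv:
  assumes "has_gradient NN G" shows "has_gradient Ninv (\<lambda>a b. - (Ninv * Ninv * G a b))"
  unfolding has_gradient_def
proof (intro allI impI, rule has_derivative_off_cone[where f="\<lambda>Z. inverse (ev NN Z)"])
  fix Z :: "complex^2^2" assume Z: "qnorm Z \<noteq> 0"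
  have "((\<lambda>Z. inverse (ev NN Z)) has_derivative (\<lambda>H. - (inverse (ev NN Z) * lin (\<lambda>a b. ev (G a b) Z) H * inverse (ev NN Z)))) (at Z)"
    using assms Z unfolding has_gradient_def by (intro Deriv.has_derivative_inverse) auto
  then show "((\<lambda>Z. inverse (ev NN Z)) has_derivative lin (\<lambda>a b. ev (- (Ninv * Ninv * G a b)) Z)) (at Z)"
    using Z by (simp add: lin_def[abs_def] sum_2 algebra_simps)
qed auto

lemma ex_gradient: "\<exists>G. has_gradient F G"
proof (induction F rule: laurent_induct)
  case Ninv
  obtain G where "has_gradient NN G" using has_gradient_NN ..
  from has_gradient_Ninv[OF this] show ?case by blast
next
  case (add F G)
  then obtain F' G' where "has_gradient F F'" "has_gradient G G'" by auto
  from has_gradient_add[OF this] show ?case by blast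
next
  case (mult F G)
  then obtain F' G' where "has_gradient F F'" "has_gradient G G'" by auto
  from has_gradient_mult[OF this] show ?case by blast
qed (rule exI, rule has_gradient_cst has_gradient_zz)+

text \<open>\<open>d a b\<close> is the derivative with respect to the matrix entry in row \<open>a\<close>, column \<open>b\<close>.\<close>

definition d :: "2 \<Rightarrow> 2 \<Rightarrow> laurent \<Rightarrow> laurent" where
  "d a b F = (SOME G. has_gradient F G) a b"

lemma has_gradient_d: "has_gradient F (\<lambda>a b. d a b F)"
  unfolding d_def by (rule someI_ex[OF ex_gradient])

lemma has_gradient_unique:
  assumes "has_gradient F G" shows "d a b F = G a b"
proof (rule laurent_eqI)
  fix Z :: "complex^2^2" assume Z: "qnorm Z \<noteq> 0"
  have "lin (\<lambda>a b. ev (d a b F) Z) = lin (\<lambda>a b. ev (G a b) Z)"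
    using assms has_gradient_d[of F] Z unfolding has_gradient_def
    by (intro has_derivative_unique[of "ev F" _ Z]) auto
  from fun_cong[OF this, of "axis a (axis b 1)"]
  show "ev (d a b F) Z = ev (G a b) Z"
    using exhaust_2[of a] exhaust_2[of b] by (auto simp: lin_def sum_2 axis_def)
qed

lemma d_cst [simp]: "d a b (cst x) = 0"
  and d_zz: "d a b (zz c e) = (if a = c \<and> b = e then 1 else 0)"
  and d_add [simp]: "d a b (F + G) = d a b F + d a b G"
  and d_mult [simp]: "d a b (F * G) = d a b F * G + F * d a b G"
  and d_uminus [simp]: "d a b (- F) = - d a b F"
  and d_Ninv: "d a b Ninv = - (Ninv * Ninv * d a b NN)"
  by (rule has_gradient_unique has_gradient_cst has_gradient_zz has_gradient_add has_gradient_mult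
      has_gradient_uminus has_gradient_Ninv has_gradient_d)+

lemma d_consts [simp]: "d a b 0 = 0" "d a b 1 = 0" "d a b (of_int n) = 0" "d a b (numeral k) = 0"
  using d_cst[of a b 0] d_cst[of a b 1] d_cst[of a b "of_int n"] d_cst[of a b "numeral k"]
  by (simp_all del: d_cst)

lemma d_diff [simp]: "d a b (F - G) = d a b F - d a b G"
  unfolding diff_conv_add_uminus d_add d_uminus ..

lemma d_sum [simp]: "d a b (\<Sum>i\<in>S. F i) = (\<Sum>i\<in>S. d a b (F i))"
  by (induction S rule: infinite_finite_induct) auto

lemma d_zz_simps [simp]:
  "d 1 1 (zz 1 1) = 1" "d 1 1 (zz 1 2) = 0" "d 1 1 (zz 2 1) = 0" "d 1 1 (zz 2 2) = 0"
  "d 1 2 (zz 1 1) = 0" "d 1 2 (zz 1 2) = 1" "d 1 2 (zz 2 1) = 0" "d 1 2 (zz 2 2) = 0"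
  "d 2 1 (zz 1 1) = 0" "d 2 1 (zz 1 2) = 0" "d 2 1 (zz 2 1) = 1" "d 2 1 (zz 2 2) = 0"
  "d 2 2 (zz 1 1) = 0" "d 2 2 (zz 1 2) = 0" "d 2 2 (zz 2 1) = 0" "d 2 2 (zz 2 2) = 1"
  by (simp_all add: d_zz)

lemma d_NN [simp]: "d 1 1 NN = zz 2 2" "d 2 2 NN = zz 1 1" "d 1 2 NN = - zz 2 1" "d 2 1 NN = - zz 1 2"
  by (simp_all add: NN_def)

lemma d_commute: "d a b (d c e F) = d c e (d a b F)"
proof (induction F rule: laurent_induct)
  case Ninv
  have "d a b (d c e NN) = d c e (d a b NN)" by (simp add: NN_def d_zz)
  then show ?case by (simp add: d_Ninv algebra_simps)
qed (simp_all add: d_zz algebra_simps)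

lemma d_order [simp]:
  "d 1 2 (d 1 1 F) = d 1 1 (d 1 2 F)" "d 2 1 (d 1 1 F) = d 1 1 (d 2 1 F)"
  "d 2 2 (d 1 1 F) = d 1 1 (d 2 2 F)" "d 2 1 (d 1 2 F) = d 1 2 (d 2 1 F)"
  "d 2 2 (d 1 2 F) = d 1 2 (d 2 2 F)" "d 2 2 (d 2 1 F) = d 2 1 (d 2 2 F)"
  by (rule d_commute)+


section \<open>The differential operators in matrix entries\<close>

text \<open>The factors of two are left out: \<open>\<box> = 4 lap\<close>, \<open>\<nabla> f = 2 dirac f\<close> and \<open>g \<nabla> = 2 dirac' g\<close>, and \<open>Q\<close>
  is half of the integrand of the pairing on the unit sphere.  Homogeneity is Euler's equation, which is
  stable under all algebraic operations.\<close>

definition deg :: "laurent \<Rightarrow> laurent" where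
  "deg F = zz 1 1 * d 1 1 F + zz 1 2 * d 1 2 F + zz 2 1 * d 2 1 F + zz 2 2 * d 2 2 F"

definition lap :: "laurent \<Rightarrow> laurent" where
  "lap F = d 1 1 (d 2 2 F) - d 1 2 (d 2 1 F)"

definition dirac :: "(2 \<Rightarrow> laurent) \<Rightarrow> 2 \<Rightarrow> laurent" where
  "dirac f b = d 1 b (f 1) + d 2 b (f 2)"

definition dirac' :: "(2 \<Rightarrow> laurent) \<Rightarrow> 2 \<Rightarrow> laurent" where
  "dirac' g a = d a 1 (g 1) + d a 2 (g 2)"

definition in_U :: "(2 \<Rightarrow> laurent) \<Rightarrow> bool" where
  "in_U f \<longleftrightarrow> (\<forall>b. dirac (\<lambda>a. lap (f a)) b = 0)"

definition in_U' :: "(2 \<Rightarrow> laurent) \<Rightarrow> bool" where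
  "in_U' g \<longleftrightarrow> (\<forall>a. dirac' (\<lambda>b. lap (g b)) a = 0)"

definition hom :: "int \<Rightarrow> laurent \<Rightarrow> bool" where
  "hom n F \<longleftrightarrow> deg F = of_int n * F"

definition row_adj_col :: "(2 \<Rightarrow> laurent) \<Rightarrow> (2 \<Rightarrow> laurent) \<Rightarrow> laurent" where
  "row_adj_col g f = g 1 * (zz 2 2 * f 1 - zz 1 2 * f 2) + g 2 * (zz 1 1 * f 2 - zz 2 1 * f 1)"

definition Q :: "(2 \<Rightarrow> laurent) \<Rightarrow> (2 \<Rightarrow> laurent) \<Rightarrow> laurent" where
  "Q f g = (\<Sum>b\<in>UNIV. deg (g b) * dirac f b - g b * deg (dirac f b))
     - 2 * row_adj_col (\<lambda>a. lap (g a)) f"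

lemma deg_simps [simp]:
  "deg (F + G) = deg F + deg G" "deg (F - G) = deg F - deg G" "deg (- F) = - deg F"
  "deg (F * G) = deg F * G + F * deg G" "deg (cst c) = 0" "deg 0 = 0" "deg 1 = 0"
  "deg (of_int n) = 0" "deg (numeral k) = 0"
  "deg (zz 1 1) = zz 1 1" "deg (zz 1 2) = zz 1 2" "deg (zz 2 1) = zz 2 1" "deg (zz 2 2) = zz 2 2"
  by (simp_all add: deg_def algebra_simps)

lemma deg_NN [simp]: "deg NN = 2 * NN"
  by (simp add: deg_def NN_def)

lemma deg_d: "deg (d a b F) = d a b (deg F) - d a b F"
proof -
  consider "a = 1" "b = 1" | "a = 1" "b = 2" | "a = 2" "b = 1" | "a = 2" "b = 2"
    using exhaust_2[of a] exhaust_2[of b] by auto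
  then show ?thesis
    by cases (simp_all add: deg_def algebra_simps)
qed

lemma lap_simps [simp]:
  "lap (F + G) = lap F + lap G" "lap (F - G) = lap F - lap G" "lap (- F) = - lap F"
  "lap (cst c * F) = cst c * lap F" "lap 0 = 0" "lap (cst c) = 0"
  by (simp_all add: lap_def algebra_simps)

lemma dirac_simps [simp]:
  "dirac (\<lambda>a. f a + g a) b = dirac f b + dirac g b" "dirac (\<lambda>a. f a - g a) b = dirac f b - dirac g b"
  "dirac (\<lambda>a. - f a) b = - dirac f b"
  "dirac (\<lambda>a. cst c * f a) b = cst c * dirac f b" "dirac (\<lambda>a. 0) b = 0"
  by (simp_all add: dirac_def algebra_simps)

lemma dirac'_simps [simp]:
  "dirac' (\<lambda>a. f a + g a) b = dirac' f b + dirac' g b" "dirac' (\<lambda>a. f a - g a) b = dirac' f b - dirac' g b"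
  "dirac' (\<lambda>a. - f a) b = - dirac' f b"
  "dirac' (\<lambda>a. cst c * f a) b = cst c * dirac' f b" "dirac' (\<lambda>a. 0) b = 0"
  by (simp_all add: dirac'_def algebra_simps)

definition mixed :: "laurent \<Rightarrow> laurent \<Rightarrow> laurent" where
  "mixed F G = d 1 1 F * d 2 2 G + d 2 2 F * d 1 1 G - d 1 2 F * d 2 1 G - d 2 1 F * d 1 2 G"

lemma lap_mult: "lap (F * G) = lap F * G + F * lap G + mixed F G"
  by (simp add: lap_def mixed_def algebra_simps)

lemma lap_d: "lap (d a b F) = d a b (lap F)"
proof -
  consider "a = 1" "b = 1" | "a = 1" "b = 2" | "a = 2" "b = 1" | "a = 2" "b = 2"
    using exhaust_2[of a] exhaust_2[of b] by auto
  then show ?thesis by cases (simp_all add: lap_def)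
qed

lemma dirac_d: "dirac (\<lambda>c. d a b (f c)) e = d a b (dirac f e)"
  by (simp add: dirac_def d_commute[of a b])

lemma dirac'_d: "dirac' (\<lambda>c. d a b (f c)) e = d a b (dirac' f e)"
  by (simp add: dirac'_def d_commute[of a b])

lemma in_U_d: "in_U f \<Longrightarrow> in_U (\<lambda>c. d a b (f c))"
  by (simp add: in_U_def lap_d dirac_d)

lemma in_U'_d: "in_U' f \<Longrightarrow> in_U' (\<lambda>c. d a b (f c))"
  by (simp add: in_U'_def lap_d dirac'_d)

lemma hom_d: "hom n F \<Longrightarrow> hom (n - 1) (d a b F)"
  by (simp add: hom_def deg_d algebra_simps)

lemma hom_mult: "hom m F \<Longrightarrow> hom n G \<Longrightarrow> hom (m + n) (F * G)"
  by (simp add: hom_def algebra_simps)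

lemma hom_add: "hom m F \<Longrightarrow> hom m G \<Longrightarrow> hom m (F + G)"
  by (simp add: hom_def algebra_simps)

lemma hom_diff: "hom m F \<Longrightarrow> hom m G \<Longrightarrow> hom m (F - G)"
  by (simp add: hom_def algebra_simps)

lemma hom_uminus: "hom m F \<Longrightarrow> hom m (- F)"
  by (simp add: hom_def)

lemma hom_cst_mult: "hom m F \<Longrightarrow> hom m (cst c * F)"
  by (simp add: hom_def algebra_simps)

lemma hom_numeral_mult: "hom m F \<Longrightarrow> hom m (numeral k * F)"
  using hom_cst_mult[of m F "numeral k"] by simp

lemma hom_zz: "hom 1 (zz a b)"
  using exhaust_2[of a] exhaust_2[of b] by (auto simp: hom_def)

lemma hom_NN: "hom 2 NN" by (simp add: hom_def)

lemma deg_Ninv [simp]: "deg Ninv = - 2 * Ninv"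
proof -
  have "deg Ninv = - (Ninv * Ninv * deg NN)"
    by (simp add: deg_def d_Ninv algebra_simps)
  also have "\<dots> = - 2 * (Ninv * (Ninv * NN))"
    by (simp only: deg_NN) (simp add: mult_ac del: NN_Ninv)
  finally show ?thesis by simp
qed

lemma hom_Ninv: "hom (- 2) Ninv" by (simp add: hom_def)

lemma hom_lap: "hom n F \<Longrightarrow> hom (n - 2) (lap F)"
  unfolding lap_def using hom_d[of n F] hom_d[of "n - 1"] by (intro hom_diff) fastforce+

lemma hom_dirac: "(\<And>a. hom n (f a)) \<Longrightarrow> hom (n - 1) (dirac f b)"
  unfolding dirac_def by (intro hom_add hom_d) auto

section \<open>The conserved current\<close>

text \<open>With \<open>\<phi> = dirac f\<close>, a Green type current for the wave operator applied to \<open>\<phi>\<close> and \<open>g\<close>; the divergence of its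
  first part is \<open>2 lap g \<phi>\<close>, since \<open>lap \<phi> = 0\<close>, and the last term of \<open>current\<close> cancels this because
  \<open>lap g\<close> is annihilated by \<open>dirac'\<close>.\<close>

definition wronskian :: "2 \<Rightarrow> 2 \<Rightarrow> (2 \<Rightarrow> laurent) \<Rightarrow> (2 \<Rightarrow> laurent) \<Rightarrow> laurent" where
  "wronskian a b \<phi> g = (\<Sum>c\<in>UNIV. d a b (g c) * \<phi> c - g c * d a b (\<phi> c))"

definition current :: "(2 \<Rightarrow> laurent) \<Rightarrow> (2 \<Rightarrow> laurent) \<Rightarrow> 2 \<Rightarrow> 2 \<Rightarrow> laurent" where
  "current f g a b =
    (if a = 1 then if b = 1 then wronskian 2 2 (dirac f) g else - wronskian 2 1 (dirac f) g
     else if b = 1 then - wronskian 1 2 (dirac f) g else wronskian 1 1 (dirac f) g)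
    - 2 * (lap (g b) * f a)"

lemma current_radial: "(\<Sum>a\<in>UNIV. \<Sum>b\<in>UNIV. d a b NN * current f g a b) = Q f g"
  by (simp add: sum_2 current_def wronskian_def Q_def row_adj_col_def deg_def algebra_simps)

lemma current_divergence:
  assumes "in_U f" "in_U' g"
  shows "(\<Sum>a\<in>UNIV. \<Sum>b\<in>UNIV. d a b (current f g a b)) = 0"
proof -
  let ?p = "dirac f"
  have "lap (?p b) = dirac (\<lambda>a. lap (f a)) b" for b
    by (simp add: dirac_def lap_d)
  then have l: "lap (?p b) = 0" for b using assms(1) by (simp add: in_U_def)
  have r: "d a 1 (lap (g 1)) + d a 2 (lap (g 2)) = 0" for a
    using assms(2) by (simp add: in_U'_def dirac'_def)
  have "(\<Sum>a\<in>UNIV. \<Sum>b\<in>UNIV. d a b (current f g a b)) =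
     2 * (\<Sum>c\<in>UNIV. lap (g c) * ?p c - g c * lap (?p c)) - 2 * (\<Sum>a\<in>UNIV. \<Sum>b\<in>UNIV. d a b (lap (g b) * f a))"
    by (simp add: sum_2 current_def wronskian_def lap_def algebra_simps)
  also have "(\<Sum>a\<in>UNIV. \<Sum>b\<in>UNIV. d a b (lap (g b) * f a)) =
     (\<Sum>a\<in>UNIV. f a * (d a 1 (lap (g 1)) + d a 2 (lap (g 2)))) + (\<Sum>c\<in>UNIV. lap (g c) * ?p c)"
    by (simp add: sum_2 dirac_def algebra_simps)
  finally show ?thesis by (simp add: l r)
qed

lemma d_current: "d c e (current f g a b) =
  current (\<lambda>i. d c e (f i)) g a b + current f (\<lambda>i. d c e (g i)) a b"
  by (simp add: current_def wronskian_def sum_2 lap_d dirac_d d_commute[of c e] algebra_simps del: d_order)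

lemma hom_current:
  assumes f: "\<And>a. hom m (f a)" and g: "\<And>a. hom n (g a)"
  shows "hom (m + n - 2) (current f g a b)"
proof -
  have p: "hom (m - 1) (dirac f b)" for b by (rule hom_dirac) (rule f)
  have 1: "hom (m + n - 2) (d a b (g c) * dirac f c)" for a b c
    using hom_mult[OF hom_d[OF g] p] by (simp add: algebra_simps)
  have 2: "hom (m + n - 2) (g c * d a b (dirac f c))" for a b c
    using hom_mult[OF g hom_d[OF p]] by (simp add: algebra_simps)
  have w: "hom (m + n - 2) (wronskian a b (dirac f) g)" for a b
    unfolding wronskian_def sum_2 by (intro hom_add hom_diff 1 2)
  have "hom (m + n - 2) (lap (g b) * f a)" for a b
    using hom_mult[OF hom_lap[OF g] f] by (simp add: algebra_simps)
  then show ?thesis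
    unfolding current_def by (auto intro!: hom_diff hom_numeral_mult hom_uminus w)
qed

lemma hom_Q:
  assumes f: "\<And>a. hom m (f a)" and g: "\<And>a. hom n (g a)"
  shows "hom (m + n - 1) (Q f g)"
proof -
  have "hom 1 (d a b NN)" for a b
    using hom_d[OF hom_NN, of a b] by simp
  then have "hom (m + n - 1) (d a b NN * current f g a b)" for a b
    using hom_mult[of 1 "d a b NN", OF _ hom_current[OF f g]] by (simp add: algebra_simps)
  then show ?thesis
    unfolding current_radial[symmetric] sum_2 by (intro hom_add)
qed

lemma Q_hom:
  assumes f: "\<And>a. hom m (f a)" and g: "\<And>a. hom n (g a)"
  shows "Q f g = of_int (n - m + 1) * (\<Sum>b\<in>UNIV. g b * dirac f b) - 2 * row_adj_col (\<lambda>a. lap (g a)) f"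
proof -
  have p: "deg (dirac f b) = of_int (m - 1) * dirac f b" for b
    using hom_dirac[of m f, OF f] by (simp only: hom_def)
  have q: "deg (g b) = of_int n * g b" for b
    using g by (simp only: hom_def)
  show ?thesis unfolding Q_def p q sum_2 by (simp add: algebra_simps)
qed

lemma Q_add_left: "Q (\<lambda>a. f a + f' a) g = Q f g + Q f' g"
  and Q_add_right: "Q f (\<lambda>a. g a + g' a) = Q f g + Q f g'"
  and Q_cst_left: "Q (\<lambda>a. cst c * f a) g = cst c * Q f g"
  and Q_cst_right: "Q f (\<lambda>a. cst c * g a) = cst c * Q f g"
  by (simp_all add: Q_def row_adj_col_def sum_2 algebra_simps)

section \<open>The diagonal blocks\<close>

text \<open>The vector field \<open>Z D - A Z\<close>.\<close>

definition lr_field :: "complex^2^2 \<Rightarrow> complex^2^2 \<Rightarrow> laurent \<Rightarrow> laurent" where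
  "lr_field A D F = (\<Sum>a\<in>UNIV. \<Sum>b\<in>UNIV. (\<Sum>e\<in>UNIV. zz a e * cst (D $ e $ b) - cst (A $ a $ e) * zz e b) * d a b F)"

definition diag_left :: "complex^2^2 \<Rightarrow> complex^2^2 \<Rightarrow> (2 \<Rightarrow> laurent) \<Rightarrow> 2 \<Rightarrow> laurent" where
  "diag_left A D f a = (\<Sum>e\<in>UNIV. cst (A $ a $ e) * f e) - cst (trace A) * f a + lr_field A D (f a)"

definition diag_right :: "complex^2^2 \<Rightarrow> complex^2^2 \<Rightarrow> (2 \<Rightarrow> laurent) \<Rightarrow> 2 \<Rightarrow> laurent" where
  "diag_right A D g b = cst (trace D) * g b - (\<Sum>e\<in>UNIV. g e * cst (D $ e $ b)) + lr_field A D (g b)"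

lemma trace_2: "trace (A :: complex^2^2) = A $ 1 $ 1 + A $ 2 $ 2"
  by (simp add: trace_def sum_2)

lemma lr_field_simps [simp]:
  "lr_field A D (F + G) = lr_field A D F + lr_field A D G"
  "lr_field A D (F - G) = lr_field A D F - lr_field A D G"
  "lr_field A D (F * G) = lr_field A D F * G + F * lr_field A D G"
  "lr_field A D (cst c) = 0" "lr_field A D (numeral k) = 0"
  by (simp_all add: lr_field_def sum_2 algebra_simps)

lemma d_lr_field: "d a b (lr_field A D F) = lr_field A D (d a b F)
   + (\<Sum>e\<in>UNIV. cst (D $ b $ e) * d a e F - cst (A $ e $ a) * d e b F)"
proof -
  consider "a = 1" "b = 1" | "a = 1" "b = 2" | "a = 2" "b = 1" | "a = 2" "b = 2"
    using exhaust_2[of a] exhaust_2[of b] by auto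
  then show ?thesis
    by cases (simp_all add: lr_field_def sum_2 algebra_simps)
qed

text \<open>\<open>lap\<close> is the determinant of the derivatives, so the infinitesimal change of variables contributes the
  traces of the two matrices.\<close>

lemma lap_lr_field: "lap (lr_field A D F) = lr_field A D (lap F) + cst (trace D - trace A) * lap F"
  by (simp add: lap_def d_lr_field sum_2 trace_2 algebra_simps)

lemma deg_lr_field: "deg (lr_field A D F) = lr_field A D (deg F)"
proof -
  have "lr_field A D (deg F) = lr_field A D (zz 1 1) * d 1 1 F + zz 1 1 * lr_field A D (d 1 1 F) +
    lr_field A D (zz 1 2) * d 1 2 F + zz 1 2 * lr_field A D (d 1 2 F) +
    lr_field A D (zz 2 1) * d 2 1 F + zz 2 1 * lr_field A D (d 2 1 F) +
    lr_field A D (zz 2 2) * d 2 2 F + zz 2 2 * lr_field A D (d 2 2 F)"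
    by (simp add: deg_def)
  moreover have "lr_field A D (zz 1 1) = zz 1 1 * cst (D$1$1) + zz 1 2 * cst (D$2$1) - cst (A$1$1) * zz 1 1 - cst (A$1$2) * zz 2 1"
    "lr_field A D (zz 1 2) = zz 1 1 * cst (D$1$2) + zz 1 2 * cst (D$2$2) - cst (A$1$1) * zz 1 2 - cst (A$1$2) * zz 2 2"
    "lr_field A D (zz 2 1) = zz 2 1 * cst (D$1$1) + zz 2 2 * cst (D$2$1) - cst (A$2$1) * zz 1 1 - cst (A$2$2) * zz 2 1"
    "lr_field A D (zz 2 2) = zz 2 1 * cst (D$1$2) + zz 2 2 * cst (D$2$2) - cst (A$2$1) * zz 1 2 - cst (A$2$2) * zz 2 2"
    by (simp_all add: lr_field_def sum_2 algebra_simps)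
  ultimately show ?thesis
    by (simp add: deg_def[of "lr_field A D F"] d_lr_field sum_2 algebra_simps)
qed

lemma dirac_diag_left: "dirac (diag_left A D f) b =
  lr_field A D (dirac f b) + (\<Sum>e\<in>UNIV. cst (D $ b $ e) * dirac f e) - cst (trace A) * dirac f b"
  using exhaust_2[of b] by (auto simp: dirac_def diag_left_def d_lr_field sum_2 trace_2 algebra_simps)

lemma lap_diag_right: "lap (diag_right A D g b) =
  lr_field A D (lap (g b)) - (\<Sum>e\<in>UNIV. lap (g e) * cst (D $ e $ b)) + cst (2 * trace D - trace A) * lap (g b)"
  by (simp add: diag_right_def lap_lr_field sum_2 lap_mult mixed_def algebra_simps)

text \<open>The infinitesimal form of the equivariance of \<open>Q\<close> under \<open>Z \<mapsto> A\<^sup>-\<^sup>1 Z D\<close>.\<close>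

lemma Q_diag: "Q (diag_left A D f) g + Q f (diag_right A D g) =
  lr_field A D (Q f g) + cst (trace D - trace A) * Q f g"
proof -
  have zzs: "lr_field A D (zz 1 1) = zz 1 1 * cst (D$1$1) + zz 1 2 * cst (D$2$1) - cst (A$1$1) * zz 1 1 - cst (A$1$2) * zz 2 1"
    "lr_field A D (zz 1 2) = zz 1 1 * cst (D$1$2) + zz 1 2 * cst (D$2$2) - cst (A$1$1) * zz 1 2 - cst (A$1$2) * zz 2 2"
    "lr_field A D (zz 2 1) = zz 2 1 * cst (D$1$1) + zz 2 2 * cst (D$2$1) - cst (A$2$1) * zz 1 1 - cst (A$2$2) * zz 2 1"
    "lr_field A D (zz 2 2) = zz 2 1 * cst (D$1$2) + zz 2 2 * cst (D$2$2) - cst (A$2$1) * zz 1 2 - cst (A$2$2) * zz 2 2"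
    by (simp_all add: lr_field_def sum_2 algebra_simps)
  have degg: "deg (diag_right A D g b) =
    cst (trace D) * deg (g b) - (\<Sum>e\<in>UNIV. deg (g e) * cst (D $ e $ b)) + lr_field A D (deg (g b))" for b
    by (simp add: diag_right_def sum_2 deg_lr_field)
  let ?w = "\<lambda>f g. \<Sum>b\<in>UNIV. deg (g b) * dirac f b - g b * deg (dirac f b)"
  let ?t = "\<lambda>f g. row_adj_col (\<lambda>a. lap (g a)) f"
  have w: "?w (diag_left A D f) g + ?w f (diag_right A D g) = lr_field A D (?w f g) + cst (trace D - trace A) * ?w f g"
    unfolding dirac_diag_left degg by (simp add: sum_2 deg_lr_field diag_right_def algebra_simps)
  have t: "?t (diag_left A D f) g + ?t f (diag_right A D g) = lr_field A D (?t f g) + cst (trace D - trace A) * ?t f g"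
    unfolding lap_diag_right by (simp add: row_adj_col_def sum_2 zzs diag_left_def trace_2 algebra_simps)
  have "Q (diag_left A D f) g + Q f (diag_right A D g) =
    (?w (diag_left A D f) g + ?w f (diag_right A D g)) - 2 * (?t (diag_left A D f) g + ?t f (diag_right A D g))"
    by (simp add: Q_def algebra_simps)
  also have "\<dots> = lr_field A D (Q f g) + cst (trace D - trace A) * Q f g"
    unfolding w t by (simp add: Q_def algebra_simps)
  finally show ?thesis .
qed


section \<open>Substitution\<close>

definition lmat :: "(2 \<Rightarrow> 2 \<Rightarrow> laurent) \<Rightarrow> complex^2^2 \<Rightarrow> complex^2^2" where
  "lmat P Z = (\<chi> a b. ev (P a b) Z)"

definition ldet :: "(2 \<Rightarrow> 2 \<Rightarrow> laurent) \<Rightarrow> laurent" where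
  "ldet P = P 1 1 * P 2 2 - P 1 2 * P 2 1"

definition subst :: "(2 \<Rightarrow> 2 \<Rightarrow> laurent) \<Rightarrow> laurent \<Rightarrow> laurent" where
  "subst P F = Abs_laurent (\<lambda>Z. if qnorm Z = 0 then 0 else ev F (lmat P Z))"

lemma qnorm_lmat: "qnorm (lmat P Z) = ev (ldet P) Z"
  by (simp add: lmat_def ldet_def det_2)

lemma unit_det_off_cone:
  assumes "ldet P * K = 1" "qnorm Z \<noteq> 0"
  shows "qnorm (lmat P Z) \<noteq> 0" "inverse (qnorm (lmat P Z)) = ev K Z"
proof -
  have "ev (ldet P) Z * ev K Z = 1"
    using arg_cong[OF assms(1), of "\<lambda>F. ev F Z"] assms(2) by simp
  then show "qnorm (lmat P Z) \<noteq> 0" "inverse (qnorm (lmat P Z)) = ev K Z"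
    unfolding qnorm_lmat by (auto simp: inverse_unique)
qed

lemma subst_exists:
  assumes K: "ldet P * K = 1"
  shows "\<exists>G. \<forall>Z. qnorm Z \<noteq> 0 \<longrightarrow> ev G Z = ev F (lmat P Z)"
proof (induction F rule: laurent_induct)
  case (cst c) show ?case
    by (rule exI[of _ "cst c"]) (simp add: unit_det_off_cone[OF K])
next
  case (zz a b) show ?case
    by (rule exI[of _ "P a b"]) (simp add: unit_det_off_cone[OF K] lmat_def[of P, THEN arg_cong, of "\<lambda>M. M $ a $ b"])
next
  case Ninv show ?case
    by (rule exI[of _ K]) (simp add: unit_det_off_cone[OF K])
next
  case (add F G)
  then obtain F' G' where "\<forall>Z. qnorm Z \<noteq> 0 \<longrightarrow> ev F' Z = ev F (lmat P Z)"
    "\<forall>Z. qnorm Z \<noteq> 0 \<longrightarrow> ev G' Z = ev G (lmat P Z)" by auto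
  then show ?case by (intro exI[of _ "F' + G'"]) simp
next
  case (mult F G)
  then obtain F' G' where "\<forall>Z. qnorm Z \<noteq> 0 \<longrightarrow> ev F' Z = ev F (lmat P Z)"
    "\<forall>Z. qnorm Z \<noteq> 0 \<longrightarrow> ev G' Z = ev G (lmat P Z)" by auto
  then show ?case by (intro exI[of _ "F' * G'"]) simp
qed

lemma ev_subst:
  assumes K: "ldet P * K = 1" and Z: "qnorm Z \<noteq> 0"
  shows "ev (subst P F) Z = ev F (lmat P Z)"
proof -
  obtain G where G: "\<forall>Z. qnorm Z \<noteq> 0 \<longrightarrow> ev G Z = ev F (lmat P Z)"
    using subst_exists[OF K] by blast
  have e: "(\<lambda>Z. if qnorm Z = 0 then 0 else ev F (lmat P Z)) = ev G"
    using G by (auto simp: fun_eq_iff)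
  show ?thesis unfolding subst_def e ev_inverse using G Z by simp
qed

context
  fixes P :: "2 \<Rightarrow> 2 \<Rightarrow> laurent" and K :: laurent
  assumes K: "ldet P * K = 1"
begin

lemma subst_add: "subst P (F + G) = subst P F + subst P G"
  and subst_diff: "subst P (F - G) = subst P F - subst P G"
  and subst_mult: "subst P (F * G) = subst P F * subst P G"
  and subst_uminus: "subst P (- F) = - subst P F"
  by (rule laurent_eqI, simp add: ev_subst[OF K])+

lemma subst_cst: "subst P (cst c) = cst c"
  and subst_one: "subst P 1 = 1"
  and subst_numeral: "subst P (numeral k) = numeral k"
  and subst_Ninv: "subst P Ninv = K"
  and subst_zero: "subst P 0 = 0"
  by (rule laurent_eqI, simp add: ev_subst[OF K] unit_det_off_cone[OF K])+

lemma subst_zz: "subst P (zz a b) = P a b"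
  by (rule laurent_eqI) (simp add: ev_subst[OF K] unit_det_off_cone[OF K], simp add: lmat_def)

lemma d_subst: "d a b (subst P F) = (\<Sum>c\<in>UNIV. \<Sum>e\<in>UNIV. d a b (P c e) * subst P (d c e F))"
proof (induction F rule: laurent_induct)
  case (zz p q)
  have "subst P (d c e (zz p q)) = (if c = p \<and> e = q then 1 else 0)" for c e
    by (simp add: d_zz subst_one subst_zero)
  then show ?case
    using exhaust_2[of p] exhaust_2[of q] by (auto simp: subst_zz sum_2)
next
  case Ninv
  have "d a b (ldet P * K) = 0" using K by simp
  then have "ldet P * d a b K = - (K * d a b (ldet P))"
    by (simp add: algebra_simps eq_neg_iff_add_eq_0)
  then have "K * (ldet P * d a b K) = - (K * K * d a b (ldet P))"
    by (simp add: algebra_simps)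
  then have "(ldet P * K) * d a b K = - (K * K * d a b (ldet P))"
    by (simp only: mult_ac)
  then have "d a b K = - (K * K * d a b (ldet P))" using K by simp
  then show ?case
    by (simp add: subst_Ninv d_Ninv subst_uminus subst_mult subst_zz sum_2 ldet_def algebra_simps)
qed (simp_all add: subst_cst subst_zero subst_add subst_mult sum_2 algebra_simps)

end

section \<open>Inversion\<close>

text \<open>\<open>zi\<close> is the matrix \<open>Z\<^sup>-\<^sup>1\<close>; the substitution \<open>\<tau>\<close> of \<open>Z\<^sup>-\<^sup>1\<close> for \<open>Z\<close> is an involution.\<close>

definition zi :: "2 \<Rightarrow> 2 \<Rightarrow> laurent" where
  "zi a b = (if a = 1 then if b = 1 then zz 2 2 else - zz 1 2 else if b = 1 then - zz 2 1 else zz 1 1) * Ninv"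

abbreviation \<tau> :: "laurent \<Rightarrow> laurent" where "\<tau> \<equiv> subst zi"

lemma NN_zi: "NN * zi 1 1 = zz 2 2" "NN * zi 1 2 = - zz 1 2" "NN * zi 2 1 = - zz 2 1" "NN * zi 2 2 = zz 1 1"
proof -
  have "NN * (x * Ninv) = x" for x
    by (metis NN_Ninv(1) mult.left_commute mult_1_right)
  then show "NN * zi 1 1 = zz 2 2" "NN * zi 1 2 = - zz 1 2" "NN * zi 2 1 = - zz 2 1" "NN * zi 2 2 = zz 1 1"
    by (simp_all only: zi_def) simp_all
qed

lemma zz_eq_zi: "zz 2 2 = NN * zi 1 1" "zz 1 2 = - (NN * zi 1 2)" "zz 2 1 = - (NN * zi 2 1)" "zz 1 1 = NN * zi 2 2"
  by (simp_all add: NN_zi)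

lemma ldet_zi: "ldet zi = Ninv"
proof -
  have "ldet zi = (NN * Ninv) * Ninv"
    by (simp add: ldet_def zi_def NN_def algebra_simps)
  then show ?thesis by simp
qed

lemma ldet_zi_NN: "ldet zi * NN = 1" by (simp add: ldet_zi)

lemmas \<tau>_simps [simp] = subst_add[OF ldet_zi_NN] subst_diff[OF ldet_zi_NN] subst_mult[OF ldet_zi_NN]
  subst_uminus[OF ldet_zi_NN] subst_cst[OF ldet_zi_NN] subst_one[OF ldet_zi_NN] subst_numeral[OF ldet_zi_NN]
  subst_Ninv[OF ldet_zi_NN] subst_zero[OF ldet_zi_NN] subst_zz[OF ldet_zi_NN]

lemma \<tau>_NN [simp]: "\<tau> NN = Ninv"
  by (simp add: NN_def flip: ldet_zi) (simp add: ldet_def)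

lemma \<tau>_zi [simp]: "\<tau> (zi a b) = zz a b"
proof -
  have "x * NN * Ninv = x" for x by (simp add: mult.assoc)
  then show ?thesis
    using exhaust_2[of a] exhaust_2[of b] zz_eq_zi by (auto simp: zi_def mult.commute)
qed

lemma \<tau>_\<tau> [simp]: "\<tau> (\<tau> F) = F"
  by (induction F rule: laurent_induct) simp_all

lemma zz_zi:
  "zz 1 1 * zi 1 1 + zz 1 2 * zi 2 1 = 1" "zz 1 1 * zi 1 2 + zz 1 2 * zi 2 2 = 0"
  "zz 2 1 * zi 1 1 + zz 2 2 * zi 2 1 = 0" "zz 2 1 * zi 1 2 + zz 2 2 * zi 2 2 = 1"
proof -
  have n: "(zz 1 1 * zz 2 2 - zz 1 2 * zz 2 1) * Ninv = 1"
    using NN_Ninv(1) unfolding NN_def .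
  show "zz 1 1 * zi 1 1 + zz 1 2 * zi 2 1 = 1" "zz 1 1 * zi 1 2 + zz 1 2 * zi 2 2 = 0"
    "zz 2 1 * zi 1 1 + zz 2 2 * zi 2 1 = 0" "zz 2 1 * zi 1 2 + zz 2 2 * zi 2 2 = 1"
    using n by (simp_all add: zi_def algebra_simps)
qed

lemma d_zi: "d a b (zi c e) = - (zi c a * zi b e)"
proof -
  have "(zz 1 1 * zz 2 2 - zz 1 2 * zz 2 1) * Ninv * Ninv = Ninv"
    using NN_Ninv(1) unfolding NN_def by simp
  then have n: "Ninv * (Ninv * (zz 1 1 * zz 2 2)) = Ninv + Ninv * (Ninv * (zz 1 2 * zz 2 1))"
    by (simp add: algebra_simps)
  have c: "c = 1 \<or> c = 2" "e = 1 \<or> e = 2" "a = 1 \<or> a = 2" "b = 1 \<or> b = 2"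
    by (rule exhaust_2)+
  have dN: "d 1 1 Ninv = - (Ninv * Ninv * zz 2 2)" "d 2 2 Ninv = - (Ninv * Ninv * zz 1 1)"
    "d 1 2 Ninv = Ninv * Ninv * zz 2 1" "d 2 1 Ninv = Ninv * Ninv * zz 1 2"
    by (simp_all add: d_Ninv)
  show ?thesis
    using c n by (elim disjE) (simp_all add: zi_def dN algebra_simps)
qed

lemma d_Ninv_zi: "d a b Ninv = - (Ninv * zi b a)"
  using exhaust_2[of a] exhaust_2[of b] by (auto simp: d_Ninv zi_def)

lemma d_\<tau>: "d a b (\<tau> F) = - (\<Sum>c\<in>UNIV. \<Sum>e\<in>UNIV. zi c a * zi b e * \<tau> (d c e F))"
  unfolding d_subst[OF ldet_zi_NN] d_zi by (simp add: sum_negf)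

lemma mixed_\<tau>: "mixed (\<tau> F) (\<tau> G) = Ninv * Ninv * \<tau> (mixed F G)"
  unfolding ldet_zi[symmetric]
  by (simp add: mixed_def d_\<tau> sum_2 ldet_def algebra_simps)

text \<open>The Kelvin transform in four dimensions. Both sides are second order operators with the same
  mixed term, so it suffices to compare them on the generators.\<close>

lemma kelvin: "lap (Ninv * \<tau> F) = Ninv * Ninv * Ninv * \<tau> (lap F)"
proof -
  have l0: "lap Ninv = 0"
    by (simp add: lap_def d_Ninv_zi d_zi algebra_simps)
  show ?thesis
  proof (induction F rule: laurent_induct)
    case (cst c) show ?case by (simp add: lap_mult l0 mixed_def)
  next
    case (zz a b)
    have "a = 1 \<or> a = 2" "b = 1 \<or> b = 2" by (rule exhaust_2)+
    then show ?case
      by (elim disjE; simp add: lap_mult mixed_def l0 lap_def d_Ninv_zi d_zi algebra_simps)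
  next
    case Ninv
    show ?case using lap_simps(6)[of 1] by (simp add: l0)
  next
    case (add F G) then show ?case by (simp add: algebra_simps)
  next
    case (mult F G)
    have "lap (Ninv * \<tau> (F * G)) = lap (Ninv * \<tau> F) * \<tau> G + lap (Ninv * \<tau> G) * \<tau> F + Ninv * mixed (\<tau> F) (\<tau> G)"
      by (simp add: lap_mult l0 mixed_def algebra_simps)
    also have "\<dots> = Ninv * Ninv * Ninv * \<tau> (lap (F * G))"
      unfolding mult.IH mixed_\<tau> by (simp add: lap_mult algebra_simps)
    finally show ?case .
  qed
qed

lemma NN_Ninv_cancel: "NN * (Ninv * F) = F" "Ninv * (NN * F) = F"
  by (simp_all flip: mult.assoc)

text \<open>The Weyl element exchanging the two blocks acts, up to sign, by these two maps.\<close>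

definition inv_left :: "(2 \<Rightarrow> laurent) \<Rightarrow> 2 \<Rightarrow> laurent" where
  "inv_left f b = (\<Sum>e\<in>UNIV. zz b e * (Ninv * \<tau> (f e)))"

definition inv_right :: "(2 \<Rightarrow> laurent) \<Rightarrow> 2 \<Rightarrow> laurent" where
  "inv_right g b = (\<Sum>e\<in>UNIV. zz e b * (Ninv * \<tau> (g e)))"

lemma inv_left_involution: "inv_left (inv_left f) b = f b"
proof -
  have "inv_left (inv_left f) b = (\<Sum>e\<in>UNIV. \<Sum>c\<in>UNIV. zz b e * zi e c * f c)"
    by (simp add: inv_left_def sum_2 algebra_simps NN_Ninv_cancel)
  also have "(\<Sum>e\<in>UNIV. \<Sum>c\<in>UNIV. zz b e * zi e c * f c) = (\<Sum>c\<in>UNIV. (\<Sum>e\<in>UNIV. zz b e * zi e c) * f c)"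
    by (simp add: sum_2 algebra_simps)
  also have "\<dots> = f b"
    using exhaust_2[of b] by (auto simp: sum_2 zz_zi)
  finally show ?thesis by simp
qed

lemma zi_zz:
  "zi 1 1 * zz 1 1 + zi 1 2 * zz 2 1 = 1" "zi 1 1 * zz 1 2 + zi 1 2 * zz 2 2 = 0"
  "zi 2 1 * zz 1 1 + zi 2 2 * zz 2 1 = 0" "zi 2 1 * zz 1 2 + zi 2 2 * zz 2 2 = 1"
  using arg_cong[OF zz_zi(1), of \<tau>] arg_cong[OF zz_zi(2), of \<tau>] arg_cong[OF zz_zi(3), of \<tau>] arg_cong[OF zz_zi(4), of \<tau>]
  by simp_all

lemma inv_right_involution: "inv_right (inv_right g) b = g b"
proof -
  have "inv_right (inv_right g) b = (\<Sum>c\<in>UNIV. (\<Sum>e\<in>UNIV. zi c e * zz e b) * g c)"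
    by (simp add: inv_right_def sum_2 algebra_simps NN_Ninv_cancel)
  also have "(\<Sum>c\<in>UNIV. (\<Sum>e\<in>UNIV. zi c e * zz e b) * g c) = g b"
    using exhaust_2[of b] by (auto simp: sum_2 zi_zz)
  finally show ?thesis by simp
qed

lemma deg_\<tau>: "deg (\<tau> F) = - \<tau> (deg F)"
proof -
  have "deg (\<tau> F) = - (\<Sum>c\<in>UNIV. \<Sum>e\<in>UNIV. (\<Sum>b\<in>UNIV. (\<Sum>a\<in>UNIV. zi c a * zz a b) * zi b e) * \<tau> (d c e F))"
    by (simp add: deg_def d_\<tau> sum_2 algebra_simps)
  also have "\<dots> = - \<tau> (deg F)"
    by (simp add: deg_def sum_2 zi_zz)
  finally show ?thesis .
qed

lemma \<tau>_of_int [simp]: "\<tau> (of_int n) = of_int n"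
  using \<tau>_simps(5)[of "of_int n"] by simp

lemma hom_\<tau>: "hom n F \<Longrightarrow> hom (- n) (\<tau> F)"
  by (simp add: hom_def deg_\<tau>)

lemma hom_inv_left: "(\<And>a. hom m (f a)) \<Longrightarrow> hom (- 1 - m) (inv_left f b)"
  unfolding inv_left_def sum_2
  using hom_mult[OF hom_zz hom_mult[OF hom_Ninv hom_\<tau>], of m] by (intro hom_add) simp_all

lemma hom_inv_right: "(\<And>a. hom m (f a)) \<Longrightarrow> hom (- 1 - m) (inv_right f b)"
  unfolding inv_right_def sum_2
  using hom_mult[OF hom_zz hom_mult[OF hom_Ninv hom_\<tau>], of m] by (intro hom_add) simp_all

text \<open>The cofactor of the matrix of partial derivatives at \<open>(a, b)\<close>; it is the mixed term of \<open>lap\<close> when one factor is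
  the coordinate \<open>z\<^sub>a\<^sub>b\<close>.\<close>

definition cod :: "2 \<Rightarrow> 2 \<Rightarrow> laurent \<Rightarrow> laurent" where
  "cod a b F = (if a = 1 then if b = 1 then d 2 2 F else - d 2 1 F else if b = 1 then - d 1 2 F else d 1 1 F)"

lemma lap_zz_mult: "lap (zz a b * F) = zz a b * lap F + cod a b F"
  using exhaust_2[of a] exhaust_2[of b] by (auto simp: lap_mult mixed_def cod_def lap_def algebra_simps)

lemma lap_inv_left: "lap (inv_left f b) =
   (\<Sum>e\<in>UNIV. zz b e * (Ninv * Ninv * Ninv * \<tau> (lap (f e))) + cod b e (Ninv * \<tau> (f e)))"
  unfolding inv_left_def sum_2 lap_simps lap_zz_mult kelvin by simp

lemma lap_inv_right: "lap (inv_right f b) =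
   (\<Sum>e\<in>UNIV. zz e b * (Ninv * Ninv * Ninv * \<tau> (lap (f e))) + cod e b (Ninv * \<tau> (f e)))"
  unfolding inv_right_def sum_2 lap_simps lap_zz_mult kelvin by simp

lemma \<tau>_sum_zero: "F + G = 0 \<Longrightarrow> \<tau> F + \<tau> G = 0"
  using \<tau>_simps(1)[of F G] by simp

text \<open>By the Kelvin transform \<open>lap\<close> of \<open>Z (N\<^sup>-\<^sup>1 \<tau> f)\<close> is \<open>Z N\<^sup>-\<^sup>3 \<tau> (lap f)\<close> plus a cofactor derivative. When
  \<open>dirac\<close> is applied, the product rule contributes \<open>2\<close> from \<open>Z\<close>, \<open>-3\<close> from \<open>N\<^sup>-\<^sup>3\<close> and \<open>1\<close> from the cofactor
  term, which cancel; what remains is \<open>\<tau>\<close> of the equation for \<open>f\<close>.\<close>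

lemma in_U_inv_left:
  assumes "in_U f" shows "in_U (inv_left f)"
  unfolding in_U_def
proof
  fix b
  let ?u = "\<lambda>e. Ninv * \<tau> (f e)" and ?F = "\<lambda>e. lap (f e)"
  have r: "\<tau> (d 1 c (?F 1)) + \<tau> (d 2 c (?F 2)) = 0" for c
    using assms by (intro \<tau>_sum_zero) (simp add: in_U_def dirac_def)
  have r': "\<tau> (d 2 c (?F 2)) = - \<tau> (d 1 c (?F 1))" for c
    using r[of c] by (simp add: eq_neg_iff_add_eq_0 add.commute)
  have cc: "d 1 b (cod 1 e F) + d 2 b (cod 2 e F) = (if e = b then lap F else 0)" for e F
    using exhaust_2[of b] exhaust_2[of e] by (auto simp: cod_def lap_def)
  have "dirac (\<lambda>a. lap (inv_left f a)) b =
     (\<Sum>e\<in>UNIV. d 1 b (zz 1 e * lap (?u e)) + d 2 b (zz 2 e * lap (?u e))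
        + (d 1 b (cod 1 e (?u e)) + d 2 b (cod 2 e (?u e))))"
    unfolding lap_inv_left dirac_def kelvin by (simp only: d_sum d_add sum_2 add_ac)
  also have "\<dots> = (\<Sum>e\<in>UNIV. d 1 b (zz 1 e * lap (?u e)) + d 2 b (zz 2 e * lap (?u e))) + lap (?u b)"
    unfolding cc using exhaust_2[of b] by (auto simp: sum_2)
  also have "(\<Sum>e\<in>UNIV. d 1 b (zz 1 e * lap (?u e)) + d 2 b (zz 2 e * lap (?u e)))
    = 2 * lap (?u b) + (\<Sum>e\<in>UNIV. zz 1 e * d 1 b (lap (?u e)) + zz 2 e * d 2 b (lap (?u e)))"
    using exhaust_2[of b] by (auto simp: sum_2 algebra_simps)
  also have "(\<Sum>e\<in>UNIV. zz 1 e * d 1 b (lap (?u e)) + zz 2 e * d 2 b (lap (?u e))) = - 3 * lap (?u b)"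
  proof -
    let ?N3 = "Ninv * Ninv * Ninv"
    have dN3: "d a b (?N3 * x) = ?N3 * d a b x - 3 * ?N3 * zi b a * x" for a x
      by (simp add: d_Ninv_zi algebra_simps)
    have "(\<Sum>e\<in>UNIV. zz 1 e * d 1 b (?N3 * \<tau> (?F e)) + zz 2 e * d 2 b (?N3 * \<tau> (?F e))) =
      - 3 * ?N3 * (\<Sum>e\<in>UNIV. (zi b 1 * zz 1 e + zi b 2 * zz 2 e) * \<tau> (?F e))
      + ?N3 * (\<Sum>e\<in>UNIV. zz 1 e * d 1 b (\<tau> (?F e)) + zz 2 e * d 2 b (\<tau> (?F e)))"
      unfolding dN3 sum_2 by (simp add: algebra_simps)
    also have "(\<Sum>e\<in>UNIV. (zi b 1 * zz 1 e + zi b 2 * zz 2 e) * \<tau> (?F e)) = \<tau> (?F b)"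
      using exhaust_2[of b] by (auto simp: sum_2 zi_zz)
    also have "(\<Sum>e\<in>UNIV. zz 1 e * d 1 b (\<tau> (?F e)) + zz 2 e * d 2 b (\<tau> (?F e))) =
       - (\<Sum>e\<in>UNIV. \<Sum>c\<in>UNIV. \<Sum>q\<in>UNIV. (zi c 1 * zz 1 e + zi c 2 * zz 2 e) * zi b q * \<tau> (d c q (?F e)))"
      unfolding d_\<tau> sum_2 by (simp add: algebra_simps)
    also have "\<dots> = 0"
      by (simp add: sum_2 zi_zz r' )
    finally show ?thesis unfolding kelvin by simp
  qed
  finally show "dirac (\<lambda>a. lap (inv_left f a)) b = 0" by simp
qed

text \<open>The transposed computation.\<close>

lemma in_U'_inv_right:
  assumes "in_U' f" shows "in_U' (inv_right f)"
  unfolding in_U'_def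
proof
  fix b
  let ?u = "\<lambda>e. Ninv * \<tau> (f e)" and ?F = "\<lambda>e. lap (f e)"
  have r: "\<tau> (d c 1 (?F 1)) + \<tau> (d c 2 (?F 2)) = 0" for c
    using assms by (intro \<tau>_sum_zero) (simp add: in_U'_def dirac'_def)
  have r': "\<tau> (d c 2 (?F 2)) = - \<tau> (d c 1 (?F 1))" for c
    using r[of c] by (simp add: eq_neg_iff_add_eq_0 add.commute)
  have cc: "d b 1 (cod e 1 F) + d b 2 (cod e 2 F) = (if e = b then lap F else 0)" for e F
    using exhaust_2[of b] exhaust_2[of e] by (auto simp: cod_def lap_def)
  have "dirac' (\<lambda>a. lap (inv_right f a)) b =
     (\<Sum>e\<in>UNIV. d b 1 (zz e 1 * lap (?u e)) + d b 2 (zz e 2 * lap (?u e))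
        + (d b 1 (cod e 1 (?u e)) + d b 2 (cod e 2 (?u e))))"
    unfolding lap_inv_right dirac'_def kelvin by (simp only: d_sum d_add sum_2 add_ac)
  also have "\<dots> = (\<Sum>e\<in>UNIV. d b 1 (zz e 1 * lap (?u e)) + d b 2 (zz e 2 * lap (?u e))) + lap (?u b)"
    unfolding cc using exhaust_2[of b] by (auto simp: sum_2)
  also have "(\<Sum>e\<in>UNIV. d b 1 (zz e 1 * lap (?u e)) + d b 2 (zz e 2 * lap (?u e)))
    = 2 * lap (?u b) + (\<Sum>e\<in>UNIV. zz e 1 * d b 1 (lap (?u e)) + zz e 2 * d b 2 (lap (?u e)))"
    using exhaust_2[of b] by (auto simp: sum_2 algebra_simps)
  also have "(\<Sum>e\<in>UNIV. zz e 1 * d b 1 (lap (?u e)) + zz e 2 * d b 2 (lap (?u e))) = - 3 * lap (?u b)"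
  proof -
    let ?N3 = "Ninv * Ninv * Ninv"
    have dN3: "d b a (?N3 * x) = ?N3 * d b a x - 3 * ?N3 * zi a b * x" for a x
      by (simp add: d_Ninv_zi algebra_simps)
    have "(\<Sum>e\<in>UNIV. zz e 1 * d b 1 (?N3 * \<tau> (?F e)) + zz e 2 * d b 2 (?N3 * \<tau> (?F e))) =
      - 3 * ?N3 * (\<Sum>e\<in>UNIV. (zz e 1 * zi 1 b + zz e 2 * zi 2 b) * \<tau> (?F e))
      + ?N3 * (\<Sum>e\<in>UNIV. zz e 1 * d b 1 (\<tau> (?F e)) + zz e 2 * d b 2 (\<tau> (?F e)))"
      unfolding dN3 sum_2 by (simp add: algebra_simps)
    also have "(\<Sum>e\<in>UNIV. (zz e 1 * zi 1 b + zz e 2 * zi 2 b) * \<tau> (?F e)) = \<tau> (?F b)"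
      using exhaust_2[of b] by (auto simp: sum_2 zz_zi)
    also have "(\<Sum>e\<in>UNIV. zz e 1 * d b 1 (\<tau> (?F e)) + zz e 2 * d b 2 (\<tau> (?F e))) =
       - (\<Sum>e\<in>UNIV. \<Sum>c\<in>UNIV. \<Sum>q\<in>UNIV. (zz e 1 * zi 1 q + zz e 2 * zi 2 q) * zi c b * \<tau> (d c q (?F e)))"
      unfolding d_\<tau> sum_2 by (simp add: algebra_simps)
    also have "\<dots> = 0"
      by (simp add: sum_2 zz_zi r')
    finally show ?thesis unfolding kelvin by simp
  qed
  finally show "dirac' (\<lambda>a. lap (inv_right f a)) b = 0" by simp
qed


section \<open>Integration over the three-sphere\<close>

lemma real_quaternions_iff:
  "Z \<in> real_quaternions \<longleftrightarrow> Z $ 2 $ 2 = cnj (Z $ 1 $ 1) \<and> Z $ 2 $ 1 = - cnj (Z $ 1 $ 2)"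
proof -
  have a: "(\<forall>j::4. P j) \<longleftrightarrow> P 0 \<and> P 1 \<and> P 2 \<and> P 3" for P
    using UNIV_4_zero by (metis UNIV_I empty_iff insert_iff)
  show ?thesis
    unfolding real_quaternions_def mem_Collect_eq a
    by (auto simp: qcoord_def complex_is_Real_iff complex_eq_iff)
qed

lemma real_quaternions_mult:
  "A \<in> real_quaternions \<Longrightarrow> B \<in> real_quaternions \<Longrightarrow> A ** B \<in> real_quaternions"
  by (simp add: real_quaternions_iff matrix_matrix_mult_def sum_2 algebra_simps)

lemma quat_real: "quat x \<in> real_quaternions"
  by (simp add: real_quaternions_def qcoord_quat)

lemma quat_surj:
  assumes "X \<in> real_quaternions" shows "quat (\<chi> j. Re (qcoord j X)) = X"
proof -
  have "complex_of_real (Re (qcoord j X)) = qcoord j X" for j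
    using assms by (auto simp: real_quaternions_def elim!: Reals_cases)
  then show ?thesis
    using qcoord_expansion[of X] by (simp add: quat_def)
qed

lemma continuous_quat: "continuous_on UNIV quat"
proof -
  have e: "quat = (\<lambda>x. \<chi> i k. (\<Sum>j\<in>UNIV. of_real (x $ j) * qunit j $ i $ k))"
    by (simp add: quat_def cscale_def vec_eq_iff fun_eq_iff)
  show ?thesis
    unfolding e by (intro continuous_intros)
qed

lemma quat_measurable [measurable]: "quat \<in> borel_measurable borel"
  by (rule borel_measurable_continuous_onI) (rule continuous_quat)

lemma continuous_on_ev: "continuous_on {Z. qnorm Z \<noteq> 0} (ev F)"
proof -
  have "isCont (ev F) Z" if "qnorm Z \<noteq> 0" for Z
    using has_gradient_d[of F] that unfolding has_gradient_def
    by (auto intro: has_derivative_continuous)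
  then show ?thesis
    by (auto intro: continuous_at_imp_continuous_on)
qed

lemma off_cone_borel: "{Z :: complex^2^2. qnorm Z \<noteq> 0} \<in> sets borel"
  by (rule borel_open) (rule open_off_cone)

lemma ev_measurable [measurable]: "ev F \<in> borel_measurable borel"
proof -
  have "(\<lambda>Z. if Z \<in> {Z. qnorm Z \<noteq> 0} then ev F Z else 0) \<in> borel_measurable borel"
    by (rule borel_measurable_continuous_on_if)
       (use off_cone_borel continuous_on_ev in auto)
  moreover have "(\<lambda>Z. if Z \<in> {Z. qnorm Z \<noteq> 0} then ev F Z else 0) = ev F"
    by (rule ext) auto
  ultimately show ?thesis by simp
qed

lemma finite_sphere_measure:
  assumes "R > 0" shows "finite_measure (sphere_measure R :: (real^4) measure)"
  by (rule finite_measureI) (simp only: space_sphere_measure sphere_measure_total[OF assms], simp)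

lemma AE_sphere_measure:
  assumes "R > 0" shows "AE x in (sphere_measure R :: (real^4) measure). norm x = R"
proof (rule AE_I)
  show "emeasure (sphere_measure R :: (real^4) measure) (- sphere 0 R) = 0"
    by (rule sphere_measure_carrier[OF assms])
qed (auto simp: borel_closed)

lemma qnorm_quat_sphere: "norm x = R \<Longrightarrow> qnorm (quat x) = of_real (R\<^sup>2)"
  by (simp add: qnorm_quat)

definition sint :: "real \<Rightarrow> laurent \<Rightarrow> complex" where
  "sint R F = (LINT X|S3_measure R. ev F X)"

lemma integral_S3_measure:
  assumes "f \<in> borel_measurable borel"
  shows "(LINT X|S3_measure R. f X) = (LINT x|sphere_measure R. f (quat x) :: complex)"
  unfolding S3_measure_def by (rule integral_distr) (use assms in simp_all)

lemma sint_eq: "sint R F = (LINT x|sphere_measure R. ev F (quat x))"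
  unfolding sint_def by (rule integral_S3_measure) simp

lemma compact_sphere_bound:
  assumes "R > 0"
  obtains B where "\<And>x. norm x = R \<Longrightarrow> norm (ev F (quat x)) \<le> B"
proof -
  have "continuous_on (sphere 0 R) (\<lambda>x. ev F (quat x))"
    by (rule continuous_on_compose2[OF continuous_on_ev continuous_on_subset[OF continuous_quat]])
       (use assms in \<open>auto simp: qnorm_quat\<close>)
  then have "compact ((\<lambda>x. ev F (quat x)) ` sphere 0 R)"
    by (rule compact_continuous_image) simp
  then obtain B where "\<forall>y\<in>(\<lambda>x. ev F (quat x)) ` sphere 0 R. norm y \<le> B"
    using compact_imp_bounded bounded_iff by metis
  then show ?thesis by (intro that[of B]) auto
qed

lemma integrable_ev:
  assumes "R > 0" shows "integrable (sphere_measure R) (\<lambda>x. ev F (quat x))"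
proof -
  interpret finite_measure "sphere_measure R :: (real^4) measure" by (rule finite_sphere_measure[OF assms])
  obtain B where "\<And>x. norm x = R \<Longrightarrow> norm (ev F (quat x)) \<le> B" by (rule compact_sphere_bound[OF assms, of F]) blast
  then have "AE x in sphere_measure R. norm (ev F (quat x)) \<le> B"
    using AE_sphere_measure[OF assms] by (auto elim: eventually_mono)
  then show ?thesis by (rule integrable_const_bound) measurable
qed

lemma sint_add: "R > 0 \<Longrightarrow> sint R (F + G) = sint R F + sint R G"
  and sint_diff: "R > 0 \<Longrightarrow> sint R (F - G) = sint R F - sint R G"
  and sint_uminus: "R > 0 \<Longrightarrow> sint R (- F) = - sint R F"
  by (simp_all add: sint_eq integrable_ev)

lemma sint_zero [simp]: "sint R 0 = 0" by (simp add: sint_def)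

lemma sint_cong_sphere:
  assumes "R > 0" and "\<And>x. norm x = R \<Longrightarrow> ev F (quat x) = c * ev G (quat x)"
  shows "sint R F = c * sint R G"
proof -
  have "sint R F = (LINT x|sphere_measure R. c * ev G (quat x))"
    unfolding sint_eq using AE_sphere_measure[OF assms(1)] assms(2)
    by (intro integral_cong_AE) (auto elim: eventually_mono)
  then show ?thesis by (simp add: sint_eq)
qed

lemma sint_cst: "R > 0 \<Longrightarrow> sint R (cst c * F) = c * sint R F"
  by (rule sint_cong_sphere) (simp_all add: qnorm_quat_sphere)

lemma sint_of_int: "R > 0 \<Longrightarrow> sint R (of_int n * F) = of_int n * sint R F"
  using sint_cst[of R "of_int n" F] by simp

lemma sint_numeral: "R > 0 \<Longrightarrow> sint R (numeral n * F) = numeral n * sint R F"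
  using sint_cst[of R "numeral n" F] by simp

lemma sint_NN: "R > 0 \<Longrightarrow> sint R (NN * F) = of_real (R\<^sup>2) * sint R F"
  by (rule sint_cong_sphere) (simp_all add: qnorm_quat_sphere)

lemma sint_one: "sint 1 1 = 2 * of_real pi ^ 2"
proof -
  have "sint 1 1 = (LINT x|(sphere_measure 1 :: (real^4) measure). 1)"
    unfolding sint_eq using AE_sphere_measure[of 1]
    by (intro integral_cong_AE) (auto elim!: eventually_mono simp: qnorm_quat)
  also have "\<dots> = of_real (measure (sphere_measure 1 :: (real^4) measure) UNIV)"
    by (simp add: scaleR_conv_of_real)
  also have "\<dots> = 2 * of_real pi ^ 2"
    by (simp add: measure_def sphere_measure_total)
  finally show ?thesis .
qed

subsection \<open>Rotations\<close>

text \<open>A real linear map that preserves \<open>\<H>\<close> and the norm is an orthogonal transformation of \<open>\<real>\<^sup>4\<close>.\<close>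

lemma integral_rotation:
  fixes f :: "complex^2^2 \<Rightarrow> complex"
  assumes f: "f \<in> borel_measurable borel" and lin: "linear \<psi>"
    and H: "\<And>Z. Z \<in> real_quaternions \<Longrightarrow> \<psi> Z \<in> real_quaternions"
    and N: "\<And>Z. Z \<in> real_quaternions \<Longrightarrow> qnorm (\<psi> Z) = qnorm Z"
  shows "(LINT x|sphere_measure R. f (\<psi> (quat x))) = (LINT x|sphere_measure R. f (quat x))"
proof -
  define T :: "real^4 \<Rightarrow> real^4" where "T x = (\<chi> j. Re (qcoord j (\<psi> (quat x))))" for x
  have qT: "quat (T x) = \<psi> (quat x)" for x
    unfolding T_def by (rule quat_surj) (rule H, rule quat_real)
  have lq: "linear quat"
    by (rule linearI) (simp_all add: quat_def cscale_def vec_eq_iff sum.distrib algebra_simps sum_UNIV_4_zero scaleR_conv_of_real[where 'a=complex])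
  have "linear (\<lambda>X. \<chi> j::4. Re (qcoord j X))"
  proof (rule linearI)
    have j: "j = 0 \<or> j = 1 \<or> j = 2 \<or> j = 3" for j :: 4 using UNIV_4_zero by auto
    show "(\<chi> j::4. Re (qcoord j (X + Y))) = (\<chi> j. Re (qcoord j X)) + (\<chi> j. Re (qcoord j Y))" for X Y
      unfolding vec_eq_iff
    proof
      fix i :: 4 show "(\<chi> j::4. Re (qcoord j (X + Y))) $ i = ((\<chi> j. Re (qcoord j X)) + (\<chi> j. Re (qcoord j Y))) $ i"
        using j[of i] by (auto simp: qcoord_def field_simps)
    qed
    show "(\<chi> j::4. Re (qcoord j (c *\<^sub>R X))) = c *\<^sub>R (\<chi> j. Re (qcoord j X))" for c X
      unfolding vec_eq_iff
    proof
      fix i :: 4 show "(\<chi> j::4. Re (qcoord j (c *\<^sub>R X))) $ i = (c *\<^sub>R (\<chi> j. Re (qcoord j X))) $ i"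
        using j[of i] by (auto simp: qcoord_def algebra_simps)
    qed
  qed
  from linear_compose[OF linear_compose[OF lq lin] this]
  have lT: "linear T" by (simp add: T_def[abs_def] o_def)
  have "norm (T x) = norm x" for x
  proof -
    have "complex_of_real ((norm (T x))\<^sup>2) = complex_of_real ((norm x)\<^sup>2)"
      using N[OF quat_real, of x] by (simp only: qnorm_quat flip: qT)
    then have "(norm (T x))\<^sup>2 = (norm x)\<^sup>2" by (simp only: of_real_eq_iff)
    then show ?thesis by simp
  qed
  then have T: "orthogonal_transformation T"
    using lT by (simp add: orthogonal_transformation)
  have Tm: "T \<in> measurable (sphere_measure R) borel"
    using lT by (simp only: measurable_cong_sets[OF sets_sphere_measure refl])
      (intro borel_measurable_continuous_onI linear_continuous_on linear_conv_bounded_linear[THEN iffD1])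
  have "(LINT x|sphere_measure R. f (quat x)) = (LINT x|distr (sphere_measure R) borel T. f (quat x))"
    by (simp only: sphere_measure_rotation[OF T])
  also have "\<dots> = (LINT x|sphere_measure R. f (quat (T x)))"
    by (rule integral_distr[OF Tm]) (use f in measurable)
  finally show ?thesis by (simp only: qT)
qed

lemma linear_left_right: "linear (\<lambda>Z :: complex^2^2. A ** Z ** B)"
  by (rule linearI)
     (simp_all add: matrix_matrix_mult_def vec_eq_iff sum_2 algebra_simps forall_2)

lemma integral_left_right:
  assumes "f \<in> borel_measurable borel"
    and A: "A \<in> real_quaternions" "qnorm A = 1" and B: "B \<in> real_quaternions" "qnorm B = 1"
  shows "(LINT x|sphere_measure R. f (A ** quat x ** B)) = (LINT x|sphere_measure R. f (quat x) :: complex)"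
  by (rule integral_rotation[OF assms(1) linear_left_right])
     (use A B in \<open>simp_all add: real_quaternions_mult det_mul\<close>)

text \<open>On the unit sphere inversion is quaternionic conjugation.\<close>

lemma sint_\<tau>: "sint 1 (\<tau> F) = sint 1 F"
proof -
  define \<psi> :: "complex^2^2 \<Rightarrow> complex^2^2" where
    "\<psi> Z = (\<chi> a b. if a = 1 then if b = 1 then Z $ 2 $ 2 else - Z $ 1 $ 2 else if b = 1 then - Z $ 2 $ 1 else Z $ 1 $ 1)" for Z
  have "linear \<psi>"
    by (rule linearI) (simp_all add: \<psi>_def vec_eq_iff forall_2)
  moreover have "\<psi> Z \<in> real_quaternions" "qnorm (\<psi> Z) = qnorm Z" if "Z \<in> real_quaternions" for Z
    using that by (auto simp: real_quaternions_iff \<psi>_def det_2)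
  ultimately have "(LINT x|sphere_measure 1. ev F (\<psi> (quat x))) = (LINT x|sphere_measure 1. ev F (quat x))"
    by (intro integral_rotation) auto
  moreover have "sint 1 (\<tau> F) = (LINT x|sphere_measure 1. ev F (\<psi> (quat x)))"
    unfolding sint_eq
  proof (rule integral_cong_AE)
    have "ev (\<tau> F) (quat x) = ev F (\<psi> (quat x))" if "norm x = 1" for x
    proof -
      have q: "qnorm (quat x) = 1" using that by (simp add: qnorm_quat)
      have "lmat zi (quat x) = \<psi> (quat x)"
        using q by (simp add: lmat_def zi_def \<psi>_def vec_eq_iff)
      then show ?thesis
        using q by (subst ev_subst[OF ldet_zi_NN]) auto
    qed
    then show "AE x in sphere_measure 1. ev (\<tau> F) (quat x) = ev F (\<psi> (quat x))"
      using AE_sphere_measure[of 1] by (auto elim: eventually_mono)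
    have "\<psi> \<in> borel_measurable borel"
      using \<open>linear \<psi>\<close> by (intro borel_measurable_continuous_onI linear_continuous_on linear_conv_bounded_linear[THEN iffD1])
    then show "(\<lambda>x. ev F (\<psi> (quat x))) \<in> borel_measurable (sphere_measure 1)" by measurable
  qed measurable
  ultimately show ?thesis by (simp add: sint_eq)
qed

subsection \<open>Infinitesimal rotations\<close>

lemma ev_has_vector_derivative:
  fixes \<psi> :: "real \<Rightarrow> complex^2^2"
  assumes Z: "qnorm (\<psi> t) \<noteq> 0" and \<psi>: "(\<psi> has_vector_derivative V) (at t within S)"
  shows "((\<lambda>t. ev F (\<psi> t)) has_vector_derivative (\<Sum>a\<in>UNIV. \<Sum>b\<in>UNIV. V $ a $ b * ev (d a b F) (\<psi> t))) (at t within S)"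
proof -
  have "(ev F has_derivative lin (\<lambda>a b. ev (d a b F) (\<psi> t))) (at (\<psi> t))"
    using has_gradient_d[of F] Z by (simp add: has_gradient_def)
  from has_derivative_compose[OF \<psi>[unfolded has_vector_derivative_def] this]
  have "((\<lambda>t. ev F (\<psi> t)) has_derivative (\<lambda>h. lin (\<lambda>a b. ev (d a b F) (\<psi> t)) (h *\<^sub>R V))) (at t within S)" .
  moreover have "lin (\<lambda>a b. ev (d a b F) (\<psi> t)) (h *\<^sub>R V) =
      h *\<^sub>R (\<Sum>a\<in>UNIV. \<Sum>b\<in>UNIV. V $ a $ b * ev (d a b F) (\<psi> t))" for h
    by (simp add: lin_def sum_2 algebra_simps)
  ultimately show ?thesis by (simp add: has_vector_derivative_def)
qed

lemma norm_diff_le_of_derivative_bound: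
  fixes f :: "real \<Rightarrow> complex"
  assumes "\<And>t. (f has_vector_derivative f' t) (at t)" and "\<And>t. norm (f' t) \<le> B"
  shows "norm (f x - f y) \<le> B * \<bar>x - y\<bar>"
proof -
  have "norm (f x - f y) \<le> B * norm (x - y)"
  proof (rule differentiable_bound[of UNIV f "\<lambda>t h. h *\<^sub>R f' t"])
    show "onorm (\<lambda>h. h *\<^sub>R f' t) \<le> B" for t
      by (rule onorm_le) (use assms(2) in \<open>simp add: mult.commute[of B] mult_left_mono\<close>)
  qed (use assms(1) in \<open>auto simp: has_vector_derivative_def\<close>)
  then show ?thesis by simp
qed

lemma qunit_square: "j \<noteq> 0 \<Longrightarrow> qunit j ** qunit j = - mat 1"
  and qunit_real: "qunit j \<in> real_quaternions"
proof -
  have j: "j = 0 \<or> j = 1 \<or> j = 2 \<or> j = 3" using UNIV_4_zero by auto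
  show "j \<noteq> 0 \<Longrightarrow> qunit j ** qunit j = - mat 1"
    using j by (auto simp: qunit_def matrix_matrix_mult_def vec_eq_iff forall_2 sum_2 mat_def)
  show "qunit j \<in> real_quaternions"
    using j by (auto simp: qunit_def real_quaternions_iff mat_def)
qed

text \<open>The integral of \<open>F (u X)\<close> does not depend on the unit quaternion \<open>u\<close>; differentiating along
  \<open>u = cos t + sin t e\<^sub>j\<close> at \<open>t = 0\<close> under the integral sign gives the claim for \<open>A = e\<^sub>j\<close>.\<close>

lemma sint_left_unit:
  assumes j: "j \<noteq> 0" shows "sint 1 (lr_field (qunit j) 0 F) = 0"
proof -
  define G where "G = - lr_field (qunit j) 0 F"
  define u where "u t = cos t *\<^sub>R mat 1 + sin t *\<^sub>R qunit j" for t :: real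
  have uq: "u t \<in> real_quaternions" for t
    using qunit_real[of j] by (simp add: u_def real_quaternions_iff mat_def)
  have jc: "j = 1 \<or> j = 2 \<or> j = 3" using UNIV_4_zero j by auto
  have qn: "qnorm (u t) = 1" for t
  proof -
    have "qnorm (u t) = of_real ((cos t)\<^sup>2 + (sin t)\<^sup>2)"
      using jc by (auto simp: u_def det_2 qunit_def mat_def power2_eq_square complex_eq_iff algebra_simps)
    then show ?thesis by simp
  qed
  have du: "(u has_vector_derivative qunit j ** u t) (at t)" for t
  proof -
    have "qunit j ** u t = (- sin t) *\<^sub>R mat 1 + cos t *\<^sub>R qunit j"
    proof -
      have "qunit j ** u t = cos t *\<^sub>R qunit j + sin t *\<^sub>R (qunit j ** qunit j)"
        by (simp add: u_def matrix_matrix_mult_def vec_eq_iff sum_2 mat_def algebra_simps forall_2)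
      then show ?thesis by (simp add: qunit_square[OF j])
    qed
    moreover have "(u has_vector_derivative (- sin t) *\<^sub>R mat 1 + cos t *\<^sub>R qunit j) (at t)"
      unfolding u_def[abs_def] by (auto intro!: derivative_eq_intros)
    ultimately show ?thesis by simp
  qed
  have dF: "((\<lambda>t. ev F (u t ** quat x)) has_vector_derivative ev G (u t ** quat x)) (at t)" if x: "norm x = 1" for x t
  proof -
    have q: "qnorm (u t ** quat x) \<noteq> 0" using x by (simp add: det_mul qn qnorm_quat)
    have "linear (\<lambda>A. A ** quat x)"
      by (rule linearI) (simp_all add: matrix_matrix_mult_def vec_eq_iff sum_2 algebra_simps)
    then have "bounded_linear (\<lambda>A. A ** quat x)" by (rule linear_conv_bounded_linear[THEN iffD1])
    then have "((\<lambda>t. u t ** quat x) has_vector_derivative (qunit j ** u t) ** quat x) (at t)"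
      using du by (rule bounded_linear.has_vector_derivative)
    from ev_has_vector_derivative[OF q this, of F]
    have "((\<lambda>t. ev F (u t ** quat x)) has_vector_derivative
      (\<Sum>a\<in>UNIV. \<Sum>b\<in>UNIV. (qunit j ** (u t ** quat x)) $ a $ b * ev (d a b F) (u t ** quat x))) (at t)"
      by (simp add: matrix_mul_assoc)
    moreover have "ev G Z = (\<Sum>a\<in>UNIV. \<Sum>b\<in>UNIV. (qunit j ** Z) $ a $ b * ev (d a b F) Z)" if "qnorm Z \<noteq> 0" for Z
      using that by (simp add: G_def lr_field_def sum_2 matrix_matrix_mult_def algebra_simps)
    ultimately show ?thesis using q by simp
  qed
  have sph: "\<exists>y. norm y = 1 \<and> u t ** quat x = quat y" if x: "norm x = 1" for x t
  proof -
    have "u t ** quat x \<in> S3 1"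
      using uq quat_real x by (auto simp: S3_def real_quaternions_mult det_mul qn qnorm_quat)
    then show ?thesis unfolding quat_sphere[symmetric, OF zero_less_one] by auto
  qed
  obtain B where B: "\<And>x. norm x = 1 \<Longrightarrow> norm (ev G (quat x)) \<le> B"
    by (rule compact_sphere_bound[of 1 G]) auto
  have BG: "norm (ev G (u t ** quat x)) \<le> B" if "norm x = 1" for x t
    using sph[OF that, of t] B by auto
  \<comment> \<open>The difference quotients at \<open>t = 1/(n + 1)\<close>; by the mean value theorem they are bounded by the maximum of
    the derivative on the sphere, which is mapped to itself.\<close>
  define s where "s n x = of_nat (Suc n) * (ev F (u (1 / real (Suc n)) ** quat x) - ev F (quat x))" for n x
  have u0: "u 0 = mat 1" by (simp add: u_def)
  have sb: "norm (s n x) \<le> B" if x: "norm x = 1" for n x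
  proof -
    have "norm (ev F (u (1 / real (Suc n)) ** quat x) - ev F (u 0 ** quat x)) \<le> B * \<bar>1 / real (Suc n) - 0\<bar>"
      by (rule norm_diff_le_of_derivative_bound[where f' = "\<lambda>t. ev G (u t ** quat x)"])
         (use dF[OF x] BG[OF x] in auto)
    then show ?thesis
      unfolding s_def norm_mult norm_of_nat by (simp add: u0 field_simps)
  qed
  have sl: "(\<lambda>n. s n x) \<longlonglongrightarrow> ev G (quat x)" if x: "norm x = 1" for x
  proof -
    let ?v = "ev G (quat x)" and ?\<Delta> = "\<lambda>t. ev F (u t ** quat x) - ev F (quat x)"
    have "((\<lambda>t. norm (?\<Delta> t - t *\<^sub>R ?v) / \<bar>t\<bar>) \<longlongrightarrow> 0) (at 0)"
      using dF[OF x, of 0] unfolding has_vector_derivative_def has_derivative_iff_norm by (simp add: u0)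
    moreover
    have "norm (?\<Delta> t - t *\<^sub>R ?v) / \<bar>t\<bar> = norm ((1 / t) *\<^sub>R ?\<Delta> t - ?v)" if "t \<noteq> 0" for t
    proof -
      have "(1 / t) *\<^sub>R ?\<Delta> t - ?v = (1 / t) *\<^sub>R (?\<Delta> t - t *\<^sub>R ?v)"
        using that by (simp add: scaleR_diff_right)
      then show ?thesis by (simp only: norm_scaleR) simp
    qed
    then have "\<forall>\<^sub>F t in at 0. norm (?\<Delta> t - t *\<^sub>R ?v) / \<bar>t\<bar> = norm ((1 / t) *\<^sub>R ?\<Delta> t - ?v)"
      unfolding eventually_at_filter by (intro always_eventually) blast
    ultimately have "((\<lambda>t. norm ((1 / t) *\<^sub>R ?\<Delta> t - ?v)) \<longlongrightarrow> 0) (at 0)"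
      by (simp only: tendsto_cong)
    then have "((\<lambda>t. (1 / t) *\<^sub>R (ev F (u t ** quat x) - ev F (quat x))) \<longlongrightarrow> ev G (quat x)) (at 0)"
      by (intro LIM_zero_cancel[of _ ?v]) (simp add: tendsto_norm_zero_iff)
    moreover have "filterlim (\<lambda>n. 1 / real (Suc n)) (at 0) sequentially"
      by (rule filterlim_atI) (use lim_1_over_n LIMSEQ_Suc[of "\<lambda>n. 1 / real n" 0] in auto)
    ultimately have "(\<lambda>n. (1 / (1 / real (Suc n))) *\<^sub>R (ev F (u (1 / real (Suc n)) ** quat x) - ev F (quat x))) \<longlonglongrightarrow> ev G (quat x)"
      by (rule filterlim_compose)
    then show ?thesis by (simp add: s_def scaleR_conv_of_real)
  qed
  have um: "(\<lambda>x. ev F (u t ** quat x)) \<in> borel_measurable borel" for t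
  proof -
    have "linear (\<lambda>Z :: complex^2^2. u t ** Z ** mat 1)" by (rule linear_left_right)
    then have "(\<lambda>Z :: complex^2^2. u t ** Z) \<in> borel_measurable borel"
      by (intro borel_measurable_continuous_onI linear_continuous_on linear_conv_bounded_linear[THEN iffD1]) simp
    then show ?thesis by measurable
  qed
  interpret finite_measure "sphere_measure 1 :: (real^4) measure" by (rule finite_sphere_measure) simp
  have ux: "integrable (sphere_measure 1) (\<lambda>x. ev F (u t ** quat x))" for t
  proof -
    obtain C where C: "\<And>x. norm x = 1 \<Longrightarrow> norm (ev F (quat x)) \<le> C"
      by (rule compact_sphere_bound[of 1 F]) auto
    have bC: "norm (ev F (u t ** quat x)) \<le> C" if "norm x = 1" for x
      using sph[OF that, of t] C by auto
    have "AE x in sphere_measure 1. norm (ev F (u t ** quat x)) \<le> C"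
      using AE_sphere_measure[OF zero_less_one] by (rule eventually_mono) (rule bC)
    then show ?thesis by (rule integrable_const_bound) (use um in simp)
  qed
  have "(\<lambda>n. LINT x|sphere_measure 1. s n x) \<longlonglongrightarrow> (LINT x|sphere_measure 1. ev G (quat x))"
  proof (rule integral_dominated_convergence[where w = "\<lambda>_. B"])
    show "AE x in sphere_measure 1. (\<lambda>n. s n x) \<longlonglongrightarrow> ev G (quat x)"
      using AE_sphere_measure[OF zero_less_one] by (rule eventually_mono) (use sl in auto)
    show "AE x in sphere_measure 1. norm (s n x) \<le> B" for n
      using AE_sphere_measure[OF zero_less_one] by (rule eventually_mono) (use sb in auto)
    show "s n \<in> borel_measurable (sphere_measure 1)" for n
      using um[of "1 / real (Suc n)"] unfolding s_def[abs_def] by measurable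
  qed (simp_all)
  moreover have "(LINT x|sphere_measure 1. s n x) = 0" for n
  proof -
    have "(LINT x|sphere_measure 1. s n x) = of_nat (Suc n) *
      ((LINT x|sphere_measure 1. ev F (u (1 / real (Suc n)) ** quat x)) - (LINT x|sphere_measure 1. ev F (quat x)))"
      unfolding s_def by (simp add: ux integrable_ev)
    also have "(LINT x|sphere_measure 1. ev F (u t ** quat x)) = (LINT x|sphere_measure 1. ev F (quat x))" for t
      using integral_left_right[of "ev F" "u t" "mat 1" 1] uq[of t] qn[of t]
      by (simp add: real_quaternions_iff[of "mat 1"], simp add: mat_def)
    finally show ?thesis by simp
  qed
  ultimately have "sint 1 G = 0"
    unfolding sint_eq by (simp add: LIMSEQ_const_iff)
  then show ?thesis by (simp add: G_def sint_uminus)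
qed

lemma sint_left_traceless:
  assumes "trace A = 0" shows "sint 1 (lr_field A 0 F) = 0"
proof -
  have A: "A = cscale (qcoord 1 A) (qunit 1) + cscale (qcoord 2 A) (qunit 2) + cscale (qcoord 3 A) (qunit 3)"
    using assms by (subst qcoord_expansion) (simp add: sum_UNIV_4_zero qcoord_def[of 0] trace_2 cscale_def vec_eq_iff)
  have "lr_field A 0 F = cst (qcoord 1 A) * lr_field (qunit 1) 0 F + cst (qcoord 2 A) * lr_field (qunit 2) 0 F
     + cst (qcoord 3 A) * lr_field (qunit 3) 0 F"
    by (subst A) (simp add: lr_field_def sum_2 cscale_def algebra_simps)
  then show ?thesis
    by (simp add: sint_add sint_cst sint_left_unit)
qed

subsection \<open>Integration by parts\<close>

text \<open>A matrix unit is traceless up to a multiple of the identity, whose vector field is the Euler field.\<close>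

lemma sint_left_field:
  "sint 1 (\<Sum>c\<in>UNIV. zz e c * d a c F) = (if a = e then sint 1 (deg F) / 2 else 0)"
proof -
  define A :: "complex^2^2" where
    "A = (\<chi> i k. if i = a \<and> k = e then 1 else 0) - (if a = e then cscale (1/2) (mat 1) else 0)"
  have ae: "a = 1 \<or> a = 2" "e = 1 \<or> e = 2" by (rule exhaust_2)+
  have "trace A = 0"
    using ae by (auto simp: A_def trace_2 cscale_def mat_def)
  then have z: "sint 1 (lr_field A 0 F) = 0" by (rule sint_left_traceless)
  have "lr_field A 0 F = (if a = e then cst (1/2) * deg F else 0) - (\<Sum>c\<in>UNIV. zz e c * d a c F)"
    using ae by (elim disjE) (simp_all add: A_def lr_field_def deg_def sum_2 cscale_def mat_def algebra_simps)
  then have "sint 1 (\<Sum>c\<in>UNIV. zz e c * d a c F) = sint 1 (if a = e then cst (1/2) * deg F else 0)"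
    using z by (simp add: sint_diff)
  then show ?thesis by (simp add: sint_cst)
qed

text \<open>On the unit sphere \<open>\<partial>\<^sub>a\<^sub>b F\<close> equals \<open>N \<partial>\<^sub>a\<^sub>b F\<close>.  By Cramer's rule \<open>N \<partial>\<^sub>a\<^sub>b\<close> is a combination of the fields of
  left multiplication with the cofactors \<open>\<partial>\<^sub>e\<^sub>b N\<close> as coefficients; those fields integrate to half the
  degree or to zero.\<close>

lemma divergence_theorem:
  assumes "hom k F"
  shows "2 * sint 1 (d a b F) = of_int (k + 3) * sint 1 (d a b NN * F)"
proof -
  have ab: "a = 1 \<or> a = 2" "b = 1 \<or> b = 2" by (rule exhaust_2)+
  let ?L = "\<lambda>e G. \<Sum>c\<in>UNIV. zz e c * d a c G"
  have n: "(\<Sum>e\<in>UNIV. ?L e (d e b NN * F)) = NN * d a b F - d a b NN * F"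
    using ab by (elim disjE) (simp_all add: NN_def d_zz sum_2 algebra_simps)
  have h: "hom (k + 1) (d a b NN * F)"
    using hom_mult[OF hom_d[OF hom_NN] assms] by (simp add: add.commute)
  have "sint 1 (d a b F) - sint 1 (d a b NN * F) = sint 1 (NN * d a b F - d a b NN * F)"
    by (simp add: sint_diff sint_NN)
  also have "\<dots> = (\<Sum>e\<in>UNIV. sint 1 (?L e (d e b NN * F)))"
    by (simp only: n[symmetric] sum_2 sint_add zero_less_one)
  also have "\<dots> = sint 1 (deg (d a b NN * F)) / 2"
    unfolding sint_left_field using ab by (auto simp: sum_2)
  also have "\<dots> = of_int (k + 1) * sint 1 (d a b NN * F) / 2"
    using h unfolding hom_def by (simp only: sint_of_int zero_less_one)
  finally show ?thesis by (simp add: field_simps)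
qed

subsection \<open>Scaling\<close>

lemma emeasure_lborel_scaleR:
  assumes R: "R > 0" and A: "A \<in> sets (borel :: 'a::euclidean_space measure)"
  shows "emeasure lborel A = ennreal (R ^ DIM('a)) * emeasure lborel {x. R *\<^sub>R x \<in> A}"
proof -
  have "emeasure lborel A = emeasure (density (distr lborel borel (\<lambda>x::'a. R *\<^sub>R x)) (\<lambda>_. \<bar>R\<bar>^DIM('a))) A"
    using lborel_affine[of R "0::'a"] R by simp
  also have "\<dots> = ennreal (R ^ DIM('a)) * emeasure (distr lborel borel (\<lambda>x::'a. R *\<^sub>R x)) A"
    using A R by (subst emeasure_density_const) auto
  also have "emeasure (distr lborel borel (\<lambda>x::'a. R *\<^sub>R x)) A = emeasure lborel {x. R *\<^sub>R x \<in> A}"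
    using A by (subst emeasure_distr) (auto simp: vimage_def)
  finally show ?thesis .
qed

lemma sphere_measure_scale:
  assumes R: "R > 0"
  shows "sphere_measure R = density (distr (sphere_measure 1) borel (\<lambda>x :: real^4. R *\<^sub>R x)) (\<lambda>_. ennreal (R ^ 3))"
proof (rule measure_eqI)
  fix E assume "E \<in> sets (sphere_measure R :: (real^4) measure)"
  then have E: "E \<in> sets borel" by simp
  let ?A = "{x \<in> ball 0 R - {0}. (R / norm x) *\<^sub>R x \<in> E}"
  let ?E' = "{x. R *\<^sub>R x \<in> E}"
  have E': "?E' \<in> sets borel"
    using measurable_sets[of "\<lambda>x::real^4. R *\<^sub>R x" borel borel E] E by (auto simp: vimage_def)
  have A: "?A \<in> sets borel" using E by measurable
  have "{x. R *\<^sub>R x \<in> ?A} = {x \<in> ball 0 1 - {0}. (1 / norm x) *\<^sub>R x \<in> ?E'}"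
    using R by auto
  then have "emeasure lborel ?A = ennreal (R ^ 4) * emeasure lborel {x \<in> ball 0 1 - {0}. (1 / norm x) *\<^sub>R x \<in> ?E'}"
    using emeasure_lborel_scaleR[OF R A] by simp
  then have "emeasure (sphere_measure R) E = ennreal (4 / R) * (ennreal (R ^ 4) * emeasure lborel {x \<in> ball 0 1 - {0}. (1 / norm x) *\<^sub>R x \<in> ?E'})"
    by (simp add: emeasure_sphere_measure[OF E])
  also have "\<dots> = ennreal (R ^ 3) * (ennreal 4 * emeasure lborel {x \<in> ball 0 1 - {0}. (1 / norm x) *\<^sub>R x \<in> ?E'})"
    using R unfolding mult.assoc[symmetric]
    by (simp flip: ennreal_mult ennreal_numeral add: field_simps power_numeral_reduce)
  also have "ennreal 4 * emeasure lborel {x \<in> ball 0 1 - {0}. (1 / norm x) *\<^sub>R x \<in> ?E'} = emeasure (sphere_measure 1) ?E'"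
    by (simp add: emeasure_sphere_measure[OF E'])
  also have "\<dots> = emeasure (distr (sphere_measure 1) borel (\<lambda>x :: real^4. R *\<^sub>R x)) E"
    using E by (subst emeasure_distr) (auto simp: vimage_def measurable_cong_sets[OF sets_sphere_measure refl])
  finally show "emeasure (sphere_measure R) E =
      emeasure (density (distr (sphere_measure 1) borel (\<lambda>x. R *\<^sub>R x)) (\<lambda>_. ennreal (R ^ 3))) E"
    using E by (simp add: emeasure_density_const)
qed simp

lemma bounded_linear_cscale: "bounded_linear (\<lambda>c. cscale c E)"
  by (rule linear_conv_bounded_linear[THEN iffD1], rule linearI)
     (simp_all add: cscale_def vec_eq_iff algebra_simps scaleR_conv_of_real[where 'a=complex])

lemma ev_has_field_derivative:
  assumes Z: "qnorm (W + cscale (g t) E) \<noteq> 0" and g: "(g has_field_derivative g') (at t)"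
  shows "((\<lambda>t. ev F (W + cscale (g t) E)) has_field_derivative
     g' * (\<Sum>a\<in>UNIV. \<Sum>b\<in>UNIV. E $ a $ b * ev (d a b F) (W + cscale (g t) E))) (at t)"
proof -
  let ?Z = "W + cscale (g t) E"
  have "((\<lambda>t. cscale (g t) E) has_derivative (\<lambda>h. cscale (g' * h) E)) (at t)"
    by (rule bounded_linear.has_derivative[OF bounded_linear_cscale]) (use g in \<open>simp add: has_field_derivative_def\<close>)
  then have 1: "((\<lambda>t. W + cscale (g t) E) has_derivative (\<lambda>h. cscale (g' * h) E)) (at t)"
    by (rule has_derivative_eq_rhs[OF has_derivative_add[OF has_derivative_const]]) simp
  have "(ev F has_derivative lin (\<lambda>a b. ev (d a b F) ?Z)) (at ?Z)"
    using has_gradient_d[of F] Z by (simp add: has_gradient_def)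
  from has_derivative_compose[OF 1 this]
  have "((\<lambda>t. ev F (W + cscale (g t) E)) has_derivative (\<lambda>h. lin (\<lambda>a b. ev (d a b F) ?Z) (cscale (g' * h) E))) (at t)" .
  moreover have "lin (\<lambda>a b. ev (d a b F) ?Z) (cscale (g' * h) E) =
      g' * (\<Sum>a\<in>UNIV. \<Sum>b\<in>UNIV. E $ a $ b * ev (d a b F) ?Z) * h" for h
    by (simp add: lin_def sum_2 cscale_def algebra_simps)
  ultimately show ?thesis by (simp add: has_field_derivative_def)
qed

lemma qnorm_cscale: "qnorm (cscale c Z) = c\<^sup>2 * qnorm Z"
  by (simp add: det_2 cscale_def power2_eq_square algebra_simps)

text \<open>Integration of Euler's equation along \<open>w \<mapsto> exp w Z\<close>.\<close>

lemma ev_cscale: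
  assumes h: "hom n F" and Z: "qnorm Z \<noteq> 0" and c: "c \<noteq> 0"
  shows "ev F (cscale c Z) = c powi n * ev F Z"
proof -
  define f where "f w = exp (- of_int n * w) * ev F (0 + cscale (exp w) Z)" for w
  have "(f has_field_derivative 0) (at w within UNIV)" for w
  proof -
    let ?S = "\<Sum>a\<in>UNIV. \<Sum>b\<in>UNIV. Z $ a $ b * ev (d a b F) (0 + cscale (exp w) Z)"
    have q: "qnorm (0 + cscale (exp w) Z) \<noteq> 0" using Z by (simp add: qnorm_cscale)
    have 1: "((\<lambda>w. ev F (0 + cscale (exp w) Z)) has_field_derivative exp w * ?S) (at w)"
      by (rule ev_has_field_derivative[where g = exp, OF q DERIV_exp])
    have "ev (deg F) (0 + cscale (exp w) Z) = of_int n * ev F (0 + cscale (exp w) Z)"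
      using h q by (simp add: hom_def)
    then have 2: "exp w * ?S = of_int n * ev F (0 + cscale (exp w) Z)"
      using q by (simp add: deg_def sum_2 cscale_def algebra_simps)
    have 3: "((\<lambda>w. exp (- of_int n * w)) has_field_derivative exp (- of_int n * w) * (- of_int n)) (at w)"
      by (auto intro!: derivative_eq_intros)
    show ?thesis
      unfolding f_def[abs_def] using DERIV_mult[OF 3 1[unfolded 2]] by (simp add: algebra_simps)
  qed
  then obtain k where k: "\<And>w. f w = k"
    using has_field_derivative_zero_constant[of UNIV f] by auto
  have "f (Ln c) = f 0" by (simp only: k)
  then have "exp (- of_int n * Ln c) * ev F (cscale c Z) = ev F Z"
    using c by (simp add: f_def) (simp add: cscale_def)
  moreover have "exp (- of_int n * Ln c) = inverse (c powi n)"
    using c exp_power_int[of "Ln c" n] by (simp add: exp_minus)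
  ultimately have "inverse (c powi n) * ev F (cscale c Z) = ev F Z" by simp
  then show ?thesis using c by (auto simp: field_simps)
qed

lemma ev_scale:
  assumes "hom k F" "qnorm Z \<noteq> 0" "r > 0"
  shows "ev F (r *\<^sub>R Z) = of_real (r powi k) * ev F Z"
proof -
  have "r *\<^sub>R Z = cscale (of_real r) Z"
    by (simp add: cscale_def vec_eq_iff scaleR_conv_of_real[where 'a=complex])
  then show ?thesis using ev_cscale[OF assms(1,2), of "of_real r"] assms(3) by simp
qed

lemma quat_scaleR: "quat (r *\<^sub>R x) = r *\<^sub>R quat x"
  by (simp add: quat_def cscale_def vec_eq_iff algebra_simps sum_UNIV_4_zero scaleR_conv_of_real[where 'a=complex])

lemma sint_scale:
  assumes R: "R > 0" and h: "hom k F"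
  shows "sint R F = of_real (R powi (k + 3)) * sint 1 F"
proof -
  have "sint R F = (LINT x|density (distr (sphere_measure 1) borel (\<lambda>x :: real^4. R *\<^sub>R x)) (\<lambda>_. ennreal (R ^ 3)). ev F (quat x))"
    unfolding sint_eq by (simp only: sphere_measure_scale[OF R])
  also have "\<dots> = R ^ 3 *\<^sub>R (LINT x|distr (sphere_measure 1) borel (\<lambda>x :: real^4. R *\<^sub>R x). ev F (quat x))"
    using R by (subst integral_density) auto
  also have "(LINT x|distr (sphere_measure 1) borel (\<lambda>x :: real^4. R *\<^sub>R x). ev F (quat x))
     = (LINT x|sphere_measure 1. ev F (quat (R *\<^sub>R x)))"
    by (rule integral_distr) (simp_all add: measurable_cong_sets[OF sets_sphere_measure refl])
  also have "\<dots> = (LINT x|sphere_measure 1. of_real (R powi k) * ev F (quat x))"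
  proof (rule integral_cong_AE)
    have "ev F (quat (R *\<^sub>R x)) = of_real (R powi k) * ev F (quat x)" if "norm x = 1" for x
      unfolding quat_scaleR by (rule ev_scale[OF h _ R]) (use that in \<open>simp add: qnorm_quat\<close>)
    then show "AE x in sphere_measure 1. ev F (quat (R *\<^sub>R x)) = of_real (R powi k) * ev F (quat x)"
      using AE_sphere_measure[OF zero_less_one] by (auto elim: eventually_mono)
  qed measurable
  finally show ?thesis
    using R by (simp add: sint_eq power_int_add scaleR_conv_of_real)
qed


section \<open>Invariance on homogeneous elements\<close>

definition homs :: "int \<Rightarrow> (2 \<Rightarrow> laurent) \<Rightarrow> bool" where
  "homs n f \<longleftrightarrow> (\<forall>a. hom n (f a))"

text \<open>The divergence theorem, applied to the current of degree \<open>m + n - 2\<close>.\<close>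

lemma sint_Q_degree:
  assumes U: "in_U f" "in_U' g" and h: "homs m f" "homs n g" and mn: "m + n \<noteq> - 1"
  shows "sint 1 (Q f g) = 0"
proof -
  have hc: "hom (m + n - 2) (current f g a b)" for a b
    using h hom_current[of m f n g a b] by (simp add: homs_def)
  have k: "m + n - 2 + 3 = m + n + 1" by simp
  have "of_int (m + n + 1) * sint 1 (Q f g) =
    (\<Sum>a\<in>UNIV. \<Sum>b\<in>UNIV. of_int (m + n - 2 + 3) * sint 1 (d a b NN * current f g a b))"
    unfolding k current_radial[symmetric] by (simp only: sum_2 sint_add zero_less_one distrib_left)
  also have "\<dots> = (\<Sum>a\<in>UNIV. \<Sum>b\<in>UNIV. 2 * sint 1 (d a b (current f g a b)))"
    by (simp only: divergence_theorem[OF hc])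
  also have "\<dots> = 2 * sint 1 (\<Sum>a\<in>UNIV. \<Sum>b\<in>UNIV. d a b (current f g a b))"
    by (simp only: sum_2 sint_add zero_less_one distrib_left)
  also have "\<dots> = 0" by (simp add: current_divergence[OF U])
  finally have "of_int (m + n + 1) * sint 1 (Q f g) = 0" .
  moreover have "(of_int (m + n + 1) :: complex) \<noteq> 0"
    using mn by (subst of_int_eq_0_iff) linarith
  ultimately show ?thesis by (simp only: mult_eq_0_iff simp_thms)
qed

text \<open>Only \<open>m + n = -1\<close> matters, where the degree of \<open>Q f g\<close> is \<open>-2\<close> and the sphere contributes \<open>R\<^sup>3\<close>.\<close>

lemma sint_Q_radius:
  assumes R: "R > 0" and U: "in_U f" "in_U' g" and h: "homs m f" "homs n g"
  shows "sint R (Q f g) / of_real R = sint 1 (Q f g)"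
proof -
  have "hom (m + n - 1) (Q f g)" using h by (intro hom_Q) (auto simp: homs_def)
  from sint_scale[OF R this]
  have s: "sint R (Q f g) = of_real (R powi (m + n + 2)) * sint 1 (Q f g)" by (simp add: algebra_simps)
  show ?thesis
  proof (cases "m + n = - 1")
    case True
    then have e: "m + n + 2 = 1" by simp
    show ?thesis using R unfolding s e by simp
  qed (simp add: s sint_Q_degree[OF U h])
qed

text \<open>Because the Hessian of the norm is symmetric, moving \<open>\<partial>\<close> off the current turns the radial
  component of a derivative of the current into its divergence.\<close>

lemma sint_Q_translation:
  assumes U: "in_U f" "in_U' g" and h: "homs m f" "homs n g"
  shows "sint 1 (Q (\<lambda>i. d c e (f i)) g + Q f (\<lambda>i. d c e (g i))) = 0"
proof (cases "m + n = 0")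
  case False
  have "homs (m - 1) (\<lambda>i. d c e (f i))" "homs (n - 1) (\<lambda>i. d c e (g i))"
    using h by (auto simp: homs_def hom_d)
  then show ?thesis
    using False sint_Q_degree[OF in_U_d[OF U(1)] U(2) _ h(2), of "m - 1" c e]
      sint_Q_degree[OF U(1) in_U'_d[OF U(2)] h(1), of "n - 1" c e] by (simp add: sint_add)
next
  case True
  let ?J = "current f g"
  have hJ: "hom (- 2) (?J a b)" for a b
    using h hom_current[of m f n g a b] True by (simp add: homs_def)
  have hN: "hom 1 (d a b NN)" for a b using hom_d[OF hom_NN, of a b] by simp
  have hNJ: "hom (- 1) (d a b NN * ?J a' b')" for a b a' b'
    using hom_mult[OF hN hJ] by simp
  have ibp: "sint 1 (d a b (d a' b' NN * ?J p q)) = sint 1 (d a b NN * (d a' b' NN * ?J p q))" for a b a' b' p q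
    using divergence_theorem[OF hNJ, of a b a' b' p q] by simp
  have swap: "sint 1 (d a b NN * d c e (?J a b)) = sint 1 (d c e NN * d a b (?J a b))" for a b
  proof -
    have "sint 1 (d a b NN * d c e (?J a b)) = sint 1 (d c e (d a b NN * ?J a b) - d c e (d a b NN) * ?J a b)"
      by (simp add: algebra_simps)
    also have "\<dots> = sint 1 (d a b (d c e NN * ?J a b) - d a b (d c e NN) * ?J a b)"
      unfolding sint_diff[OF zero_less_one] ibp by (simp only: d_commute[of c e a b] mult.left_commute)
    also have "\<dots> = sint 1 (d c e NN * d a b (?J a b))"
      by (simp add: algebra_simps)
    finally show ?thesis .
  qed
  have "Q (\<lambda>i. d c e (f i)) g + Q f (\<lambda>i. d c e (g i)) = (\<Sum>a\<in>UNIV. \<Sum>b\<in>UNIV. d a b NN * d c e (?J a b))"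
    unfolding current_radial[symmetric] d_current by (simp add: sum.distrib distrib_left)
  also have "sint 1 \<dots> = (\<Sum>a\<in>UNIV. \<Sum>b\<in>UNIV. sint 1 (d c e NN * d a b (?J a b)))"
    by (simp only: sum_2 sint_add zero_less_one swap)
  also have "\<dots> = sint 1 (d c e NN * (\<Sum>a\<in>UNIV. \<Sum>b\<in>UNIV. d a b (?J a b)))"
    by (simp only: sum_2 sint_add zero_less_one distrib_left)
  also have "\<dots> = 0" by (simp add: current_divergence[OF U])
  finally show ?thesis .
qed

text \<open>For right multiplication the divergence theorem takes the place of rotation invariance.\<close>

lemma sint_lr_field:
  assumes "hom k F"
  shows "sint 1 (lr_field A D F) = (trace D - trace A) * of_int k / 2 * sint 1 F"
proof -
  let ?I = "sint 1"
  have L: "?I (\<Sum>c\<in>UNIV. zz e c * d a c F) = (if a = e then of_int k * ?I F / 2 else 0)" for a e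
    using assms by (simp only: sint_left_field hom_def sint_of_int zero_less_one)
  have Rr: "?I (\<Sum>c\<in>UNIV. zz c a * d c b F) = (if a = b then of_int k * ?I F / 2 else 0)" for a b
  proof -
    have ab: "a = 1 \<or> a = 2" "b = 1 \<or> b = 2" by (rule exhaust_2)+
    have h: "hom (k + 1) (zz c a * F)" for c
      using hom_mult[OF hom_zz assms] by (simp add: add.commute)
    have "2 * ?I (\<Sum>c\<in>UNIV. d c b (zz c a * F)) = of_int (k + 1 + 3) * ?I (\<Sum>c\<in>UNIV. d c b NN * (zz c a * F))"
      by (simp only: sum_2 sint_add zero_less_one distrib_left divergence_theorem[OF h])
    also have "(\<Sum>c\<in>UNIV. d c b NN * (zz c a * F)) = (if a = b then NN * F else 0)"
      using ab by (elim disjE) (simp_all add: sum_2 NN_def d_zz algebra_simps)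
    also have "(\<Sum>c\<in>UNIV. d c b (zz c a * F)) = (\<Sum>c\<in>UNIV. zz c a * d c b F) + (if a = b then 2 * F else 0)"
      using ab by (elim disjE) (simp_all add: sum_2 algebra_simps)
    finally have e: "2 * ?I ((\<Sum>c\<in>UNIV. zz c a * d c b F) + (if a = b then 2 * F else 0)) =
      of_int (k + 1 + 3) * ?I (if a = b then NN * F else 0)" .
    show ?thesis
    proof (cases "a = b")
      case True
      then have "2 * (?I (\<Sum>c\<in>UNIV. zz c a * d c b F) + 2 * ?I F) = of_int (k + 1 + 3) * ?I F"
        using e by (simp add: sint_add sint_NN sint_numeral)
      then show ?thesis using True by (simp add: algebra_simps)
    qed (use e in simp)
  qed
  have e: "lr_field A D F = (\<Sum>e\<in>UNIV. \<Sum>b\<in>UNIV. cst (D $ e $ b) * (\<Sum>c\<in>UNIV. zz c e * d c b F))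
     - (\<Sum>a\<in>UNIV. \<Sum>e\<in>UNIV. cst (A $ a $ e) * (\<Sum>c\<in>UNIV. zz e c * d a c F))"
    by (simp add: lr_field_def sum_2 algebra_simps)
  have lin: "?I (\<Sum>e\<in>UNIV. \<Sum>b\<in>UNIV. cst (x e b) * G e b) = (\<Sum>e\<in>UNIV. \<Sum>b\<in>UNIV. x e b * ?I (G e b))"
    for x and G :: "2 \<Rightarrow> 2 \<Rightarrow> laurent"
    by (simp only: sum_2 sint_add sint_cst zero_less_one)
  have e2: "?I (lr_field A D F) = (\<Sum>e\<in>UNIV. \<Sum>b\<in>UNIV. D $ e $ b * ?I (\<Sum>c\<in>UNIV. zz c e * d c b F))
     - (\<Sum>a\<in>UNIV. \<Sum>e\<in>UNIV. A $ a $ e * ?I (\<Sum>c\<in>UNIV. zz e c * d a c F))"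
    unfolding e by (simp only: sint_diff lin zero_less_one)
  show ?thesis
    unfolding e2 L Rr by (simp add: sum_2 trace_2 field_simps)
qed

lemma hom_lr_field: "hom k F \<Longrightarrow> hom k (lr_field A D F)"
  unfolding hom_def deg_lr_field using lr_field_simps(4)[of A D "of_int k"] by (simp del: lr_field_simps(4))

lemma sint_Q_diag:
  assumes U: "in_U f" "in_U' g" and h: "homs m f" "homs n g"
  shows "sint 1 (Q (diag_left A D f) g + Q f (diag_right A D g)) = 0"
proof -
  have "hom (m + n - 1) (Q f g)" using h by (intro hom_Q) (auto simp: homs_def)
  then have "sint 1 (Q (diag_left A D f) g + Q f (diag_right A D g)) =
     (trace D - trace A) * of_int (m + n + 1) / 2 * sint 1 (Q f g)"
    unfolding Q_diag by (simp only: sint_add sint_lr_field sint_cst zero_less_one) (simp add: field_simps)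
  then show ?thesis
    using sint_Q_degree[OF U h] by (cases "m + n + 1 = 0") auto
qed

subsection \<open>Invariance under inversion\<close>

lemma dirac_inv_left: "dirac (inv_left f) b = Ninv * \<tau> (f b) - (\<Sum>e\<in>UNIV. Ninv * zi b e * \<tau> (dirac f e))"
proof -
  let ?u = "\<lambda>e. Ninv * \<tau> (f e)"
  have b: "b = 1 \<or> b = 2" by (rule exhaust_2)
  have "dirac (inv_left f) b = 2 * ?u b + (\<Sum>e\<in>UNIV. \<Sum>c\<in>UNIV. zz c e * d c b (?u e))"
    using b by (auto simp: dirac_def inv_left_def sum_2 algebra_simps)
  also have "(\<Sum>e\<in>UNIV. \<Sum>c\<in>UNIV. zz c e * d c b (?u e)) =
     - (\<Sum>e\<in>UNIV. (zi b 1 * zz 1 e + zi b 2 * zz 2 e) * ?u e)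
     - (\<Sum>e\<in>UNIV. \<Sum>p\<in>UNIV. \<Sum>q\<in>UNIV. (zi p 1 * zz 1 e + zi p 2 * zz 2 e) * Ninv * zi b q * \<tau> (d p q (f e)))"
    by (simp add: sum_2 d_\<tau> d_Ninv_zi algebra_simps)
  also have "\<dots> = - ?u b - (\<Sum>q\<in>UNIV. Ninv * zi b q * \<tau> (dirac f q))"
    using b by (elim disjE) (simp_all only: sum_2 zi_zz, simp_all add: dirac_def algebra_simps)
  finally show ?thesis by simp
qed

lemma cod_\<tau>: "cod a b (\<tau> F) = - (Ninv * Ninv * (\<Sum>c\<in>UNIV. \<Sum>e\<in>UNIV. zz a c * zz e b * \<tau> (cod c e F)))"
  using exhaust_2[of a] exhaust_2[of b]
  by (auto simp: cod_def d_\<tau> sum_2 zi_def algebra_simps)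

lemma cod_Ninv: "cod a b Ninv = - (Ninv * Ninv * zz a b)"
  using exhaust_2[of a] exhaust_2[of b] by (auto simp: cod_def d_Ninv)

lemma cod_mult: "cod a b (F * G) = cod a b F * G + F * cod a b G"
  by (simp add: cod_def algebra_simps)

lemma zi_cod_zi: "(\<Sum>c\<in>UNIV. \<Sum>q\<in>UNIV. zi e c * cod c q F * zi q b) = Ninv * (zi e b * deg F - d b e F)"
proof -
  have "(zz 1 1 * zz 2 2 - zz 1 2 * zz 2 1) * Ninv * Ninv = Ninv"
    using NN_Ninv(1) unfolding NN_def by simp
  then have n: "Ninv * (Ninv * (zz 1 1 * zz 2 2)) = Ninv + Ninv * (Ninv * (zz 1 2 * zz 2 1))"
    by (simp add: algebra_simps)
  have n': "Ninv * (Ninv * (zz 1 1 * (zz 2 2 * x))) = Ninv * x + Ninv * (Ninv * (zz 1 2 * (zz 2 1 * x)))" for x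
    using arg_cong[OF n, of "\<lambda>y. y * x"] by (simp add: algebra_simps)
  have eb: "e = 1 \<or> e = 2" "b = 1 \<or> b = 2" by (rule exhaust_2)+
  have l: "(\<Sum>c\<in>UNIV. \<Sum>q\<in>UNIV. zi e c * cod c q F * zi q b) =
      (Ninv * Ninv) * (\<Sum>c\<in>UNIV. \<Sum>q\<in>UNIV. (NN * zi e c) * cod c q F * (NN * zi q b))"
    by (simp add: sum_2 algebra_simps NN_Ninv_cancel)
  have r: "Ninv * (zi e b * deg F - d b e F) = (Ninv * Ninv) * ((NN * zi e b) * deg F - NN * d b e F)"
    by (simp add: algebra_simps NN_Ninv_cancel)
  show ?thesis
    unfolding l r using eb by (elim disjE) (simp_all only: sum_2 NN_zi, simp_all add: cod_def deg_def NN_def algebra_simps)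
qed

definition row_zi_col :: "(2 \<Rightarrow> laurent) \<Rightarrow> (2 \<Rightarrow> laurent) \<Rightarrow> laurent" where
  "row_zi_col g f = (\<Sum>e\<in>UNIV. \<Sum>b\<in>UNIV. g e * zi e b * f b)"

lemma row_adj_col_eq: "row_adj_col g f = NN * row_zi_col g f"
proof -
  have e: "NN * row_zi_col g f = (\<Sum>e\<in>UNIV. \<Sum>b\<in>UNIV. g e * (NN * zi e b) * f b)"
    by (simp add: row_zi_col_def sum_2 algebra_simps)
  show ?thesis unfolding e by (simp only: row_adj_col_def sum_2 NN_zi) (simp add: algebra_simps)
qed

lemma row_adj_inv_left: "row_adj_col h (inv_left f) = (\<Sum>b\<in>UNIV. h b * \<tau> (f b))"
proof -
  have "row_zi_col h (inv_left f) = (\<Sum>e\<in>UNIV. \<Sum>c\<in>UNIV. h e * (zi e 1 * zz 1 c + zi e 2 * zz 2 c) * Ninv * \<tau> (f c))"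
    by (simp add: row_zi_col_def inv_left_def sum_2 algebra_simps)
  also have "\<dots> = Ninv * (\<Sum>b\<in>UNIV. h b * \<tau> (f b))"
    by (simp only: sum_2 zi_zz) (simp add: algebra_simps)
  finally show ?thesis by (simp add: row_adj_col_eq NN_Ninv_cancel)
qed

text \<open>Both sides are brought to the same three integrals; the integral of the divergence of
  \<open>g\<^sub>e f\<^sub>b\<close>, which has degree \<open>-1\<close>, accounts for the difference.\<close>

lemma sint_Q_inversion:
  assumes h: "homs m f" "homs n g" and mn: "m + n = - 1"
  shows "sint 1 (Q (inv_left f) (inv_right g)) = sint 1 (Q f g)"
proof -
  let ?I = "sint 1" and ?N2 = "NN * NN" and ?N3 = "NN * NN * NN"
  define P where "P = (\<Sum>b\<in>UNIV. g b * dirac f b)"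
  define X where "X = row_zi_col g f"
  define T where "T = row_zi_col (\<lambda>e. lap (g e)) f"
  define D where "D = (\<Sum>e\<in>UNIV. \<Sum>b\<in>UNIV. d b e (g e) * f b)"
  have hf: "hom m (f a)" and hg: "hom n (g a)" for a using h by (auto simp: homs_def)
  have one: "?I (NN * F) = ?I F" for F by (simp add: sint_NN)
  have A: "(\<Sum>b\<in>UNIV. inv_right g b * dirac (inv_left f) b) = \<tau> (?N2 * (X - P))"
  proof -
    have "(\<Sum>b\<in>UNIV. inv_right g b * dirac (inv_left f) b) =
      Ninv * Ninv * ((\<Sum>e\<in>UNIV. \<Sum>b\<in>UNIV. \<tau> (g e) * zz e b * \<tau> (f b))
        - (\<Sum>e\<in>UNIV. \<Sum>c\<in>UNIV. \<tau> (g e) * (zz e 1 * zi 1 c + zz e 2 * zi 2 c) * \<tau> (dirac f c)))"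
      unfolding dirac_inv_left by (simp add: inv_right_def sum_2 algebra_simps)
    also have "\<dots> = \<tau> (?N2 * (X - P))"
      by (simp only: sum_2 zz_zi) (simp add: X_def P_def row_zi_col_def sum_2 algebra_simps)
    finally show ?thesis .
  qed
  have B: "row_adj_col (\<lambda>a. lap (inv_right g a)) (inv_left f) =
     \<tau> (?N3 * T - ?N2 * X - ?N3 * (\<Sum>e\<in>UNIV. \<Sum>b\<in>UNIV. (\<Sum>c\<in>UNIV. \<Sum>q\<in>UNIV. zi e c * cod c q (g e) * zi q b) * f b))"
    unfolding row_adj_inv_left lap_inv_right cod_mult cod_Ninv cod_\<tau>
    by (simp add: sum_2 X_def T_def row_zi_col_def algebra_simps)
  have "?N3 * (\<Sum>e\<in>UNIV. \<Sum>b\<in>UNIV. (\<Sum>c\<in>UNIV. \<Sum>q\<in>UNIV. zi e c * cod c q (g e) * zi q b) * f b) =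
     ?N2 * (of_int n * X - D)"
    using hg unfolding zi_cod_zi hom_def
    by (simp add: X_def D_def row_zi_col_def sum_2 algebra_simps NN_Ninv_cancel)
  from B[unfolded this] have IB: "?I (row_adj_col (\<lambda>a. lap (inv_right g a)) (inv_left f)) =
     ?I T - ?I X - of_int n * ?I X + ?I D"
    by (simp only: sint_\<tau> sint_diff sint_add zero_less_one mult.assoc one sint_of_int) simp
  have IA: "?I (\<Sum>b\<in>UNIV. inv_right g b * dirac (inv_left f) b) = ?I X - ?I P"
    unfolding A by (simp only: sint_\<tau> sint_diff zero_less_one mult.assoc one)
  have ID: "?I P + ?I D = ?I X"
  proof -
    have gf: "hom (- 1) (g e * f b)" for e b
      using hom_mult[OF hg hf, of e b] mn by (simp add: add.commute)
    have "P + D = (\<Sum>e\<in>UNIV. \<Sum>b\<in>UNIV. d b e (g e * f b))"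
      by (simp add: P_def D_def dirac_def sum_2 algebra_simps)
    then have "?I P + ?I D = (\<Sum>e\<in>UNIV. \<Sum>b\<in>UNIV. ?I (d b e (g e * f b)))"
      by (simp only: sum_2 sint_add zero_less_one flip: sint_add)
    also have "\<dots> = (\<Sum>e\<in>UNIV. \<Sum>b\<in>UNIV. ?I (d b e NN * (g e * f b)))"
      using divergence_theorem[OF gf] by simp
    also have "\<dots> = ?I (\<Sum>e\<in>UNIV. \<Sum>b\<in>UNIV. d b e NN * (g e * f b))"
      by (simp only: sum_2 sint_add zero_less_one)
    also have "(\<Sum>e\<in>UNIV. \<Sum>b\<in>UNIV. d b e NN * (g e * f b)) = row_adj_col g f"
      by (simp add: row_adj_col_def sum_2 algebra_simps)
    finally show ?thesis by (simp add: row_adj_col_eq X_def one)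
  qed
  have n: "n = - 1 - m" using mn by simp
  have e1: "?I (Q f g) = of_int (n - m + 1) * ?I P - 2 * ?I T"
    unfolding Q_hom[of m f n g, OF hf hg] P_def[symmetric]
    by (simp only: sint_diff sint_of_int sint_numeral zero_less_one row_adj_col_eq one T_def)
  have e2: "?I (Q (inv_left f) (inv_right g)) = of_int ((- 1 - n) - (- 1 - m) + 1) * (?I X - ?I P)
      - 2 * (?I T - ?I X - of_int n * ?I X + ?I D)"
    unfolding Q_hom[of "- 1 - m" "inv_left f" "- 1 - n" "inv_right g", OF hom_inv_left[OF hf] hom_inv_right[OF hg]]
    by (simp only: sint_diff sint_of_int sint_numeral zero_less_one IA IB)
  have e3: "?I D = ?I X - ?I P" using ID by (simp add: algebra_simps)
  show ?thesis unfolding e1 e2 e3 by (simp add: n algebra_simps)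
qed

subsection \<open>The lower left block\<close>

text \<open>The vector field \<open>Z C Z\<close>.\<close>

definition quad_coeff :: "complex^2^2 \<Rightarrow> 2 \<Rightarrow> 2 \<Rightarrow> laurent" where
  "quad_coeff C a b = (\<Sum>p\<in>UNIV. \<Sum>q\<in>UNIV. zz a p * cst (C $ p $ q) * zz q b)"

definition quad_field :: "complex^2^2 \<Rightarrow> laurent \<Rightarrow> laurent" where
  "quad_field C F = (\<Sum>a\<in>UNIV. \<Sum>b\<in>UNIV. quad_coeff C a b * d a b F)"

definition trace_coeff :: "complex^2^2 \<Rightarrow> laurent" where
  "trace_coeff C = (\<Sum>a\<in>UNIV. \<Sum>p\<in>UNIV. zz a p * cst (C $ p $ a))"

definition const_field :: "complex^2^2 \<Rightarrow> laurent \<Rightarrow> laurent" where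
  "const_field B F = (\<Sum>a\<in>UNIV. \<Sum>b\<in>UNIV. cst (B $ a $ b) * d a b F)"

definition quad_left :: "complex^2^2 \<Rightarrow> (2 \<Rightarrow> laurent) \<Rightarrow> 2 \<Rightarrow> laurent" where
  "quad_left C f a = quad_field C (f a) + trace_coeff C * f a
     - (\<Sum>e\<in>UNIV. \<Sum>p\<in>UNIV. zz a p * cst (C $ p $ e) * f e)"

definition quad_right :: "complex^2^2 \<Rightarrow> (2 \<Rightarrow> laurent) \<Rightarrow> 2 \<Rightarrow> laurent" where
  "quad_right C g b = quad_field C (g b) + trace_coeff C * g b
     - (\<Sum>e\<in>UNIV. \<Sum>p\<in>UNIV. g e * cst (C $ e $ p) * zz p b)"

lemma quad_field_mult: "quad_field C (F * G) = quad_field C F * G + F * quad_field C G"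
  and quad_field_add: "quad_field C (F + G) = quad_field C F + quad_field C G"
  by (simp_all add: quad_field_def sum_2 algebra_simps)

lemma quad_field_zz: "quad_field C (zz a b) = quad_coeff C a b"
  using exhaust_2[of a] exhaust_2[of b] by (auto simp: quad_field_def sum_2)

lemma quad_field_Ninv: "quad_field C Ninv = - (trace_coeff C * Ninv)"
proof -
  have e: "quad_field C Ninv = - (Ninv * (\<Sum>a\<in>UNIV. \<Sum>p\<in>UNIV. \<Sum>q\<in>UNIV. (zz q 1 * zi 1 a + zz q 2 * zi 2 a) * (zz a p * cst (C $ p $ q))))"
    by (simp add: quad_field_def quad_coeff_def d_Ninv_zi sum_2 algebra_simps)
  show ?thesis
    unfolding e by (simp only: sum_2 zz_zi) (simp add: sum_2 trace_coeff_def algebra_simps)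
qed

lemma quad_field_\<tau>: "quad_field C (\<tau> F) = - \<tau> (const_field C F)"
proof -
  have e: "quad_field C (\<tau> F) = - (\<Sum>c\<in>UNIV. \<Sum>e\<in>UNIV. \<Sum>p\<in>UNIV. \<Sum>q\<in>UNIV.
     (zi c 1 * zz 1 p + zi c 2 * zz 2 p) * cst (C $ p $ q) * (zz q 1 * zi 1 e + zz q 2 * zi 2 e) * \<tau> (d c e F))"
    by (simp add: quad_field_def quad_coeff_def d_\<tau> sum_2 algebra_simps)
  show ?thesis
    unfolding e by (simp only: sum_2 zz_zi zi_zz) (simp add: sum_2 const_field_def algebra_simps)
qed

lemma quad_left_inv: "quad_left C (inv_left f) b = - inv_left (\<lambda>e. const_field C (f e)) b"
  by (simp add: quad_left_def inv_left_def quad_field_mult quad_field_add quad_field_zz quad_field_Ninv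
      quad_field_\<tau> quad_coeff_def sum_2 algebra_simps)

lemma quad_right_inv: "quad_right C (inv_right f) b = - inv_right (\<lambda>e. const_field C (f e)) b"
  by (simp add: quad_right_def inv_right_def quad_field_mult quad_field_add quad_field_zz quad_field_Ninv
      quad_field_\<tau> quad_coeff_def sum_2 algebra_simps)

lemma hom_const_field: "hom n F \<Longrightarrow> hom (n - 1) (const_field C F)"
  unfolding const_field_def sum_2 by (intro hom_add hom_cst_mult hom_d)

lemma lap_const_field: "lap (const_field C F) = const_field C (lap F)"
  by (simp add: const_field_def sum_2 lap_d)

lemma d_const_field: "d a b (const_field C F) = const_field C (d a b F)"
  by (simp add: const_field_def sum_2 d_commute[of a b])

lemma const_field_add: "const_field C (F + G) = const_field C F + const_field C G"
  by (simp add: const_field_def sum_2 algebra_simps)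

lemma const_field_zero: "const_field C 0 = 0" by (simp add: const_field_def)

lemma in_U_const_field: "in_U f \<Longrightarrow> in_U (\<lambda>e. const_field C (f e))"
  unfolding in_U_def dirac_def lap_const_field d_const_field by (simp flip: const_field_add add: const_field_zero)

lemma in_U'_const_field: "in_U' f \<Longrightarrow> in_U' (\<lambda>e. const_field C (f e))"
  unfolding in_U'_def dirac'_def lap_const_field d_const_field by (simp flip: const_field_add add: const_field_zero)

lemma homs_inv: "homs m f \<Longrightarrow> homs (- 1 - m) (inv_left f)" "homs m f \<Longrightarrow> homs (- 1 - m) (inv_right f)"
  by (auto simp: homs_def hom_inv_left hom_inv_right)

lemma sint_Q_const_field:
  assumes U: "in_U f" "in_U' g" and h: "homs m f" "homs n g"
  shows "sint 1 (Q (\<lambda>e. const_field B (f e)) g + Q f (\<lambda>e. const_field B (g e))) = 0"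
proof -
  let ?t = "\<lambda>a b. Q (\<lambda>e. d a b (f e)) g + Q f (\<lambda>e. d a b (g e))"
  have "Q (\<lambda>e. const_field B (f e)) g + Q f (\<lambda>e. const_field B (g e)) = (\<Sum>a\<in>UNIV. \<Sum>b\<in>UNIV. cst (B $ a $ b) * ?t a b)"
    unfolding const_field_def sum_2 Q_add_left Q_add_right Q_cst_left Q_cst_right by (simp add: algebra_simps)
  moreover have "sint 1 (?t a b) = 0" for a b by (rule sint_Q_translation[OF U h])
  ultimately show ?thesis by (simp only: sum_2 sint_add sint_cst zero_less_one) simp
qed

lemma Q_uminus: "Q (\<lambda>a. - f a) g = - Q f g" "Q f (\<lambda>a. - g a) = - Q f g"
  using Q_cst_left[of "- 1"] Q_cst_right[of f "- 1"] by simp_all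

text \<open>Inversion conjugates the lower left block into the upper right one.\<close>

lemma sint_Q_quad:
  assumes U: "in_U f" "in_U' g" and h: "homs m f" "homs n g"
  shows "sint 1 (Q (quad_left C f) g + Q f (quad_right C g)) = 0"
proof -
  define F G where "F = inv_left f" and "G = inv_right g"
  have UF: "in_U F" "in_U' G" using U by (auto simp: F_def G_def in_U_inv_left in_U'_inv_right)
  have hF: "homs (- 1 - m) F" "homs (- 1 - n) G" using h by (auto simp: F_def G_def homs_inv)
  have fg: "f = inv_left F" "g = inv_right G"
    by (simp_all add: F_def G_def inv_left_involution inv_right_involution fun_eq_iff)
  let ?cF = "\<lambda>e. const_field C (F e)" and ?cG = "\<lambda>e. const_field C (G e)"
  have hc: "homs (- 1 - m - 1) ?cF" "homs (- 1 - n - 1) ?cG"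
    using hF unfolding homs_def by (blast intro: hom_const_field)+
  have e: "Q (quad_left C f) g + Q f (quad_right C g) = - (Q (inv_left ?cF) (inv_right G) + Q (inv_left F) (inv_right ?cG))"
    unfolding fg quad_left_inv[abs_def] quad_right_inv[abs_def] Q_uminus by (simp add: algebra_simps)
  show ?thesis
  proof (cases "m + n = - 2")
    case True
    have "sint 1 (Q (inv_left ?cF) (inv_right G)) = sint 1 (Q ?cF G)"
      by (rule sint_Q_inversion[OF hc(1) hF(2)]) (use True in simp)
    moreover have "sint 1 (Q (inv_left F) (inv_right ?cG)) = sint 1 (Q F ?cG)"
      by (rule sint_Q_inversion[OF hF(1) hc(2)]) (use True in simp)
    ultimately show ?thesis
      using sint_Q_const_field[OF UF hF, of C] unfolding e by (simp only: sint_add sint_uminus zero_less_one) simp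
  next
    case False
    have i: "in_U (inv_left ?cF)" "in_U' (inv_right ?cG)"
      using UF by (auto intro!: in_U_inv_left in_U'_inv_right in_U_const_field in_U'_const_field)
    have "sint 1 (Q (inv_left ?cF) g) = 0" "sint 1 (Q f (inv_right ?cG)) = 0"
      using False sint_Q_degree[OF i(1) U(2) homs_inv(1)[OF hc(1)] h(2)]
        sint_Q_degree[OF U(1) i(2) h(1) homs_inv(2)[OF hc(2)]] by auto
    then show ?thesis unfolding e fg[symmetric] by (simp add: sint_add sint_uminus sint_diff)
  qed
qed


section \<open>Non-degeneracy on homogeneous elements\<close>

inductive polynomial :: "laurent \<Rightarrow> bool" where
  cst: "polynomial (cst c)"
| zz: "polynomial (zz a b)"
| add: "polynomial F \<Longrightarrow> polynomial G \<Longrightarrow> polynomial (F + G)"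
| mult: "polynomial F \<Longrightarrow> polynomial G \<Longrightarrow> polynomial (F * G)"

lemma polynomial_numeral: "polynomial 0" "polynomial 1" "polynomial (numeral k)"
  using polynomial.cst[of 0] polynomial.cst[of 1] polynomial.cst[of "numeral k"] by simp_all

lemma polynomial_diff: "polynomial F \<Longrightarrow> polynomial G \<Longrightarrow> polynomial (F - G)"
  using polynomial.add[OF _ polynomial.mult[OF polynomial.cst[of "- 1"]], of F G] by simp

lemma polynomial_NN: "polynomial NN"
  unfolding NN_def by (intro polynomial_diff polynomial.mult polynomial.zz)

lemma polynomial_power: "polynomial F \<Longrightarrow> polynomial (F ^ k)"
  by (induction k) (auto intro: polynomial.mult polynomial_numeral)

lemma polynomial_d: "polynomial F \<Longrightarrow> polynomial (d a b F)"
  by (induction rule: polynomial.induct) (auto simp: d_zz intro: polynomial.intros polynomial_numeral)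

lemma polynomial_lap: "polynomial F \<Longrightarrow> polynomial (lap F)"
  unfolding lap_def by (intro polynomial_diff polynomial_d)

lemma Ninv_power_NN: "Ninv ^ k * NN ^ k = 1"
  by (simp flip: power_mult_distrib)

lemma laurent_denominator: "\<exists>k p. polynomial p \<and> F = Ninv ^ k * p"
proof (induction F rule: laurent_induct)
  case (cst c) show ?case by (rule exI[of _ 0]) (auto intro: polynomial.cst)
next
  case (zz a b) show ?case by (rule exI[of _ 0]) (auto intro: polynomial.zz)
next
  case Ninv show ?case by (rule exI[of _ 1], rule exI[of _ 1]) (auto intro: polynomial_numeral)
next
  case (add F G)
  then obtain k p l q where p: "polynomial p" "F = Ninv ^ k * p" and q: "polynomial q" "G = Ninv ^ l * q" by auto
  have "F + G = Ninv ^ (k + l) * (NN ^ l * p + NN ^ k * q)"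
  proof -
    have "Ninv ^ (k + l) * (NN ^ l * p + NN ^ k * q) = (Ninv ^ l * NN ^ l) * (Ninv ^ k * p) + (Ninv ^ k * NN ^ k) * (Ninv ^ l * q)"
      by (simp add: power_add algebra_simps)
    then show ?thesis by (simp add: Ninv_power_NN p q)
  qed
  moreover have "polynomial (NN ^ l * p + NN ^ k * q)"
    by (intro polynomial.add polynomial.mult polynomial_power polynomial_NN p q)
  ultimately show ?case by blast
next
  case (mult F G)
  then obtain k p l q where p: "polynomial p" "F = Ninv ^ k * p" and q: "polynomial q" "G = Ninv ^ l * q" by auto
  have "F * G = Ninv ^ (k + l) * (p * q)" by (simp add: p q power_add algebra_simps)
  then show ?case using polynomial.mult[OF p(1) q(1)] by blast
qed

lemma polynomial_continuous_extension:
  "polynomial F \<Longrightarrow> \<exists>h. continuous_on UNIV h \<and> (\<forall>Z. qnorm Z \<noteq> 0 \<longrightarrow> ev F Z = h Z)"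
proof (induction rule: polynomial.induct)
  case (cst c) show ?case by (rule exI[of _ "\<lambda>_. c"]) (auto intro: continuous_intros)
next
  case (zz a b) show ?case by (rule exI[of _ "\<lambda>Z. Z $ a $ b"]) (simp, intro continuous_intros)
next
  case (add F G)
  then obtain h k where "continuous_on UNIV h" "\<forall>Z. qnorm Z \<noteq> 0 \<longrightarrow> ev F Z = h Z"
    "continuous_on UNIV k" "\<forall>Z. qnorm Z \<noteq> 0 \<longrightarrow> ev G Z = k Z" by auto
  then show ?case by (intro exI[of _ "\<lambda>Z. h Z + k Z"]) (auto intro: continuous_intros)
next
  case (mult F G)
  then obtain h k where "continuous_on UNIV h" "\<forall>Z. qnorm Z \<noteq> 0 \<longrightarrow> ev F Z = h Z"
    "continuous_on UNIV k" "\<forall>Z. qnorm Z \<noteq> 0 \<longrightarrow> ev G Z = k Z" by auto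
  then show ?case by (intro exI[of _ "\<lambda>Z. h Z * k Z"]) (auto intro: continuous_intros)
qed

text \<open>A polynomial is continuous at the origin, and one of degree 0 is constant on each ray.\<close>

lemma polynomial_degree_zero:
  assumes p: "polynomial F" and h: "hom 0 F"
  shows "\<exists>c. F = cst c"
proof -
  obtain e where e: "continuous_on UNIV e" "\<And>Z. qnorm Z \<noteq> 0 \<Longrightarrow> ev F Z = e Z"
    using polynomial_continuous_extension[OF p] by blast
  have "F = cst (e 0)"
  proof (rule laurent_eqI)
    fix Z :: "complex^2^2" assume Z: "qnorm Z \<noteq> 0"
    have "ev F Z = e ((1 / real (Suc n)) *\<^sub>R Z)" for n
    proof -
      have r: "1 / real (Suc n) > 0" by simp
      have q: "qnorm ((1 / real (Suc n)) *\<^sub>R Z) \<noteq> 0"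
        using Z by (simp add: det_2 field_simps del: of_nat_Suc)
      show ?thesis using ev_scale[OF h Z r] e(2)[OF q] by simp
    qed
    moreover have "(\<lambda>n. e ((1 / real (Suc n)) *\<^sub>R Z)) \<longlonglongrightarrow> e (0 *\<^sub>R Z)"
    proof (rule continuous_on_tendsto_compose[OF e(1)])
      have "(\<lambda>n. 1 / real (Suc n)) \<longlonglongrightarrow> 0" by (rule LIMSEQ_Suc[OF lim_1_over_n])
      then show "(\<lambda>n. (1 / real (Suc n)) *\<^sub>R Z) \<longlonglongrightarrow> 0 *\<^sub>R Z" by (intro tendsto_intros)
    qed auto
    ultimately show "ev F Z = ev (cst (e 0)) Z"
      using Z by (simp add: LIMSEQ_const_iff)
  qed
  then show ?thesis ..
qed

lemma hom_power: "hom n F \<Longrightarrow> hom (int k * n) (F ^ k)"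
proof (induction k)
  case (Suc k) then show ?case
    using hom_mult[of n F "int k * n" "F ^ k"] by (simp add: algebra_simps)
qed (simp add: hom_def)

lemma mixed_Ninv: "mixed Ninv F = - (Ninv * Ninv * deg F)"
  by (simp add: mixed_def d_Ninv deg_def algebra_simps)

lemma lap_Ninv_mult: "lap (Ninv * F) = Ninv * lap F - Ninv * Ninv * deg F"
proof -
  have "lap Ninv = 0" using kelvin[of 1] lap_simps(6)[of 1] by simp
  then show ?thesis by (simp add: lap_mult mixed_Ninv)
qed

lemma lap_Ninv_power:
  assumes "hom j F"
  shows "lap (Ninv ^ s * F) = Ninv ^ s * lap F - of_int (int s * (j + 1 - int s)) * (Ninv ^ Suc s * F)"
proof (induction s)
  case (Suc s)
  have "hom (int s * (- 2) + j) (Ninv ^ s * F)"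
    by (rule hom_mult[OF hom_power[OF hom_Ninv] assms])
  then have dg: "deg (Ninv ^ s * F) = of_int (int s * (- 2) + j) * (Ninv ^ s * F)"
    by (simp only: hom_def)
  have "lap (Ninv ^ Suc s * F) = Ninv * lap (Ninv ^ s * F) - Ninv * Ninv * deg (Ninv ^ s * F)"
    using lap_Ninv_mult[of "Ninv ^ s * F"] by (simp add: mult.assoc)
  also have "\<dots> = Ninv ^ Suc s * lap F - of_int (int s * (j + 1 - int s) + (int s * (- 2) + j)) * (Ninv ^ Suc (Suc s) * F)"
    unfolding Suc.IH dg by (simp add: algebra_simps)
  also have "int s * (j + 1 - int s) + (int s * (- 2) + j) = int (Suc s) * (j + 1 - int (Suc s))"
    by (simp add: algebra_simps)
  finally show ?case .
qed simp

text \<open>If \<open>F = N\<^sup>-\<^sup>k p\<close> with \<open>k > 0\<close>, then the leading term of \<open>lap (lap F)\<close> is \<open>k\<^sup>2 (k + 1)\<^sup>2 N\<^sup>-\<^sup>k\<^sup>-\<^sup>2 p\<close>.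
  So \<open>N\<close> divides \<open>p\<close> when \<open>F\<close> is biharmonic, and the denominator can be cleared step by step.\<close>

lemma biharmonic_degree_zero:
  assumes h: "hom 0 F" and L: "lap (lap F) = 0"
  shows "\<exists>c. F = cst c"
proof -
  have "polynomial p \<Longrightarrow> F = Ninv ^ k * p \<Longrightarrow> polynomial F" for k p
  proof (induction k arbitrary: p)
    case (Suc s)
    define k where "k = Suc s"
    have Fk: "F = Ninv ^ k * p" using Suc.prems by (simp add: k_def)
    have "NN ^ k * F = (Ninv ^ k * NN ^ k) * p" unfolding Fk by (simp add: mult_ac)
    then have pF: "p = NN ^ k * F" by (simp add: Ninv_power_NN)
    have hp: "hom (2 * int k) p"
      unfolding pF using hom_mult[OF hom_power[OF hom_NN, of k] h] by (simp add: mult.commute)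
    have hl: "hom (2 * int k - 2) (lap p)" by (rule hom_lap[OF hp])
    have l1: "lap F = Ninv ^ k * lap p - of_int (int k * (int k + 1)) * (Ninv ^ Suc k * p)"
      unfolding Fk lap_Ninv_power[OF hp] by (simp add: algebra_simps)
    have lc: "lap (of_int i * G) = of_int i * lap G" for i G
      using lap_simps(4)[of "of_int i" G] by simp
    have "lap (lap F) = Ninv ^ k * lap (lap p) - of_int (int k * (2 * int k - 2 + 1 - int k)) * (Ninv ^ Suc k * lap p)
       - of_int (int k * (int k + 1)) * (Ninv ^ Suc k * lap p - of_int (int (Suc k) * (2 * int k + 1 - int (Suc k))) * (Ninv ^ Suc (Suc k) * p))"
      unfolding l1 lap_simps lc lap_Ninv_power[OF hp] lap_Ninv_power[OF hl] by simp
    also have "\<dots> = Ninv ^ k * lap (lap p) - of_int (2 * int k * int k) * (Ninv ^ Suc k * lap p)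
       + of_int ((int k * (int k + 1))\<^sup>2) * (Ninv ^ Suc (Suc k) * p)"
      by (simp add: algebra_simps power2_eq_square)
    finally have z: "Ninv ^ k * lap (lap p) - of_int (2 * int k * int k) * (Ninv ^ Suc k * lap p)
       + of_int ((int k * (int k + 1))\<^sup>2) * (Ninv ^ Suc (Suc k) * p) = 0"
      using L by simp
    have c1: "NN ^ Suc (Suc k) * (Ninv ^ k * x) = NN * NN * x" for x
    proof -
      have "NN ^ Suc (Suc k) * (Ninv ^ k * x) = (Ninv ^ k * NN ^ k) * (NN * NN * x)" by (simp add: mult_ac)
      then show ?thesis by (simp add: Ninv_power_NN)
    qed
    have c2: "NN ^ Suc (Suc k) * (Ninv ^ Suc k * x) = NN * x" for x
    proof -
      have "NN ^ Suc (Suc k) * (Ninv ^ Suc k * x) = (Ninv ^ Suc k * NN ^ Suc k) * (NN * x)" by (simp add: mult_ac)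
      then show ?thesis by (simp only: Ninv_power_NN mult_1)
    qed
    have c3: "NN ^ Suc (Suc k) * (Ninv ^ Suc (Suc k) * x) = x" for x
    proof -
      have "NN ^ Suc (Suc k) * (Ninv ^ Suc (Suc k) * x) = (Ninv ^ Suc (Suc k) * NN ^ Suc (Suc k)) * x" by (simp only: mult_ac)
      then show ?thesis by (simp only: Ninv_power_NN mult_1)
    qed
    have "NN * NN * lap (lap p) - of_int (2 * int k * int k) * (NN * lap p) + of_int ((int k * (int k + 1))\<^sup>2) * p =
      NN ^ Suc (Suc k) * (Ninv ^ k * lap (lap p) - of_int (2 * int k * int k) * (Ninv ^ Suc k * lap p)
       + of_int ((int k * (int k + 1))\<^sup>2) * (Ninv ^ Suc (Suc k) * p))"
      unfolding distrib_left right_diff_distrib mult.left_commute[of "NN ^ Suc (Suc k)" "of_int i" for i] c1 c2 c3 ..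
    then have "of_int ((int k * (int k + 1))\<^sup>2) * p = - (NN * NN * lap (lap p) - of_int (2 * int k * int k) * (NN * lap p))"
      unfolding z mult_zero_right by (simp only: add_eq_0_iff)
    moreover have "- (NN * NN * x - c * (NN * y)) = NN * (c * y - NN * x)" for x y c :: laurent
      by (simp add: algebra_simps)
    ultimately have e: "of_int ((int k * (int k + 1))\<^sup>2) * p = NN * (of_int (2 * int k * int k) * lap p - NN * lap (lap p))"
      by (rule trans)
    let ?c = "of_int ((int k * (int k + 1))\<^sup>2) :: complex"
    define q where "q = cst (1 / ?c) * (of_int (2 * int k * int k) * lap p - NN * lap (lap p))"
    have "int k > 0" by (simp add: k_def)
    then have "(int k * (int k + 1))\<^sup>2 \<noteq> 0" by simp
    then have "?c \<noteq> 0" by (simp only: of_int_eq_0_iff not_False_eq_True)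
    then have "cst (1 / ?c) * cst ?c = 1" by (simp flip: cst_simps(6))
    then have c: "cst (1 / ?c) * of_int ((int k * (int k + 1))\<^sup>2) = 1" by (simp only: cst_simps(7))
    have "p = (cst (1 / ?c) * of_int ((int k * (int k + 1))\<^sup>2)) * p" by (simp only: c mult_1)
    also have "\<dots> = NN * q" unfolding mult.assoc e q_def by (simp only: mult.left_commute)
    finally have pq: "p = NN * q" .
    have "polynomial q"
      unfolding q_def using Suc.prems(1) polynomial.cst[of "of_int (2 * int k * int k)"]
      by (auto intro!: polynomial.mult polynomial.cst polynomial_diff polynomial_lap polynomial_NN simp del: of_int_mult of_int_power)
    moreover have "F = Ninv ^ s * q"
      unfolding Fk pq k_def power_Suc2 mult.assoc NN_Ninv_cancel ..
    ultimately show ?case by (rule Suc.IH)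
  qed simp
  then have "polynomial F" using laurent_denominator[of F] by blast
  then show ?thesis using h by (rule polynomial_degree_zero)
qed

lemma in_U_biharmonic:
  assumes "in_U f" shows "lap (lap (f a)) = 0"
proof -
  have r: "d 1 b (lap (f 1)) + d 2 b (lap (f 2)) = 0" for b
    using assms by (simp add: in_U_def dirac_def)
  have "lap (lap (f 1)) = d 2 2 (d 1 1 (lap (f 1)) + d 2 1 (lap (f 2))) - d 2 1 (d 1 2 (lap (f 1)) + d 2 2 (lap (f 2)))"
    "lap (lap (f 2)) = d 1 1 (d 1 2 (lap (f 1)) + d 2 2 (lap (f 2))) - d 1 2 (d 1 1 (lap (f 1)) + d 2 1 (lap (f 2)))"
    by (simp_all add: lap_def[of "lap F" for F])
  then show ?thesis using exhaust_2[of a] by (auto simp only: r d_consts diff_self)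
qed

lemma in_U'_biharmonic:
  assumes "in_U' f" shows "lap (lap (f a)) = 0"
proof -
  have r: "d b 1 (lap (f 1)) + d b 2 (lap (f 2)) = 0" for b
    using assms by (simp add: in_U'_def dirac'_def)
  have "lap (lap (f 1)) = d 2 2 (d 1 1 (lap (f 1)) + d 1 2 (lap (f 2))) - d 1 2 (d 2 1 (lap (f 1)) + d 2 2 (lap (f 2)))"
    "lap (lap (f 2)) = d 1 1 (d 2 1 (lap (f 1)) + d 2 2 (lap (f 2))) - d 2 1 (d 1 1 (lap (f 1)) + d 1 2 (lap (f 2)))"
    by (simp_all add: lap_def[of "lap F" for F])
  then show ?thesis using exhaust_2[of a] by (auto simp only: r d_consts diff_self)
qed

definition unit_vec :: "2 \<Rightarrow> 2 \<Rightarrow> laurent" where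
  "unit_vec e b = (if b = e then 1 else 0)"

lemma lap_unit_vec [simp]: "lap (unit_vec e b) = 0"
  using lap_simps(6)[of 1] by (simp add: unit_vec_def)

lemma unit_vec_in: "in_U (unit_vec e)" "in_U' (unit_vec e)" "homs 0 (unit_vec e)"
  by (auto simp: in_U_def in_U'_def dirac_def dirac'_def homs_def hom_def) (auto simp: unit_vec_def)

lemma sint_Ninv: "sint 1 (Ninv * F) = sint 1 F"
  using sint_NN[of 1 "Ninv * F"] by (simp add: NN_Ninv_cancel)

text \<open>The test elements for constants are the rows and columns of \<open>Z / N(Z)\<close>, which arise from the constant unit
  vectors by inversion.\<close>

lemma sint_Q_const_left:
  "sint 1 (Q (\<lambda>a. cst (c a)) (inv_right (unit_vec e))) = 4 * of_real pi ^ 2 * c e"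
proof -
  have "lap (inv_right (unit_vec e) b) = - (Ninv * Ninv * zz e b)" for b
    using exhaust_2[of e] by (auto simp: lap_inv_right sum_2) (auto simp: unit_vec_def cod_Ninv cod_def[of _ _ 0])
  then have "Q (\<lambda>a. cst (c a)) (inv_right (unit_vec e)) =
     2 * row_adj_col (\<lambda>b. Ninv * Ninv * zz e b) (\<lambda>a. cst (c a))"
    by (simp add: Q_def dirac_def sum_2 row_adj_col_def algebra_simps)
  also have "row_adj_col (\<lambda>b. Ninv * Ninv * zz e b) (\<lambda>a. cst (c a)) = Ninv * (Ninv * (NN * cst (c e)))"
    using exhaust_2[of e] by (auto simp: row_adj_col_def NN_def algebra_simps)
  finally have "Q (\<lambda>a. cst (c a)) (inv_right (unit_vec e)) = 2 * (Ninv * (cst (c e) * 1))"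
    by (simp add: NN_Ninv_cancel)
  then show ?thesis by (simp only: sint_numeral sint_Ninv sint_cst zero_less_one sint_one) simp
qed

lemma sint_Q_const_right:
  "sint 1 (Q (inv_left (unit_vec e)) (\<lambda>a. cst (c a))) = 4 * of_real pi ^ 2 * c e"
proof -
  have "dirac (inv_left (unit_vec e)) b = (if b = e then Ninv else 0)" for b
  proof -
    have "dirac (unit_vec e) b = 0" for b by (simp add: dirac_def unit_vec_def)
    then show ?thesis unfolding dirac_inv_left by (simp add: unit_vec_def)
  qed
  then have "Q (inv_left (unit_vec e)) (\<lambda>a. cst (c a)) = 2 * (Ninv * (cst (c e) * 1))"
    using exhaust_2[of e] by (auto simp: Q_def sum_2 row_adj_col_def)
  then show ?thesis by (simp only: sint_numeral sint_Ninv sint_cst zero_less_one sint_one) simp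
qed

lemma hom_all_d_zero:
  assumes "hom n F" "n \<noteq> 0" "\<And>a b. d a b F = 0"
  shows "F = 0"
proof -
  have "of_int n * F = 0" using assms(1,3) by (simp add: hom_def deg_def)
  then have "cst (1 / of_int n) * (cst (of_int n) * F) = 0" by simp
  then have "cst (1 / of_int n * of_int n) * F = 0" by (simp only: cst_simps(6) mult.assoc)
  then show ?thesis using assms(2) by simp
qed

text \<open>Translations lower the degree, so an element of \<open>\<U>\<^sub>m\<close>, \<open>m > 0\<close>, that pairs to zero with everything
  has derivatives with the same property; the descent ends at the constants.\<close>

lemma nondegenerate_left_nonneg:
  assumes "in_U f" "homs (int k) f"
    and "\<And>g. in_U' g \<Longrightarrow> homs (- 1 - int k) g \<Longrightarrow> sint 1 (Q f g) = 0"
  shows "f = (\<lambda>a. 0)"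
  using assms
proof (induction k arbitrary: f)
  case 0
  have "\<exists>c. f a = cst c" for a
    using 0 in_U_biharmonic[of f a] by (intro biharmonic_degree_zero) (auto simp: homs_def)
  then obtain c where "\<And>a. f a = cst (c a)" by metis
  then have c: "f = (\<lambda>a. cst (c a))" by (rule ext)
  have "4 * of_real pi ^ 2 * c e = 0" for e
    using "0.prems"(3)[of "inv_right (unit_vec e)"] sint_Q_const_left[of c e]
      in_U'_inv_right[OF unit_vec_in(2)] homs_inv(2)[OF unit_vec_in(3)] unfolding c by simp
  then show ?case by (simp add: c)
next
  case (Suc k)
  have "(\<lambda>i. d a b (f i)) = (\<lambda>i. 0)" for a b
  proof (rule Suc.IH)
    show "in_U (\<lambda>i. d a b (f i))" by (rule in_U_d) (rule Suc.prems)
    show "homs (int k) (\<lambda>i. d a b (f i))"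
      using Suc.prems(2) hom_d[of "int (Suc k)" _ a b] by (simp add: homs_def)
    fix g assume g: "in_U' g" "homs (- 1 - int k) g"
    have "sint 1 (Q f (\<lambda>i. d a b (g i))) = 0"
      by (rule Suc.prems(3)) (use g hom_d[of "- 1 - int k" _ a b] in \<open>auto simp: homs_def in_U'_d algebra_simps\<close>)
    then show "sint 1 (Q (\<lambda>i. d a b (f i)) g) = 0"
      using sint_Q_translation[OF Suc.prems(1) g(1) Suc.prems(2) g(2), of a b] by (simp add: sint_add)
  qed
  then have dz: "d a b (f i) = 0" for a b i by (rule fun_cong)
  have "f i = 0" for i
    using Suc.prems(2) unfolding homs_def by (intro hom_all_d_zero[OF _ _ dz, of "int (Suc k)"]) simp_all
  then show ?case by blast
qed

lemma nondegenerate_right_nonneg: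
  assumes "in_U' g" "homs (int k) g"
    and "\<And>f. in_U f \<Longrightarrow> homs (- 1 - int k) f \<Longrightarrow> sint 1 (Q f g) = 0"
  shows "g = (\<lambda>a. 0)"
  using assms
proof (induction k arbitrary: g)
  case 0
  have "\<exists>c. g a = cst c" for a
    using 0 in_U'_biharmonic[of g a] by (intro biharmonic_degree_zero) (auto simp: homs_def)
  then obtain c where "\<And>a. g a = cst (c a)" by metis
  then have c: "g = (\<lambda>a. cst (c a))" by (rule ext)
  have "4 * of_real pi ^ 2 * c e = 0" for e
    using "0.prems"(3)[of "inv_left (unit_vec e)"] sint_Q_const_right[of e c]
      in_U_inv_left[OF unit_vec_in(1)] homs_inv(1)[OF unit_vec_in(3)] unfolding c by simp
  then show ?case by (simp add: c)
next
  case (Suc k)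
  have "(\<lambda>i. d a b (g i)) = (\<lambda>i. 0)" for a b
  proof (rule Suc.IH)
    show "in_U' (\<lambda>i. d a b (g i))" by (rule in_U'_d) (rule Suc.prems)
    show "homs (int k) (\<lambda>i. d a b (g i))"
      using Suc.prems(2) hom_d[of "int (Suc k)" _ a b] by (simp add: homs_def)
    fix f assume f: "in_U f" "homs (- 1 - int k) f"
    have "sint 1 (Q (\<lambda>i. d a b (f i)) g) = 0"
      by (rule Suc.prems(3)) (use f hom_d[of "- 1 - int k" _ a b] in \<open>auto simp: homs_def in_U_d algebra_simps\<close>)
    then show "sint 1 (Q f (\<lambda>i. d a b (g i))) = 0"
      using sint_Q_translation[OF f(1) Suc.prems(1) f(2) Suc.prems(2), of a b] by (simp add: sint_add)
  qed
  then have dz: "d a b (g i) = 0" for a b i by (rule fun_cong)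
  have "g i = 0" for i
    using Suc.prems(2) unfolding homs_def by (intro hom_all_d_zero[OF _ _ dz, of "int (Suc k)"]) simp_all
  then show ?case by blast
qed

lemma inv_zero: "inv_left (\<lambda>a. 0) = (\<lambda>a. 0)" "inv_right (\<lambda>a. 0) = (\<lambda>a. 0)"
  by (simp_all add: inv_left_def inv_right_def fun_eq_iff)

lemma nondegenerate_left:
  assumes f: "in_U f" "homs m f"
    and z: "\<And>g. in_U' g \<Longrightarrow> homs (- 1 - m) g \<Longrightarrow> sint 1 (Q f g) = 0"
  shows "f = (\<lambda>a. 0)"
proof (cases "m \<ge> 0")
  case True
  then show ?thesis using nondegenerate_left_nonneg[of f "nat m"] f z by simp
next
  case False
  have "inv_left f = (\<lambda>a. 0)"
  proof (rule nondegenerate_left_nonneg[of _ "nat (- 1 - m)"])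
    show "in_U (inv_left f)" by (rule in_U_inv_left[OF f(1)])
    show "homs (int (nat (- 1 - m))) (inv_left f)" using homs_inv(1)[OF f(2)] False by simp
    fix g assume g: "in_U' g" "homs (- 1 - int (nat (- 1 - m))) g"
    then have gm: "homs m g" using False by simp
    have "sint 1 (Q f (inv_right g)) = 0"
      by (rule z[OF in_U'_inv_right[OF g(1)] homs_inv(2)[OF gm]])
    moreover have "sint 1 (Q (inv_left f) (inv_right (inv_right g))) = sint 1 (Q f (inv_right g))"
      by (rule sint_Q_inversion[OF f(2) homs_inv(2)[OF gm]]) simp
    moreover have "inv_right (inv_right g) = g" by (simp add: fun_eq_iff inv_right_involution)
    ultimately show "sint 1 (Q (inv_left f) g) = 0" by simp
  qed
  then have "inv_left (inv_left f) = (\<lambda>a. 0)" by (simp only: inv_zero)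
  then show ?thesis by (simp add: fun_eq_iff inv_left_involution)
qed

lemma nondegenerate_right:
  assumes g: "in_U' g" "homs m g"
    and z: "\<And>f. in_U f \<Longrightarrow> homs (- 1 - m) f \<Longrightarrow> sint 1 (Q f g) = 0"
  shows "g = (\<lambda>a. 0)"
proof (cases "m \<ge> 0")
  case True
  then show ?thesis using nondegenerate_right_nonneg[of g "nat m"] g z by simp
next
  case False
  have "inv_right g = (\<lambda>a. 0)"
  proof (rule nondegenerate_right_nonneg[of _ "nat (- 1 - m)"])
    show "in_U' (inv_right g)" by (rule in_U'_inv_right[OF g(1)])
    show "homs (int (nat (- 1 - m))) (inv_right g)" using homs_inv(2)[OF g(2)] False by simp
    fix f assume f: "in_U f" "homs (- 1 - int (nat (- 1 - m))) f"
    then have fm: "homs m f" using False by simp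
    have "sint 1 (Q (inv_left f) g) = 0"
      by (rule z[OF in_U_inv_left[OF f(1)] homs_inv(1)[OF fm]])
    moreover have "sint 1 (Q (inv_left (inv_left f)) (inv_right g)) = sint 1 (Q (inv_left f) g)"
      by (rule sint_Q_inversion[OF homs_inv(1)[OF fm] g(2)]) simp
    moreover have "inv_left (inv_left f) = f" by (simp add: fun_eq_iff inv_left_involution)
    ultimately show "sint 1 (Q f (inv_right g)) = 0" by simp
  qed
  then have "inv_right (inv_right g) = (\<lambda>a. 0)" by (simp only: inv_zero)
  then show ?thesis by (simp add: fun_eq_iff inv_right_involution)
qed


section \<open>From operators on functions to operators on Laurent polynomials\<close>

definition fn :: "(2 \<Rightarrow> laurent) \<Rightarrow> complex^2^2 \<Rightarrow> complex^2" where
  "fn F Z = (\<chi> i. ev (F i) Z)"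

lemma fn_nth [simp]: "fn F Z $ i = ev (F i) Z" by (simp add: fn_def)

lemma fn_surj:
  assumes "\<And>i. (\<lambda>Z. f Z $ i) \<in> laurent_polynomials"
  shows "\<exists>F. f = fn F"
proof (rule exI[of _ "\<lambda>i. Abs_laurent (\<lambda>Z. f Z $ i)"], rule ext)
  fix Z show "f Z = fn (\<lambda>i. Abs_laurent (\<lambda>Z. f Z $ i)) Z"
    using assms by (simp add: vec_eq_iff Abs_laurent_inverse)
qed

lemma fn_laurent: "(\<lambda>Z. fn F Z $ i) \<in> laurent_polynomials"
  using ev[of "F i"] by simp

text \<open>The operators on functions are only determined off the null cone; on the cone the value of \<open>deriv\<close> at a point of
  non-differentiability intervenes.\<close>

definition agrees :: "(complex^2^2 \<Rightarrow> complex^2) \<Rightarrow> (2 \<Rightarrow> laurent) \<Rightarrow> bool" where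
  "agrees f F \<longleftrightarrow> (\<forall>Z. qnorm Z \<noteq> 0 \<longrightarrow> f Z = fn F Z)"

lemma agrees_fn: "agrees (fn F) F" by (simp add: agrees_def)

definition dir_deriv :: "complex^2^2 \<Rightarrow> laurent \<Rightarrow> laurent" where
  "dir_deriv E F = (\<Sum>a\<in>UNIV. \<Sum>b\<in>UNIV. cst (E $ a $ b) * d a b F)"

lemma cscale_zero [simp]: "cscale 0 E = 0"
  by (simp add: cscale_def vec_eq_iff)

lemma eventually_line_off_cone:
  assumes "qnorm Z \<noteq> 0"
  shows "eventually (\<lambda>t. qnorm (Z + cscale t E) \<noteq> 0) (nhds 0)"
proof -
  have "((\<lambda>t. Z + cscale t E) \<longlongrightarrow> Z + cscale 0 E) (nhds 0)"
    by (rule tendsto_add[OF tendsto_const]) (rule bounded_linear.tendsto[OF bounded_linear_cscale filterlim_ident])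
  then have "((\<lambda>t. Z + cscale t E) \<longlongrightarrow> Z) (nhds 0)" by simp
  from eventually_compose_filterlim[OF eventually_off_cone[OF assms] this] show ?thesis .
qed

lemma deriv_line:
  assumes f: "\<And>Z. qnorm Z \<noteq> 0 \<Longrightarrow> f Z = ev F Z" and Z: "qnorm Z \<noteq> 0"
  shows "deriv (\<lambda>t. f (Z + cscale t E)) 0 = ev (dir_deriv E F) Z"
proof -
  have "((\<lambda>t. ev F (Z + cscale t E)) has_field_derivative ev (dir_deriv E F) Z) (at 0)"
    using ev_has_field_derivative[of Z "\<lambda>t. t" 0 E 1 F] Z by (simp add: dir_deriv_def)
  moreover have "eventually (\<lambda>t. f (Z + cscale t E) = ev F (Z + cscale t E)) (nhds 0)"
    using eventually_line_off_cone[OF Z, of E] by (rule eventually_mono) (rule f)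
  ultimately have "((\<lambda>t. f (Z + cscale t E)) has_field_derivative ev (dir_deriv E F) Z) (at 0)"
    by (subst DERIV_cong_ev[OF refl _ refl]) auto
  then show ?thesis by (rule DERIV_imp_deriv)
qed

lemma agrees_qpartial:
  assumes "agrees f F" shows "agrees (qpartial j f) (\<lambda>i. dir_deriv (qunit j) (F i))"
  unfolding agrees_def
proof (intro allI impI)
  fix Z :: "complex^2^2" assume Z: "qnorm Z \<noteq> 0"
  have "deriv (\<lambda>t. f (Z + cscale t (qunit j)) $ i) 0 = ev (dir_deriv (qunit j) (F i)) Z" for i
    using assms by (intro deriv_line[of "\<lambda>Z. f Z $ i", OF _ Z]) (simp add: agrees_def)
  then show "qpartial j f Z = fn (\<lambda>i. dir_deriv (qunit j) (F i)) Z"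
    by (simp add: qpartial_def vec_eq_iff)
qed

lemma qunit_entries:
  "qunit 0 $ 1 $ 1 = 1" "qunit 0 $ 1 $ 2 = 0" "qunit 0 $ 2 $ 1 = 0" "qunit 0 $ 2 $ 2 = 1"
  "qunit 1 $ 1 $ 1 = 0" "qunit 1 $ 1 $ 2 = - \<i>" "qunit 1 $ 2 $ 1 = - \<i>" "qunit 1 $ 2 $ 2 = 0"
  "qunit 2 $ 1 $ 1 = 0" "qunit 2 $ 1 $ 2 = - 1" "qunit 2 $ 2 $ 1 = 1" "qunit 2 $ 2 $ 2 = 0"
  "qunit 3 $ 1 $ 1 = - \<i>" "qunit 3 $ 1 $ 2 = 0" "qunit 3 $ 2 $ 1 = 0" "qunit 3 $ 2 $ 2 = \<i>"
  by (simp_all add: qunit_def mat_def)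

lemma agrees_qpartial_nth:
  "agrees f F \<Longrightarrow> qnorm Z \<noteq> 0 \<Longrightarrow> qpartial j f Z $ i = ev (dir_deriv (qunit j) (F i)) Z"
  using agrees_qpartial[of f F j] by (simp add: agrees_def)

lemma agrees_nabla:
  assumes "agrees f F" shows "agrees (nabla f) (\<lambda>b. 2 * dirac F b)"
  unfolding agrees_def
proof (intro allI impI)
  fix Z :: "complex^2^2" assume Z: "qnorm Z \<noteq> 0"
  show "nabla f Z = fn (\<lambda>b. 2 * dirac F b) Z"
    unfolding vec_eq_iff forall_2 using Z
    by (simp add: nabla_def matrix_vector_mult_def sum_2 qunit_entries agrees_qpartial_nth[OF assms Z]
        dir_deriv_def dirac_def algebra_simps)
qed

lemma agrees_nabla_right:
  assumes "agrees g G" shows "agrees (nabla_right g) (\<lambda>b. 2 * dirac' G b)"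
  unfolding agrees_def
proof (intro allI impI)
  fix Z :: "complex^2^2" assume Z: "qnorm Z \<noteq> 0"
  show "nabla_right g Z = fn (\<lambda>b. 2 * dirac' G b) Z"
    unfolding vec_eq_iff forall_2 using Z
    by (simp add: nabla_right_def vector_matrix_mult_def sum_2 qunit_entries agrees_qpartial_nth[OF assms Z]
        dir_deriv_def dirac'_def algebra_simps)
qed

lemma agrees_qbox:
  assumes "agrees f F" shows "agrees (qbox f) (\<lambda>b. 4 * lap (F b))"
  unfolding agrees_def
proof (intro allI impI)
  fix Z :: "complex^2^2" assume Z: "qnorm Z \<noteq> 0"
  have "qbox f Z $ i = ev (4 * lap (F i)) Z" for i
    using Z by (simp add: qbox_def sum_UNIV_4_zero agrees_qpartial_nth[OF agrees_qpartial[OF assms] Z]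
        dir_deriv_def sum_2 qunit_entries lap_def algebra_simps)
  then show "qbox f Z = fn (\<lambda>b. 4 * lap (F b)) Z"
    by (simp add: vec_eq_iff)
qed

lemma agrees_qdeg:
  assumes "agrees f F" shows "agrees (qdeg f) (\<lambda>b. deg (F b))"
  unfolding agrees_def
proof (intro allI impI)
  fix Z :: "complex^2^2" assume Z: "qnorm Z \<noteq> 0"
  have "qdeg f Z $ i = ev (deg (F i)) Z" for i
    using Z by (simp add: qdeg_def sum_UNIV_4_zero agrees_qpartial_nth[OF assms Z]
        dir_deriv_def sum_2 qunit_entries deg_def qcoord_def, simp add: field_simps)
  then show "qdeg f Z = fn (\<lambda>b. deg (F b)) Z"
    by (simp add: vec_eq_iff)
qed

lemma numeral_mult_eq_zero: "numeral k * F = (0 :: laurent) \<longleftrightarrow> F = 0"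
proof
  assume "numeral k * F = 0"
  then have "cst (1 / numeral k) * (cst (numeral k) * F) = 0" by simp
  then have "cst (1 / numeral k * numeral k) * F = 0" by (simp only: cst_simps(6) mult.assoc)
  then show "F = 0" by simp
qed simp

lemma fn_eq_zero_iff: "(\<forall>Z. qnorm Z \<noteq> 0 \<longrightarrow> fn F Z = 0) \<longleftrightarrow> (\<forall>i. F i = 0)"
proof
  assume "\<forall>Z. qnorm Z \<noteq> 0 \<longrightarrow> fn F Z = 0"
  then show "\<forall>i. F i = 0" by (metis (no_types) fn_nth laurent_eqI ev_simps(1) zero_index)
qed (simp add: vec_eq_iff)

lemma U_space_fn: "fn F \<in> U_space \<longleftrightarrow> in_U F"
proof -
  have a: "agrees (nabla (qbox (fn F))) (\<lambda>b. 2 * dirac (\<lambda>a. 4 * lap (F a)) b)"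
    by (intro agrees_nabla agrees_qbox agrees_fn)
  have "fn F \<in> U_space \<longleftrightarrow> (\<forall>Z. qnorm Z \<noteq> 0 \<longrightarrow> fn (\<lambda>b. 2 * dirac (\<lambda>a. 4 * lap (F a)) b) Z = 0)"
    using a fn_laurent[of F] by (simp add: U_space_def agrees_def)
  also have "\<dots> \<longleftrightarrow> (\<forall>b. 2 * dirac (\<lambda>a. 4 * lap (F a)) b = 0)" by (rule fn_eq_zero_iff)
  also have "\<dots> \<longleftrightarrow> in_U F"
    using dirac_simps(4)[of 4 "\<lambda>a. lap (F a)"] by (simp add: in_U_def numeral_mult_eq_zero)
  finally show ?thesis .
qed

lemma U'_space_fn: "fn F \<in> U'_space \<longleftrightarrow> in_U' F"
proof -
  have a: "agrees (nabla_right (qbox (fn F))) (\<lambda>b. 2 * dirac' (\<lambda>a. 4 * lap (F a)) b)"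
    by (intro agrees_nabla_right agrees_qbox agrees_fn)
  have "fn F \<in> U'_space \<longleftrightarrow> (\<forall>Z. qnorm Z \<noteq> 0 \<longrightarrow> fn (\<lambda>b. 2 * dirac' (\<lambda>a. 4 * lap (F a)) b) Z = 0)"
    using a fn_laurent[of F] by (simp add: U'_space_def agrees_def)
  also have "\<dots> \<longleftrightarrow> (\<forall>b. 2 * dirac' (\<lambda>a. 4 * lap (F a)) b = 0)" by (rule fn_eq_zero_iff)
  also have "\<dots> \<longleftrightarrow> in_U' F"
    using dirac'_simps(4)[of 4 "\<lambda>a. lap (F a)"] by (simp add: in_U'_def numeral_mult_eq_zero)
  finally show ?thesis .
qed

subsection \<open>Homogeneity\<close>

text \<open>Euler's theorem, in both directions.\<close>

lemma homogeneous_fn: "homogeneous n (fn F) \<longleftrightarrow> homs n F"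
proof
  assume h: "homs n F"
  show "homogeneous n (fn F)"
    unfolding homogeneous_def
  proof (intro allI impI)
    fix c :: complex and Z assume c: "c \<noteq> 0"
    show "fn F (cscale c Z) = (c powi n) *s fn F Z"
    proof (cases "qnorm Z = 0")
      case True then show ?thesis by (simp add: vec_eq_iff qnorm_cscale)
    next
      case False
      then show ?thesis using h c by (simp add: vec_eq_iff homs_def ev_cscale)
    qed
  qed
next
  assume h: "homogeneous n (fn F)"
  show "homs n F"
    unfolding homs_def hom_def
  proof (intro allI laurent_eqI)
    fix i and Z :: "complex^2^2" assume Z: "qnorm Z \<noteq> 0"
    let ?g = "\<lambda>t. ev (F i) (0 + cscale t Z)"
    have g: "?g t = t powi n * ev (F i) Z" if "t \<noteq> 0" for t
      using h that unfolding homogeneous_def by (metis add_0 fn_nth vector_smult_component)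
    have e: "0 + cscale 1 Z = Z" by (simp add: cscale_def)
    have "(?g has_field_derivative 1 * (\<Sum>a\<in>UNIV. \<Sum>b\<in>UNIV. Z $ a $ b * ev (d a b (F i)) (0 + cscale 1 Z))) (at 1)"
      by (rule ev_has_field_derivative[where g = "\<lambda>t. t"]) (use Z e in auto)
    then have 1: "(?g has_field_derivative ev (deg (F i)) Z) (at 1)"
      using Z unfolding e by (simp add: deg_def sum_2 add.assoc)
    have "((\<lambda>t. t powi n * ev (F i) Z) has_field_derivative of_int n * ev (F i) Z) (at 1)"
      by (auto intro!: derivative_eq_intros)
    moreover have "eventually (\<lambda>t. ?g t = t powi n * ev (F i) Z) (nhds 1)"
      by (rule eventually_mono[OF t1_space_nhds[OF one_neq_zero]]) (rule g)
    ultimately have "(?g has_field_derivative of_int n * ev (F i) Z) (at 1)"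
      by (subst DERIV_cong_ev[OF refl _ refl])
    with 1 have "ev (deg (F i)) Z = of_int n * ev (F i) Z" by (rule DERIV_unique)
    then show "ev (deg (F i)) Z = ev (of_int n * F i) Z" using Z by simp
  qed
qed

subsection \<open>Measurability on the null cone\<close>

text \<open>On the null cone the extension by zero need not be differentiable, and the derivative there is
  whatever value \<open>deriv\<close> has. On a line through a point of the cone the function is meromorphic, so
  it is differentiable exactly if the difference quotients converge along one sequence;
  this makes the derivative a Borel function.\<close>

lemma eventually_line_leaves_cone:
  assumes "qnorm E = 1"
  shows "eventually (\<lambda>t. qnorm (Z + cscale t E) \<noteq> 0) (at 0)"
proof -
  define p where "p = [: qnorm Z, Z $ 1 $ 1 * E $ 2 $ 2 + E $ 1 $ 1 * Z $ 2 $ 2 - Z $ 1 $ 2 * E $ 2 $ 1 - E $ 1 $ 2 * Z $ 2 $ 1, qnorm E :]"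
  have p: "poly p t = qnorm (Z + cscale t E)" for t
    by (simp add: p_def det_2 cscale_def algebra_simps)
  have "p \<noteq> 0" using assms by (simp add: p_def)
  then have "finite {t. poly p t = 0}" by (rule poly_roots_finite)
  then have "\<not> 0 islimpt {t. poly p t = 0}" by (rule islimpt_finite)
  then show ?thesis by (simp add: islimpt_iff_eventually p)
qed

lemma polynomial_line_analytic:
  assumes "polynomial F"
  shows "\<exists>h. h analytic_on {0} \<and> (\<forall>t. qnorm (Z + cscale t E) \<noteq> 0 \<longrightarrow> ev F (Z + cscale t E) = h t)"
  using assms
proof (induction rule: polynomial.induct)
  case (cst c) show ?case by (rule exI[of _ "\<lambda>_. c"]) simp
next
  case (zz a b)
  have "(\<lambda>t. Z $ a $ b + t * E $ a $ b) analytic_on {0}" by (intro analytic_intros)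
  then show ?case by (intro exI[of _ "\<lambda>t. Z $ a $ b + t * E $ a $ b"]) (simp add: cscale_def)
next
  case (add F G)
  then obtain h k where "h analytic_on {0}" "\<forall>t. qnorm (Z + cscale t E) \<noteq> 0 \<longrightarrow> ev F (Z + cscale t E) = h t"
    "k analytic_on {0}" "\<forall>t. qnorm (Z + cscale t E) \<noteq> 0 \<longrightarrow> ev G (Z + cscale t E) = k t" by blast
  then show ?case by (intro exI[of _ "\<lambda>t. h t + k t"]) (auto intro: analytic_on_add)
next
  case (mult F G)
  then obtain h k where "h analytic_on {0}" "\<forall>t. qnorm (Z + cscale t E) \<noteq> 0 \<longrightarrow> ev F (Z + cscale t E) = h t"
    "k analytic_on {0}" "\<forall>t. qnorm (Z + cscale t E) \<noteq> 0 \<longrightarrow> ev G (Z + cscale t E) = k t" by blast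
  then show ?case by (intro exI[of _ "\<lambda>t. h t * k t"]) (auto intro: analytic_on_mult)
qed

lemma line_meromorphic:
  assumes E: "qnorm E = 1"
  shows "isolated_singularity_at (\<lambda>t. ev F (Z + cscale t E)) 0" "not_essential (\<lambda>t. ev F (Z + cscale t E)) 0"
proof -
  obtain k p where p: "polynomial p" "F = Ninv ^ k * p" using laurent_denominator[of F] by blast
  obtain h where h: "h analytic_on {0}" "\<And>t. qnorm (Z + cscale t E) \<noteq> 0 \<Longrightarrow> ev p (Z + cscale t E) = h t"
    using polynomial_line_analytic[OF p(1), of Z E] by blast
  obtain n where n: "n analytic_on {0}" "\<And>t. qnorm (Z + cscale t E) \<noteq> 0 \<Longrightarrow> ev NN (Z + cscale t E) = n t"
    using polynomial_line_analytic[OF polynomial_NN, of Z E] by blast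
  let ?g = "\<lambda>t. h t / n t ^ k"
  have nk: "(\<lambda>t. n t ^ k) analytic_on {0}" using n(1) by (rule analytic_on_power)
  have "isolated_singularity_at ?g 0" "not_essential ?g 0"
    by (intro isolated_singularity_at_divide not_essential_divide isolated_singularity_at_analytic
        not_essential_analytic h(1) nk)+
  moreover have "eventually (\<lambda>t. ?g t = ev F (Z + cscale t E)) (at 0)"
    using eventually_line_leaves_cone[OF E, of Z]
    by (rule eventually_mono) (use h(2) n(2) in \<open>simp add: p(2) field_simps\<close>)
  ultimately show "isolated_singularity_at (\<lambda>t. ev F (Z + cscale t E)) 0" "not_essential (\<lambda>t. ev F (Z + cscale t E)) 0"
    by (blast intro: isolated_singularity_at_transform not_essential_transform)+
qed

lemma deriv_line_on_cone:
  fixes F :: laurent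
  assumes E: "qnorm E = 1" and Z: "qnorm Z = 0"
  defines "L \<equiv> \<lambda>n. of_nat (Suc n) * ev F (Z + cscale (1 / of_nat (Suc n)) E)"
  shows "deriv (\<lambda>t. ev F (Z + cscale t E)) 0 = (if convergent L then lim L else (SOME D. False))"
proof -
  let ?f = "\<lambda>t. ev F (Z + cscale t E)"
  have f0: "?f 0 = 0" using Z by simp
  have fl: "filterlim (\<lambda>n. 1 / of_nat (Suc n) :: complex) (at 0) sequentially"
  proof (rule filterlim_atI)
    show "(\<lambda>n. 1 / of_nat (Suc n) :: complex) \<longlonglongrightarrow> 0"
      by (rule LIMSEQ_Suc[of "\<lambda>n. 1 / of_nat n :: complex"]) (rule lim_1_over_n)
  qed (auto simp del: of_nat_Suc)
  have D: "(?f has_field_derivative D) (at 0) \<longleftrightarrow> ((\<lambda>t. ?f t / t) \<longlongrightarrow> D) (at 0)" for D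
    unfolding has_field_derivative_iff by (simp add: Z)
  have Leq: "L n = ?f (1 / of_nat (Suc n)) / (1 / of_nat (Suc n))" for n
    by (simp add: L_def mult.commute)
  have lim: "L \<longlonglongrightarrow> D" if "((\<lambda>t. ?f t / t) \<longlongrightarrow> D) (at 0)" for D
    using filterlim_compose[OF that fl] by (simp only: Leq[abs_def])
  have "isolated_singularity_at ?f 0" "not_essential ?f 0"
    by (rule line_meromorphic[OF E])+
  then have "not_essential (\<lambda>t. ?f t / t) 0"
    by (intro not_essential_divide singularity_intros)
  then consider x where "((\<lambda>t. ?f t / t) \<longlongrightarrow> x) (at 0)" | "is_pole (\<lambda>t. ?f t / t) 0"
    unfolding not_essential_def by blast
  then show ?thesis
  proof cases
    case 1
    then have "deriv ?f 0 = x" using D by (intro DERIV_imp_deriv) blast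
    moreover have "L \<longlonglongrightarrow> x" by (rule lim[OF 1])
    ultimately show ?thesis by (auto simp: convergent_def limI)
  next
    case 2
    have "filterlim L at_infinity sequentially"
      using filterlim_compose[OF 2[unfolded is_pole_def] fl] by (simp only: Leq[abs_def])
    then have "\<not> convergent L"
      using not_tendsto_and_filterlim_at_infinity[of sequentially L] by (auto simp: convergent_def)
    moreover have "\<not> (?f has_field_derivative D) (at 0)" for D
      using lim[of D] D[of D] \<open>\<not> convergent L\<close> by (auto simp: convergent_def)
    ultimately show ?thesis by (simp add: deriv_def)
  qed
qed

lemma qpartial_fn_measurable [measurable]:
  "(\<lambda>Z. qpartial j (fn F) Z $ i) \<in> borel_measurable borel"
proof -
  let ?E = "qunit j"
  have "j = 0 \<or> j = 1 \<or> j = 2 \<or> j = 3" using UNIV_4_zero by auto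
  then have E: "qnorm ?E = 1" by (auto simp: det_2 qunit_entries)
  define L where "L n Z = of_nat (Suc n) * ev (F i) (Z + cscale (1 / of_nat (Suc n)) ?E)" for n Z
  have Lm [measurable]: "L n \<in> borel_measurable borel" for n
    unfolding L_def[abs_def] by measurable
  have cm [measurable]: "Measurable.pred borel (\<lambda>Z. convergent (\<lambda>n. L n Z))"
    using sets_Collect_Cauchy[of L borel] by (simp add: pred_def Cauchy_convergent_iff Lm)
  have qm [measurable]: "Measurable.pred borel (\<lambda>Z :: complex^2^2. qnorm Z \<noteq> 0)"
    using off_cone_borel by (simp add: pred_def)
  have "(\<lambda>Z. qpartial j (fn F) Z $ i) = (\<lambda>Z. if qnorm Z \<noteq> 0 then ev (dir_deriv ?E (F i)) Z
     else if convergent (\<lambda>n. L n Z) then lim (\<lambda>n. L n Z) else (SOME D. False))"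
  proof
    fix Z
    show "qpartial j (fn F) Z $ i = (if qnorm Z \<noteq> 0 then ev (dir_deriv ?E (F i)) Z
     else if convergent (\<lambda>n. L n Z) then lim (\<lambda>n. L n Z) else (SOME D. False))"
      using agrees_qpartial_nth[OF agrees_fn, of Z j F i] deriv_line_on_cone[OF E, of Z "F i"]
      by (auto simp: qpartial_def L_def)
  qed
  also have "\<dots> \<in> borel_measurable borel" by measurable
  finally show ?thesis .
qed

subsection \<open>The pairing\<close>

lemma qcoord_measurable [measurable]: "qcoord j \<in> borel_measurable borel"
proof -
  have "j = 0 \<or> j = 1 \<or> j = 2 \<or> j = 3" using UNIV_4_zero by auto
  moreover have [measurable]: "(\<lambda>Z :: complex^2^2. Z $ a $ b) \<in> borel_measurable borel" for a b
    by (intro borel_measurable_continuous_onI continuous_intros)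
  ultimately show ?thesis by (elim disjE) (simp_all add: qcoord_def[abs_def])
qed

lemma integral_agree:
  assumes R: "R > 0" and f: "f \<in> borel_measurable borel" and e: "\<And>Z. qnorm Z \<noteq> 0 \<Longrightarrow> f Z = ev F Z"
  shows "(LINT X|S3_measure R. f X) = sint R F"
proof -
  have "(LINT X|S3_measure R. f X) = (LINT x|sphere_measure R. f (quat x))"
    by (rule integral_S3_measure[OF f])
  also have "\<dots> = (LINT x|sphere_measure R. ev F (quat x))"
  proof (rule integral_cong_AE)
    show "AE x in sphere_measure R. f (quat x) = ev F (quat x)"
      using AE_sphere_measure[OF R] by (rule eventually_mono) (use R in \<open>auto intro!: e simp: qnorm_quat\<close>)
    show "(\<lambda>x. f (quat x)) \<in> borel_measurable (sphere_measure R)" using f by measurable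
  qed measurable
  finally show ?thesis by (simp add: sint_eq)
qed

lemma integral_agree_zero:
  assumes "R > 0" and e: "\<And>Z. qnorm Z \<noteq> 0 \<Longrightarrow> f Z = ev F Z" and "\<And>Z. qnorm Z = 0 \<Longrightarrow> f Z = 0"
  shows "(LINT X|S3_measure R. f X) = sint R F"
proof -
  have "f = ev F" using assms by (intro ext) (metis ev_off_cone)
  then show ?thesis by (simp add: sint_def)
qed

lemma matrix_inv_eqI:
  fixes A B :: "complex^'n^'n"
  assumes "A ** B = mat 1" "B ** A = mat 1"
  shows "matrix_inv A = B"
proof -
  have "A ** matrix_inv A = mat 1 \<and> matrix_inv A ** A = mat 1"
    unfolding matrix_inv_def by (rule someI[of _ B]) (use assms in simp)
  then show ?thesis using assms by (metis matrix_mul_assoc matrix_mul_lid matrix_mul_rid)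
qed

lemma matrix_inv_entries:
  assumes "qnorm Z \<noteq> 0" shows "matrix_inv Z $ a $ b = ev (zi a b) Z"
proof -
  define W :: "complex^2^2" where "W = (\<chi> a b. ev (zi a b) Z)"
  have "Z ** W = mat 1" "W ** Z = mat 1"
    using assms arg_cong[OF zz_zi(1), of "\<lambda>F. ev F Z"] arg_cong[OF zz_zi(2), of "\<lambda>F. ev F Z"]
      arg_cong[OF zz_zi(3), of "\<lambda>F. ev F Z"] arg_cong[OF zz_zi(4), of "\<lambda>F. ev F Z"]
      arg_cong[OF zi_zz(1), of "\<lambda>F. ev F Z"] arg_cong[OF zi_zz(2), of "\<lambda>F. ev F Z"]
      arg_cong[OF zi_zz(3), of "\<lambda>F. ev F Z"] arg_cong[OF zi_zz(4), of "\<lambda>F. ev F Z"]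
    by (simp_all add: vec_eq_iff forall_2 matrix_matrix_mult_def sum_2 W_def mat_def)
  then have "matrix_inv Z = W" by (rule matrix_inv_eqI)
  then show ?thesis by (simp add: W_def)
qed

text \<open>In the second and third integrands a factor vanishes on the null cone; in the first one both factors are
  derivatives, and the measurability result is needed to discard the cone.\<close>

lemma QR_pairing_fn:
  assumes R: "R > 0"
  shows "QR_pairing R (fn F) (fn G) = 1 / (4 * of_real pi ^ 2) * (sint R (Q F G) / of_real R)"
proof -
  let ?A = "\<Sum>b\<in>UNIV. deg (G b) * (2 * dirac F b)" and ?B = "\<Sum>b\<in>UNIV. G b * deg (2 * dirac F b)"
  let ?C = "row_zi_col (\<lambda>a. 4 * lap (G a)) F"
  have n: "agrees (nabla (fn F)) (\<lambda>b. 2 * dirac F b)" by (rule agrees_nabla[OF agrees_fn])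
  have 1: "(LINT X|S3_measure R. row_col (qdeg (fn G) X) (nabla (fn F) X)) = sint R ?A"
  proof (rule integral_agree[OF R])
    show "(\<lambda>X. row_col (qdeg (fn G) X) (nabla (fn F) X)) \<in> borel_measurable borel"
      unfolding row_col_def sum_2 qdeg_def nabla_def matrix_vector_mult_def sum_UNIV_4_zero
      by (simp only: vec_lambda_beta vector_minus_component vector_add_component vector_smult_component) measurable
    show "row_col (qdeg (fn G) Z) (nabla (fn F) Z) = ev ?A Z" if "qnorm Z \<noteq> 0" for Z
      using n agrees_qdeg[OF agrees_fn, of G] that by (simp add: agrees_def row_col_def)
  qed
  have 2: "(LINT X|S3_measure R. row_col (fn G X) (qdeg (nabla (fn F)) X)) = sint R ?B"
  proof (rule integral_agree_zero[OF R])
    show "row_col (fn G Z) (qdeg (nabla (fn F)) Z) = ev ?B Z" if "qnorm Z \<noteq> 0" for Z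
      using agrees_qdeg[OF n] that by (simp add: agrees_def row_col_def)
  qed (simp add: row_col_def)
  have 3: "(LINT X|S3_measure R. row_col (qbox (fn G) X v* matrix_inv X) (fn F X)) = sint R ?C"
  proof (rule integral_agree_zero[OF R])
    show "row_col (qbox (fn G) Z v* matrix_inv Z) (fn F Z) = ev ?C Z" if "qnorm Z \<noteq> 0" for Z
      using agrees_qbox[OF agrees_fn, of G] that
      by (simp add: agrees_def row_col_def vector_matrix_mult_def sum_2 row_zi_col_def matrix_inv_entries algebra_simps)
  qed (simp add: row_col_def)
  have C: "of_real R * of_real R * sint R ?C = 4 * sint R (row_adj_col (\<lambda>a. lap (G a)) F)"
  proof -
    have "row_zi_col (\<lambda>a. 4 * lap (G a)) F = 4 * row_zi_col (\<lambda>a. lap (G a)) F"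
      by (simp add: row_zi_col_def sum_2 algebra_simps)
    then show ?thesis
      by (simp add: sint_numeral R row_adj_col_eq sint_NN power2_eq_square)
  qed
  have Q2: "2 * sint R (Q F G) = sint R ?A - sint R ?B - 4 * sint R (row_adj_col (\<lambda>a. lap (G a)) F)"
  proof -
    have e: "2 * Q F G = ?A - ?B - 4 * row_adj_col (\<lambda>a. lap (G a)) F"
      by (simp add: Q_def sum_2 algebra_simps)
    show ?thesis
      using arg_cong[OF e, of "sint R"] by (simp only: sint_diff[OF R] sint_numeral[OF R])
  qed
  have "QR_pairing R (fn F) (fn G) = 1 / (8 * of_real pi ^ 2) * (sint R ?A / of_real R)
    - 1 / (8 * of_real pi ^ 2) * (sint R ?B / of_real R) - of_real R / (8 * of_real pi ^ 2) * sint R ?C"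
    unfolding QR_pairing_def by (simp add: 1 2 3)
  also have "\<dots> = 1 / (8 * of_real pi ^ 2 * of_real R) * (sint R ?A - sint R ?B - of_real R * of_real R * sint R ?C)"
    using R by (simp add: field_simps)
  also have "\<dots> = 1 / (4 * of_real pi ^ 2) * (sint R (Q F G) / of_real R)"
    unfolding C Q2[symmetric] by simp
  finally show ?thesis .
qed


section \<open>The Lie algebra action as a differential operator\<close>

subsection \<open>Curves of matrices\<close>

lemma matrix_power_entry_bound:
  fixes Y :: "complex^'n^'n"
  shows "norm (((**) Y ^^ n) (mat 1) $ i $ j) \<le> (real CARD('n) * (\<Sum>i\<in>UNIV. \<Sum>j\<in>UNIV. norm (Y $ i $ j))) ^ n"
proof (induction n arbitrary: i j)
  case 0 show ?case by (simp add: mat_def)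
next
  case (Suc n)
  let ?m = "\<Sum>i\<in>UNIV. \<Sum>j\<in>UNIV. norm (Y $ i $ j)" and ?P = "((**) Y ^^ n) (mat 1)"
  let ?K = "(real CARD('n) * ?m) ^ n"
  have m: "norm (Y $ i $ k) \<le> ?m" for i k
  proof -
    have "norm (Y $ i $ k) \<le> (\<Sum>j\<in>UNIV. norm (Y $ i $ j))" by (rule member_le_sum) auto
    also have "\<dots> \<le> ?m" by (rule member_le_sum[of i UNIV "\<lambda>i. \<Sum>j\<in>UNIV. norm (Y $ i $ j)"]) (auto intro: sum_nonneg)
    finally show ?thesis .
  qed
  have m0: "0 \<le> ?m" by (intro sum_nonneg) auto
  have "norm (((**) Y ^^ Suc n) (mat 1) $ i $ j) = norm (\<Sum>k\<in>UNIV. Y $ i $ k * ?P $ k $ j)"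
    by (simp add: matrix_matrix_mult_def)
  also have "\<dots> \<le> (\<Sum>k\<in>(UNIV :: 'n set). ?m * ?K)"
    by (rule sum_norm_le) (use Suc.IH m m0 in \<open>auto simp: norm_mult intro!: mult_mono\<close>)
  also have "\<dots> = (real CARD('n) * ?m) ^ Suc n" by simp
  finally show ?case .
qed

lemma matrix_power_scaleR:
  fixes Y :: "complex^'n^'n"
  shows "((**) (t *\<^sub>R Y) ^^ n) (mat 1) = t ^ n *\<^sub>R ((**) Y ^^ n) (mat 1)"
proof (induction n)
  case (Suc n)
  have "(t *\<^sub>R Y) ** (s *\<^sub>R P) = (t * s) *\<^sub>R (Y ** P)" for s and P :: "complex^'n^'n"
    by (simp add: vec_eq_iff matrix_matrix_mult_def scaleR_sum_right mult.commute)
  then show ?case by (simp add: Suc.IH)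
qed simp

lemma norm_matrix_le_sum:
  fixes M :: "complex^'n^'m"
  shows "norm M \<le> (\<Sum>i\<in>UNIV. \<Sum>j\<in>UNIV. norm (M $ i $ j))"
proof -
  have "norm M \<le> (\<Sum>i\<in>UNIV. norm (M $ i))"
    unfolding norm_vec_def by (rule L2_set_le_sum) auto
  also have "\<dots> \<le> (\<Sum>i\<in>UNIV. \<Sum>j\<in>UNIV. norm (M $ i $ j))"
    unfolding norm_vec_def[of "M $ i" for i] by (intro sum_mono L2_set_le_sum) auto
  finally show ?thesis .
qed

lemma bounded_linear_entry: "bounded_linear (\<lambda>M :: complex^'n^'m. M $ i $ j)"
  by (rule bounded_linear_compose[OF bounded_linear_vec_nth bounded_linear_vec_nth])

text \<open>The entries of the exponential are power series in \<open>t\<close> with coefficients bounded by \<open>K\<^sup>n / n!\<close>.\<close>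

lemma matrix_exp_has_derivative:
  fixes Y :: "complex^'n^'n"
  shows "((\<lambda>t. matrix_exp (t *\<^sub>R Y) $ i $ j) has_vector_derivative Y $ i $ j) (at 0)"
    and "matrix_exp (0 *\<^sub>R Y) = mat 1"
proof -
  define P where "P n = ((**) Y ^^ n) (mat 1)" for n
  define K where "K = real CARD('n) * (\<Sum>i\<in>UNIV. \<Sum>j\<in>UNIV. norm (Y $ i $ j))"
  define c where "c i j n = P n $ i $ j / fact n" for i j n
  have cb: "norm (c i j n * x ^ n) \<le> (K * norm x) ^ n / fact n" for i j n and x :: complex
    using matrix_power_entry_bound[where Y = Y and n = n and i = i and j = j]
    by (simp add: c_def P_def K_def norm_mult norm_divide norm_power power_mult_distrib divide_right_mono mult_right_mono)
  have se: "summable (\<lambda>n. (K * x) ^ n / fact n)" for x :: real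
    using summable_exp[of "K * x"] by (simp add: divide_inverse mult.commute)
  have sc: "summable (\<lambda>n. c i j n * x ^ n)" for i j x
    by (rule summable_comparison_test'[OF se[of "norm x"]]) (rule cb)
  define T where "T t n = (1 / fact n) *\<^sub>R ((**) (t *\<^sub>R Y) ^^ n) (mat 1)" for t n
  have Te: "T t n $ i $ j = c i j n * of_real t ^ n" for t n i j
    by (simp add: T_def matrix_power_scaleR P_def c_def scaleR_conv_of_real[where 'a=complex])
  have sT: "summable (T t)" for t
  proof (rule summable_comparison_test')
    have "norm (T t n) \<le> (\<Sum>i\<in>UNIV. \<Sum>j\<in>UNIV. norm (T t n $ i $ j))" for n
      by (rule norm_matrix_le_sum)
    also have "\<dots> n \<le> (\<Sum>i\<in>(UNIV :: 'n set). \<Sum>j\<in>(UNIV :: 'n set). (K * norm (of_real t :: complex)) ^ n / fact n)" for n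
      unfolding Te by (intro sum_mono cb)
    finally show "norm (T t n) \<le> (\<Sum>i\<in>(UNIV :: 'n set). \<Sum>j\<in>(UNIV :: 'n set). (K * norm (of_real t :: complex)) ^ n / fact n)" for n .
    show "summable (\<lambda>n. \<Sum>i\<in>(UNIV :: 'n set). \<Sum>j\<in>(UNIV :: 'n set). (K * norm (of_real t :: complex)) ^ n / fact n)"
      by (intro summable_sum se)
  qed
  have e: "matrix_exp (t *\<^sub>R Y) $ i $ j = (\<Sum>n. c i j n * of_real t ^ n)" for t i j
  proof -
    have "matrix_exp (t *\<^sub>R Y) = suminf (T t)" by (simp add: matrix_exp_def T_def[abs_def])
    moreover have "suminf (T t) $ i $ j = (\<Sum>n. T t n $ i $ j)"
      by (rule bounded_linear.suminf[OF bounded_linear_entry sT])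
    ultimately show ?thesis by (simp only: Te)
  qed
  have "((\<lambda>x. \<Sum>n. c i j n * x ^ n) has_field_derivative (\<Sum>n. diffs (c i j) n * 0 ^ n)) (at (of_real 0))"
    unfolding of_real_0 by (rule termdiffs_strong_converges_everywhere) (rule sc)
  moreover have "(\<Sum>n. diffs (c i j) n * 0 ^ n) = Y $ i $ j"
    unfolding powser_zero by (simp add: diffs_def c_def P_def)
  ultimately have "((\<lambda>x. \<Sum>n. c i j n * x ^ n) has_field_derivative Y $ i $ j) (at (of_real 0))" by simp
  from has_vector_derivative_real_field[OF this]
  show "((\<lambda>t. matrix_exp (t *\<^sub>R Y) $ i $ j) has_vector_derivative Y $ i $ j) (at 0)"
    by (simp only: e)
  have "(\<Sum>n. c i j n * 0 ^ n) = mat 1 $ i $ j" for i j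
    unfolding powser_zero by (simp add: c_def P_def)
  then show "matrix_exp (0 *\<^sub>R Y) = mat 1"
    unfolding vec_eq_iff e by simp
qed

lemma prod_differentiable:
  fixes f :: "'i \<Rightarrow> real \<Rightarrow> complex"
  assumes "\<And>i. i \<in> S \<Longrightarrow> f i differentiable (at x)"
  shows "(\<lambda>t. \<Prod>i\<in>S. f i t) differentiable (at x)"
  using assms by (induction S rule: infinite_finite_induct) (auto intro: differentiable_mult)

lemma det_differentiable:
  fixes M :: "real \<Rightarrow> complex^'n^'n"
  assumes "\<And>i j. (\<lambda>t. M t $ i $ j) differentiable (at x)"
  shows "(\<lambda>t. det (M t)) differentiable (at x)"
  unfolding det_def
  by (intro differentiable_sum finite_permutations differentiable_mult differentiable_const prod_differentiable assms finite ballI)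

lemma matrix_inv_cramer:
  fixes A :: "complex^'n^'n"
  assumes "det A \<noteq> 0"
  shows "matrix_inv A $ k $ j = det (\<chi> i l. if l = k then (if i = j then 1 else 0) else A $ i $ l) / det A"
    and "A ** matrix_inv A = mat 1"
proof -
  have "invertible A" using assms invertible_det_nz by blast
  then obtain B where B: "A ** B = mat 1" "B ** A = mat 1" unfolding invertible_def by auto
  then have inv: "matrix_inv A = B" by (rule matrix_inv_eqI)
  show "A ** matrix_inv A = mat 1" by (simp add: inv B)
  define x where "x = (\<chi> k. B $ k $ j)"
  have "A *v x = (\<chi> i. if i = j then 1 else 0)"
  proof -
    have "(A *v x) $ i = (A ** B) $ i $ j" for i
      by (simp add: matrix_vector_mult_def matrix_matrix_mult_def x_def)
    then show ?thesis by (simp add: vec_eq_iff B mat_def)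
  qed
  then have "x = (\<chi> k. det (\<chi> i l. if l = k then (\<chi> i. if i = j then 1 else 0) $ i else A $ i $ l) / det A)"
    using cramer[OF assms] by blast
  then have "x $ k = det (\<chi> i l. if l = k then (if i = j then 1 else 0) else A $ i $ l) / det A"
    by (simp cong: if_cong)
  then show "matrix_inv A $ k $ j = det (\<chi> i l. if l = k then (if i = j then 1 else 0) else A $ i $ l) / det A"
    by (simp add: inv x_def)
qed

lemma has_vector_derivative_eventually:
  assumes "(f has_vector_derivative D) (at x)" "eventually (\<lambda>t. f t = g t) (nhds x)"
  shows "(g has_vector_derivative D) (at x)"
  using assms has_vector_derivative_cong_ev[where S = UNIV and f = f and g = g and x = x and f' = D]
    eventually_nhds_x_imp_x[OF assms(2)] by simp

text \<open>Cramer's rule gives differentiability, and the product rule then gives the value.\<close>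

lemma matrix_inv_has_derivative:
  fixes M :: "real \<Rightarrow> complex^'n^'n"
  assumes d: "\<And>i j. ((\<lambda>t. M t $ i $ j) has_vector_derivative Y $ i $ j) (at 0)" and M0: "M 0 = mat 1"
  shows "((\<lambda>t. matrix_inv (M t) $ k $ j) has_vector_derivative - Y $ k $ j) (at 0)"
    and "matrix_inv (M 0) = mat 1"
proof -
  have Md: "(\<lambda>t. M t $ i $ l) differentiable (at 0)" for i l
    using d[of i l] by (rule differentiableI_vector)
  have dd: "(\<lambda>t. det (M t)) differentiable (at 0)" by (rule det_differentiable[OF Md])
  have "isCont (\<lambda>t. det (M t)) 0" by (rule differentiable_imp_continuous_within[OF dd])
  then have ev: "eventually (\<lambda>t. det (M t) \<noteq> 0) (nhds 0)"
    using tendsto_imp_eventually_ne[of "\<lambda>t. det (M t)" "det (M 0)" "at 0" 0]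
    by (simp add: M0 isCont_def eventually_nhds_conv_at)
  let ?q = "\<lambda>k j t. det (\<chi> i l. if l = k then (if i = j then 1 else 0) else M t $ i $ l) / det (M t)"
  have nd: "(\<lambda>t. det (\<chi> i l. if l = k then (if i = j then 1 else 0) else M t $ i $ l)) differentiable (at 0)" for k j
  proof (rule det_differentiable)
    show "(\<lambda>t. (\<chi> i l. if l = k then (if i = j then 1 else 0) else M t $ i $ l) $ i $ l) differentiable (at 0)" for i l
      by (cases "l = k"; cases "i = j") (simp_all add: Md)
  qed
  have qd: "?q k j differentiable (at 0)" for k j
    by (rule differentiable_divide[OF nd dd]) (simp add: M0)
  define K' where "K' k j = vector_derivative (?q k j) (at 0)" for k j
  have K': "(?q k j has_vector_derivative K' k j) (at 0)" for k j
    unfolding K'_def by (rule vector_derivative_works[THEN iffD1, OF qd])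
  have inv: "((\<lambda>t. matrix_inv (M t) $ k $ j) has_vector_derivative K' k j) (at 0)" for k j
  proof (rule has_vector_derivative_eventually[OF K'])
    show "eventually (\<lambda>t. ?q k j t = matrix_inv (M t) $ k $ j) (nhds 0)"
      using ev by (rule eventually_mono) (simp add: matrix_inv_cramer)
  qed
  show one: "matrix_inv (M 0) = mat 1"
    unfolding M0 by (rule matrix_inv_eqI) simp_all
  have "((\<lambda>t. \<Sum>l\<in>UNIV. M t $ k $ l * matrix_inv (M t) $ l $ j) has_vector_derivative
      (\<Sum>l\<in>UNIV. M 0 $ k $ l * K' l j + Y $ k $ l * matrix_inv (M 0) $ l $ j)) (at 0)" for k j
    by (intro has_vector_derivative_sum has_vector_derivative_mult d inv)
  moreover have "(\<Sum>l\<in>UNIV. M 0 $ k $ l * K' l j + Y $ k $ l * matrix_inv (M 0) $ l $ j) = K' k j + Y $ k $ j" for k j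
    unfolding M0 one[unfolded M0] by (simp add: sum.distrib mat_def if_distrib[of "\<lambda>x. x * y" for y] if_distrib[of "\<lambda>x. y * x" for y] cong: if_cong)
  ultimately have "((\<lambda>t. \<Sum>l\<in>UNIV. M t $ k $ l * matrix_inv (M t) $ l $ j) has_vector_derivative K' k j + Y $ k $ j) (at 0)" for k j
    by simp
  moreover have "((\<lambda>t. \<Sum>l\<in>UNIV. M t $ k $ l * matrix_inv (M t) $ l $ j) has_vector_derivative 0) (at 0)" for k j
  proof (rule has_vector_derivative_eventually[OF has_vector_derivative_const])
    show "eventually (\<lambda>t. (mat 1 :: complex^'n^'n) $ k $ j = (\<Sum>l\<in>UNIV. M t $ k $ l * matrix_inv (M t) $ l $ j)) (nhds 0)"
    proof (rule eventually_mono[OF ev])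
      fix t assume "det (M t) \<noteq> 0"
      then have "M t ** matrix_inv (M t) = mat 1" by (rule matrix_inv_cramer)
      then have "(mat 1 :: complex^'n^'n) $ k $ j = (M t ** matrix_inv (M t)) $ k $ j" by simp
      then show "(mat 1 :: complex^'n^'n) $ k $ j = (\<Sum>l\<in>UNIV. M t $ k $ l * matrix_inv (M t) $ l $ j)"
        by (simp add: matrix_matrix_mult_def)
    qed
  qed
  ultimately have "K' k j + Y $ k $ j = 0" for k j
    by (rule vector_derivative_unique_at)
  then have "K' k j = - Y $ k $ j" for k j by (simp add: add_eq_0_iff)
  then show "((\<lambda>t. matrix_inv (M t) $ k $ j) has_vector_derivative - Y $ k $ j) (at 0)"
    using inv[of k j] by simp
qed

lemma has_vector_derivative_entries:
  fixes \<psi> :: "real \<Rightarrow> complex^2^2"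
  assumes "\<And>a b. ((\<lambda>t. \<psi> t $ a $ b) has_vector_derivative V $ a $ b) (at x)"
  shows "(\<psi> has_vector_derivative V) (at x)"
proof -
  define E where "E a b = (\<chi> i j. if i = a \<and> j = b then 1 else (0 :: complex))" for a b :: 2
  have e: "M = (\<Sum>a\<in>UNIV. \<Sum>b\<in>UNIV. cscale (M $ a $ b) (E a b))" for M :: "complex^2^2"
    by (simp add: vec_eq_iff forall_2 sum_2 cscale_def E_def)
  have "((\<lambda>t. \<Sum>a\<in>UNIV. \<Sum>b\<in>UNIV. cscale (\<psi> t $ a $ b) (E a b)) has_vector_derivative
     (\<Sum>a\<in>UNIV. \<Sum>b\<in>UNIV. cscale (V $ a $ b) (E a b))) (at x)"
    by (intro has_vector_derivative_sum bounded_linear.has_vector_derivative[OF bounded_linear_cscale] assms)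
  then show ?thesis by (simp only: e[symmetric])
qed

lemma has_vector_derivative_entries_vec:
  fixes \<psi> :: "real \<Rightarrow> complex^2"
  assumes "\<And>a. ((\<lambda>t. \<psi> t $ a) has_vector_derivative V $ a) (at x)"
  shows "(\<psi> has_vector_derivative V) (at x)"
proof -
  have e: "v = v $ 1 *s (axis 1 1 :: complex^2) + v $ 2 *s (axis 2 1 :: complex^2)" for v :: "complex^2"
    by (simp add: vec_eq_iff forall_2 axis_def)
  have bl: "bounded_linear (\<lambda>c. c *s v)" for v :: "complex^2"
    by (rule linear_conv_bounded_linear[THEN iffD1], rule linearI)
       (simp_all add: vec_eq_iff algebra_simps scaleR_conv_of_real[where 'a=complex])
  have "((\<lambda>t. \<psi> t $ 1 *s (axis 1 1 :: complex^2) + \<psi> t $ 2 *s (axis 2 1 :: complex^2)) has_vector_derivative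
     (V $ 1 *s (axis 1 1 :: complex^2) + V $ 2 *s (axis 2 1 :: complex^2))) (at x)"
    by (intro has_vector_derivative_add bounded_linear.has_vector_derivative[OF bl] assms)
  then show ?thesis by (simp only: e[symmetric])
qed

subsection \<open>Differentiation of the group action\<close>

lemma mat_1_entry: "(mat 1 :: complex^2^2) $ a $ b = (if a = b then 1 else 0)"
  by (simp add: mat_def)

lemma near_identity:
  fixes W :: "real \<Rightarrow> complex^2^2"
  assumes W: "(W has_vector_derivative V) (at 0)" and W0: "W 0 = mat 1"
  shows "eventually (\<lambda>t. qnorm (W t) \<noteq> 0) (nhds 0)"
    and "((\<lambda>t. ev Ninv (W t)) has_vector_derivative - trace V) (at 0)"
    and "((\<lambda>t. ev (zi a b) (W t)) has_vector_derivative - V $ a $ b) (at 0)"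
proof -
  have q: "qnorm (W 0) \<noteq> 0" by (simp add: W0)
  have "isCont W 0" by (rule has_vector_derivative_continuous[OF W])
  then have "(W \<longlongrightarrow> W 0) (at 0)" by (simp add: isCont_def)
  from eventually_compose_filterlim[OF eventually_off_cone[OF q] this]
  show "eventually (\<lambda>t. qnorm (W t) \<noteq> 0) (nhds 0)"
    using q by (simp add: eventually_nhds_conv_at)
  have z1: "ev (zi a b) (mat 1) = (if a = b then 1 else 0)" for a b
    using exhaust_2[of a] exhaust_2[of b] by (auto simp: zi_def mat_1_entry)
  have n1: "ev Ninv (mat 1) = 1" by simp
  show "((\<lambda>t. ev Ninv (W t)) has_vector_derivative - trace V) (at 0)"
    by (rule has_vector_derivative_eq_rhs[OF ev_has_vector_derivative[OF q W]])
       (simp add: d_Ninv_zi W0 z1 n1 sum_2 trace_2)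
  show "((\<lambda>t. ev (zi a b) (W t)) has_vector_derivative - V $ a $ b) (at 0)"
    by (rule has_vector_derivative_eq_rhs[OF ev_has_vector_derivative[OF q W]])
       (use exhaust_2[of a] exhaust_2[of b] in \<open>auto simp: d_zi W0 z1 sum_2\<close>)
qed

text \<open>Both actions differentiate along the field \<open>Z D - A Z - B + Z C Z\<close>; the multipliers contribute terms of
  order zero, which are part of the diagonal and quadratic operators.\<close>

definition lie_left :: "complex^(2 + 2)^(2 + 2) \<Rightarrow> (2 \<Rightarrow> laurent) \<Rightarrow> 2 \<Rightarrow> laurent" where
  "lie_left Y F a = diag_left (block_a Y) (block_d Y) F a + quad_left (block_c Y) F a - const_field (block_b Y) (F a)"

definition lie_right :: "complex^(2 + 2)^(2 + 2) \<Rightarrow> (2 \<Rightarrow> laurent) \<Rightarrow> 2 \<Rightarrow> laurent" where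
  "lie_right Y G b = diag_right (block_a Y) (block_d Y) G b + quad_right (block_c Y) G b - const_field (block_b Y) (G b)"

lemma pi_l_curve:
  fixes M :: "real \<Rightarrow> complex^(2 + 2)^(2 + 2)"
  assumes d: "\<And>i j. ((\<lambda>t. M t $ i $ j) has_vector_derivative Y $ i $ j) (at 0)" and M0: "M 0 = mat 1"
    and Z: "qnorm Z \<noteq> 0"
  shows "((\<lambda>t. pi_l (M t) (fn F) Z) has_vector_derivative fn (lie_left Y F) Z) (at 0)"
proof -
  define W where "W t = block_a (M t) - Z ** block_c (M t)" for t
  define V where "V = block_a Y - Z ** block_c Y"
  define X where "X t = matrix_inv (W t) ** (Z ** block_d (M t) - block_b (M t))" for t
  define X' where "X' = Z ** block_d Y - block_b Y - V ** Z"
  have W0: "W 0 = mat 1"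
    by (simp add: W_def M0 block_a_def block_c_def mat_def vec_eq_iff matrix_matrix_mult_def)
  have dW: "((\<lambda>t. W t $ a $ b) has_vector_derivative V $ a $ b) (at 0)" for a b
    unfolding W_def V_def block_a_def block_c_def matrix_matrix_mult_def
    by (simp, intro has_vector_derivative_diff has_vector_derivative_sum has_vector_derivative_mult_right d)
  have W: "(W has_vector_derivative V) (at 0)" by (rule has_vector_derivative_entries) (rule dW)
  note near = near_identity[OF W W0]
  \<comment> \<open>Near \<open>t = 0\<close> this is the argument of the transformed function; the entries of the inverse matrix are
    written as the Laurent polynomials \<open>zi\<close>, which have known derivatives.\<close>
  define X1 where "X1 t = (\<chi> a b. \<Sum>c\<in>UNIV. ev (zi a c) (W t) * (Z ** block_d (M t) - block_b (M t)) $ c $ b)" for t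
  have dz: "((\<lambda>t. (Z ** block_d (M t) - block_b (M t)) $ c $ b) has_vector_derivative (Z ** block_d Y - block_b Y) $ c $ b) (at 0)" for c b
    unfolding block_d_def block_b_def matrix_matrix_mult_def
    by (simp, intro has_vector_derivative_diff has_vector_derivative_sum has_vector_derivative_mult_right d)
  have z0: "Z ** block_d (M 0) - block_b (M 0) = Z"
    by (simp add: M0 block_b_def block_d_def mat_def vec_eq_iff matrix_matrix_mult_def if_distrib[of "\<lambda>x. y * x" for y] cong: if_cong)
  have zi1: "ev (zi a b) (W 0) = mat 1 $ a $ b" for a b
    unfolding W0 using exhaust_2[of a] exhaust_2[of b] by (auto simp: zi_def mat_1_entry)
  have X0: "X1 0 = Z" by (simp add: X1_def zi1 z0 vec_eq_iff forall_2 sum_2 mat_def)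
  have "((\<lambda>t. X1 t $ a $ b) has_vector_derivative (\<Sum>c\<in>UNIV. ev (zi a c) (W 0) * (Z ** block_d Y - block_b Y) $ c $ b
      + (- V $ a $ c) * (Z ** block_d (M 0) - block_b (M 0)) $ c $ b)) (at 0)" for a b
    unfolding X1_def by (simp only: vec_lambda_beta) (intro has_vector_derivative_sum has_vector_derivative_mult near dz)
  then have "((\<lambda>t. X1 t $ a $ b) has_vector_derivative X' $ a $ b) (at 0)" for a b
  proof (rule has_vector_derivative_eq_rhs)
    show "(\<Sum>c\<in>UNIV. ev (zi a c) (W 0) * (Z ** block_d Y - block_b Y) $ c $ b
      + (- V $ a $ c) * (Z ** block_d (M 0) - block_b (M 0)) $ c $ b) = X' $ a $ b"
      unfolding z0 zi1 X'_def using exhaust_2[of a]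
      by (auto simp: sum_2 mat_def matrix_matrix_mult_def[of V])
  qed
  then have dX: "(X1 has_vector_derivative X') (at 0)" by (rule has_vector_derivative_entries)
  have qX: "qnorm (X1 0) \<noteq> 0" by (simp add: X0 Z)
  let ?DF = "\<lambda>e. \<Sum>a\<in>UNIV. \<Sum>b\<in>UNIV. X' $ a $ b * ev (d a b (F e)) Z"
  have dF: "((\<lambda>t. ev (F e) (X1 t)) has_vector_derivative ?DF e) (at 0)" for e
    using ev_has_vector_derivative[OF qX dX, of "F e"] by (simp only: X0)
  have der: "((\<lambda>t. ev Ninv (W t) * (\<Sum>e\<in>UNIV. W t $ a $ e * ev (F e) (X1 t))) has_vector_derivative
      (ev Ninv (W 0) * (\<Sum>e\<in>UNIV. W 0 $ a $ e * ?DF e + V $ a $ e * ev (F e) (X1 0))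
       + (- trace V) * (\<Sum>e\<in>UNIV. W 0 $ a $ e * ev (F e) (X1 0)))) (at 0)" for a
    by (intro has_vector_derivative_mult has_vector_derivative_sum near dW dF)
  have val: "ev Ninv (W 0) * (\<Sum>e\<in>UNIV. W 0 $ a $ e * ?DF e + V $ a $ e * ev (F e) (X1 0))
       + (- trace V) * (\<Sum>e\<in>UNIV. W 0 $ a $ e * ev (F e) (X1 0)) = fn (lie_left Y F) Z $ a" for a
    unfolding W0 X0 using exhaust_2[of a] Z
    by (auto simp: sum_2 mat_1_entry V_def X'_def trace_2 lie_left_def diag_left_def quad_left_def lr_field_def
        quad_field_def quad_coeff_def trace_coeff_def const_field_def matrix_matrix_mult_def algebra_simps)
  have "eventually (\<lambda>t. (\<chi> a. ev Ninv (W t) * (\<Sum>e\<in>UNIV. W t $ a $ e * ev (F e) (X1 t))) = pi_l (M t) (fn F) Z) (nhds 0)"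
    using near(1)
  proof (rule eventually_mono)
    fix t assume q: "qnorm (W t) \<noteq> 0"
    then have "X1 t = matrix_inv (W t) ** (Z ** block_d (M t) - block_b (M t))"
      by (simp add: X1_def vec_eq_iff matrix_matrix_mult_def[of "matrix_inv (W t)"] matrix_inv_entries)
    then show "(\<chi> a. ev Ninv (W t) * (\<Sum>e\<in>UNIV. W t $ a $ e * ev (F e) (X1 t))) = pi_l (M t) (fn F) Z"
      by (simp add: pi_l_def Let_def flip: W_def) (simp add: vec_eq_iff matrix_vector_mult_def)
  qed
  moreover have "((\<lambda>t. \<chi> a. ev Ninv (W t) * (\<Sum>e\<in>UNIV. W t $ a $ e * ev (F e) (X1 t))) has_vector_derivative fn (lie_left Y F) Z) (at 0)"
    by (rule has_vector_derivative_entries_vec) (use der val in simp)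
  ultimately show ?thesis
    by (rule has_vector_derivative_eventually[rotated])
qed

lemma pi_r_curve:
  fixes K :: "real \<Rightarrow> complex^(2 + 2)^(2 + 2)"
  assumes d: "\<And>i j. ((\<lambda>t. K t $ i $ j) has_vector_derivative - Y $ i $ j) (at 0)" and K0: "K 0 = mat 1"
    and K: "\<And>t. matrix_inv (M t) = K t" and Z: "qnorm Z \<noteq> 0"
  shows "((\<lambda>t. pi_r (M t) (fn G) Z) has_vector_derivative fn (lie_right Y G) Z) (at 0)"
proof -
  define W where "W t = block_c (K t) ** Z + block_d (K t)" for t
  define V where "V = - (block_c Y ** Z + block_d Y)"
  define T where "T t = block_a (K t) ** Z + block_b (K t)" for t
  define T' where "T' = - (block_a Y ** Z + block_b Y)"
  define X' where "X' = T' - Z ** V"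
  have W0: "W 0 = mat 1"
    by (simp add: W_def K0 block_c_def block_d_def mat_def vec_eq_iff matrix_matrix_mult_def)
  have T0: "T 0 = Z"
    by (simp add: T_def K0 block_b_def block_a_def mat_def vec_eq_iff matrix_matrix_mult_def if_distrib[of "\<lambda>x. x * y" for y] cong: if_cong)
  have dW: "((\<lambda>t. W t $ a $ b) has_vector_derivative V $ a $ b) (at 0)" for a b
  proof -
    have "((\<lambda>t. W t $ a $ b) has_vector_derivative (\<Sum>c\<in>UNIV. (- Y $ Inr a $ Inl c) * Z $ c $ b) + - Y $ Inr a $ Inr b) (at 0)"
      unfolding W_def block_c_def block_d_def matrix_matrix_mult_def
      by (simp only: vec_lambda_beta vector_add_component) (intro has_vector_derivative_add has_vector_derivative_sum has_vector_derivative_mult_left d)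
    then show ?thesis by (simp add: V_def block_c_def block_d_def matrix_matrix_mult_def sum_negf)
  qed
  have dT: "((\<lambda>t. T t $ a $ b) has_vector_derivative T' $ a $ b) (at 0)" for a b
  proof -
    have "((\<lambda>t. T t $ a $ b) has_vector_derivative (\<Sum>c\<in>UNIV. (- Y $ Inl a $ Inl c) * Z $ c $ b) + - Y $ Inl a $ Inr b) (at 0)"
      unfolding T_def block_a_def block_b_def matrix_matrix_mult_def
      by (simp only: vec_lambda_beta vector_add_component) (intro has_vector_derivative_add has_vector_derivative_sum has_vector_derivative_mult_left d)
    then show ?thesis by (simp add: T'_def block_a_def block_b_def matrix_matrix_mult_def sum_negf)
  qed
  have W: "(W has_vector_derivative V) (at 0)" by (rule has_vector_derivative_entries) (rule dW)
  note near = near_identity[OF W W0]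
  \<comment> \<open>As before, the argument of the transformed function near \<open>t = 0\<close>.\<close>
  define X1 where "X1 t = (\<chi> a b. \<Sum>c\<in>UNIV. T t $ a $ c * ev (zi c b) (W t))" for t
  have zi1: "ev (zi a b) (W 0) = mat 1 $ a $ b" for a b
    unfolding W0 using exhaust_2[of a] exhaust_2[of b] by (auto simp: zi_def mat_1_entry)
  have X0: "X1 0 = Z" by (simp add: X1_def zi1 T0 vec_eq_iff forall_2 sum_2 mat_def)
  have "((\<lambda>t. X1 t $ a $ b) has_vector_derivative (\<Sum>c\<in>UNIV. T 0 $ a $ c * (- V $ c $ b) + T' $ a $ c * ev (zi c b) (W 0))) (at 0)" for a b
    unfolding X1_def by (simp only: vec_lambda_beta) (intro has_vector_derivative_sum has_vector_derivative_mult near dT)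
  then have "((\<lambda>t. X1 t $ a $ b) has_vector_derivative X' $ a $ b) (at 0)" for a b
  proof (rule has_vector_derivative_eq_rhs)
    show "(\<Sum>c\<in>UNIV. T 0 $ a $ c * (- V $ c $ b) + T' $ a $ c * ev (zi c b) (W 0)) = X' $ a $ b"
      unfolding T0 zi1 X'_def using exhaust_2[of b]
      by (auto simp: sum_2 mat_def matrix_matrix_mult_def[of Z])
  qed
  then have dX: "(X1 has_vector_derivative X') (at 0)" by (rule has_vector_derivative_entries)
  have qX: "qnorm (X1 0) \<noteq> 0" by (simp add: X0 Z)
  let ?DG = "\<lambda>e. \<Sum>a\<in>UNIV. \<Sum>b\<in>UNIV. X' $ a $ b * ev (d a b (G e)) Z"
  have dG: "((\<lambda>t. ev (G e) (X1 t)) has_vector_derivative ?DG e) (at 0)" for e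
    using ev_has_vector_derivative[OF qX dX, of "G e"] by (simp only: X0)
  have der: "((\<lambda>t. ev Ninv (W t) * (\<Sum>e\<in>UNIV. W t $ e $ b * ev (G e) (X1 t))) has_vector_derivative
      (ev Ninv (W 0) * (\<Sum>e\<in>UNIV. W 0 $ e $ b * ?DG e + V $ e $ b * ev (G e) (X1 0))
       + (- trace V) * (\<Sum>e\<in>UNIV. W 0 $ e $ b * ev (G e) (X1 0)))) (at 0)" for b
    by (intro has_vector_derivative_mult has_vector_derivative_sum near dW dG)
  have val: "ev Ninv (W 0) * (\<Sum>e\<in>UNIV. W 0 $ e $ b * ?DG e + V $ e $ b * ev (G e) (X1 0))
       + (- trace V) * (\<Sum>e\<in>UNIV. W 0 $ e $ b * ev (G e) (X1 0)) = fn (lie_right Y G) Z $ b" for b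
    unfolding W0 X0 using exhaust_2[of b] Z
    by (auto simp: sum_2 mat_1_entry V_def X'_def T'_def trace_2 lie_right_def diag_right_def quad_right_def lr_field_def
        quad_field_def quad_coeff_def trace_coeff_def const_field_def matrix_matrix_mult_def algebra_simps)
  have "eventually (\<lambda>t. (\<chi> b. ev Ninv (W t) * (\<Sum>e\<in>UNIV. W t $ e $ b * ev (G e) (X1 t))) = pi_r (M t) (fn G) Z) (nhds 0)"
    using near(1)
  proof (rule eventually_mono)
    fix t assume q: "qnorm (W t) \<noteq> 0"
    then have "X1 t = T t ** matrix_inv (W t)"
      by (simp add: X1_def vec_eq_iff matrix_matrix_mult_def[of "T t"] matrix_inv_entries)
    then show "(\<chi> b. ev Ninv (W t) * (\<Sum>e\<in>UNIV. W t $ e $ b * ev (G e) (X1 t))) = pi_r (M t) (fn G) Z"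
      by (simp add: pi_r_def Let_def K flip: W_def T_def) (simp add: vec_eq_iff vector_matrix_mult_def mult.commute)
  qed
  moreover have "((\<lambda>t. \<chi> b. ev Ninv (W t) * (\<Sum>e\<in>UNIV. W t $ e $ b * ev (G e) (X1 t))) has_vector_derivative fn (lie_right Y G) Z) (at 0)"
    by (rule has_vector_derivative_entries_vec) (use der val in simp)
  ultimately show ?thesis
    by (rule has_vector_derivative_eventually[rotated])
qed

lemma pi_l_Lie_fn: "pi_l_Lie Y (fn F) = fn (lie_left Y F)"
proof
  fix Z
  show "pi_l_Lie Y (fn F) Z = fn (lie_left Y F) Z"
  proof (cases "qnorm Z = 0")
    case False
    have "((\<lambda>t. pi_l (matrix_exp (t *\<^sub>R Y)) (fn F) Z) has_vector_derivative fn (lie_left Y F) Z) (at 0)"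
      by (rule pi_l_curve[OF matrix_exp_has_derivative False])
    then show ?thesis using False by (simp add: pi_l_Lie_def vector_derivative_at)
  qed (simp add: pi_l_Lie_def vec_eq_iff)
qed

lemma pi_r_Lie_fn: "pi_r_Lie Y (fn G) = fn (lie_right Y G)"
proof
  fix Z
  show "pi_r_Lie Y (fn G) Z = fn (lie_right Y G) Z"
  proof (cases "qnorm Z = 0")
    case False
    have "((\<lambda>t. pi_r (matrix_exp (t *\<^sub>R Y)) (fn G) Z) has_vector_derivative fn (lie_right Y G) Z) (at 0)"
      by (rule pi_r_curve[OF matrix_inv_has_derivative[OF matrix_exp_has_derivative] refl False])
    then show ?thesis using False by (simp add: pi_r_Lie_def vector_derivative_at)
  qed (simp add: pi_r_Lie_def vec_eq_iff)
qed


section \<open>Invariance under the compact group\<close>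

definition adjm :: "complex^2^2 \<Rightarrow> complex^2^2" where
  "adjm A = (\<chi> i j. if i = 1 then if j = 1 then A $ 2 $ 2 else - A $ 1 $ 2 else if j = 1 then - A $ 2 $ 1 else A $ 1 $ 1)"

lemma adjm_entries [simp]: "adjm A $ 1 $ 1 = A $ 2 $ 2" "adjm A $ 1 $ 2 = - A $ 1 $ 2"
  "adjm A $ 2 $ 1 = - A $ 2 $ 1" "adjm A $ 2 $ 2 = A $ 1 $ 1"
  by (simp_all add: adjm_def)

lemma adjm_inverse:
  assumes "qnorm A = 1"
  shows "A ** adjm A = mat 1" "adjm A ** A = mat 1" "qnorm (adjm A) = 1" "matrix_inv A = adjm A"
proof -
  show 1: "A ** adjm A = mat 1" "adjm A ** A = mat 1" and "qnorm (adjm A) = 1"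
    using assms by (simp_all add: vec_eq_iff forall_2 matrix_matrix_mult_def sum_2 mat_1_entry det_2 algebra_simps)
  from 1 show "matrix_inv A = adjm A" by (rule matrix_inv_eqI)
qed

lemma adjm_adjm: "adjm (adjm A) = A"
  by (simp add: vec_eq_iff forall_2)

lemma adjm_real: "A \<in> real_quaternions \<Longrightarrow> adjm A \<in> real_quaternions"
  by (simp add: real_quaternions_iff)

text \<open>When \<open>det A = 1\<close>, this is the matrix \<open>A\<^sup>-\<^sup>1 Z D\<close>.\<close>

definition rot_entry :: "complex^2^2 \<Rightarrow> complex^2^2 \<Rightarrow> 2 \<Rightarrow> 2 \<Rightarrow> laurent" where
  "rot_entry A D c e = (\<Sum>i\<in>UNIV. \<Sum>j\<in>UNIV. cst (adjm A $ c $ i) * zz i j * cst (D $ j $ e))"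

definition rot_left :: "complex^2^2 \<Rightarrow> complex^2^2 \<Rightarrow> (2 \<Rightarrow> laurent) \<Rightarrow> 2 \<Rightarrow> laurent" where
  "rot_left A D F i = (\<Sum>e\<in>UNIV. cst (A $ i $ e) * subst (rot_entry A D) (F e))"

definition rot_right :: "complex^2^2 \<Rightarrow> complex^2^2 \<Rightarrow> (2 \<Rightarrow> laurent) \<Rightarrow> 2 \<Rightarrow> laurent" where
  "rot_right A D G b = (\<Sum>e\<in>UNIV. subst (rot_entry A D) (G e) * cst (adjm D $ e $ b))"

context
  fixes A D :: "complex^2^2"
  assumes A: "qnorm A = 1" and D: "qnorm D = 1"
begin

lemma cst_det:
  "cst (A $ 1 $ 1) * cst (A $ 2 $ 2) - cst (A $ 1 $ 2) * cst (A $ 2 $ 1) = 1"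
  "cst (D $ 1 $ 1) * cst (D $ 2 $ 2) - cst (D $ 1 $ 2) * cst (D $ 2 $ 1) = 1"
proof -
  have "cst (A $ 1 $ 1 * A $ 2 $ 2 - A $ 1 $ 2 * A $ 2 $ 1) = 1" using A by (simp only: det_2 cst_simps(2))
  then show "cst (A $ 1 $ 1) * cst (A $ 2 $ 2) - cst (A $ 1 $ 2) * cst (A $ 2 $ 1) = 1" by simp
  have "cst (D $ 1 $ 1 * D $ 2 $ 2 - D $ 1 $ 2 * D $ 2 $ 1) = 1" using D by (simp only: det_2 cst_simps(2))
  then show "cst (D $ 1 $ 1) * cst (D $ 2 $ 2) - cst (D $ 1 $ 2) * cst (D $ 2 $ 1) = 1" by simp
qed

lemma ldet_rot: "ldet (rot_entry A D) = NN"
proof -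
  have "ldet (rot_entry A D) = (cst (A $ 1 $ 1) * cst (A $ 2 $ 2) - cst (A $ 1 $ 2) * cst (A $ 2 $ 1))
     * (cst (D $ 1 $ 1) * cst (D $ 2 $ 2) - cst (D $ 1 $ 2) * cst (D $ 2 $ 1)) * NN"
    by (simp add: ldet_def rot_entry_def sum_2 NN_def algebra_simps)
  then show ?thesis by (simp only: cst_det mult_1)
qed

lemma ldet_rot_Ninv: "ldet (rot_entry A D) * Ninv = 1"
  by (simp add: ldet_rot)

abbreviation "\<rho> \<equiv> subst (rot_entry A D)"

lemmas \<rho>_simps = subst_add[OF ldet_rot_Ninv] subst_diff[OF ldet_rot_Ninv] subst_mult[OF ldet_rot_Ninv]
  subst_uminus[OF ldet_rot_Ninv] subst_cst[OF ldet_rot_Ninv] subst_numeral[OF ldet_rot_Ninv]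
  subst_zz[OF ldet_rot_Ninv]

lemma d_\<rho>: "d i j (\<rho> F) = (\<Sum>c\<in>UNIV. \<Sum>e\<in>UNIV. cst (adjm A $ c $ i) * cst (D $ j $ e) * \<rho> (d c e F))"
proof -
  have "d i j (rot_entry A D c e) = cst (adjm A $ c $ i) * cst (D $ j $ e)" for c e
    using exhaust_2[of i] exhaust_2[of j] by (auto simp: rot_entry_def sum_2)
  then show ?thesis by (simp only: d_subst[OF ldet_rot_Ninv])
qed

lemma lap_\<rho>: "lap (\<rho> F) = \<rho> (lap F)"
proof -
  have "lap (\<rho> F) = (cst (A $ 1 $ 1) * cst (A $ 2 $ 2) - cst (A $ 1 $ 2) * cst (A $ 2 $ 1))
     * (cst (D $ 1 $ 1) * cst (D $ 2 $ 2) - cst (D $ 1 $ 2) * cst (D $ 2 $ 1)) * \<rho> (lap F)"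
    by (simp add: lap_def d_\<rho> sum_2 \<rho>_simps algebra_simps)
  then show ?thesis by (simp only: cst_det mult_1)
qed

lemma deg_\<rho>: "deg (\<rho> F) = \<rho> (deg F)"
  by (simp add: deg_def d_\<rho> sum_2 \<rho>_simps rot_entry_def algebra_simps)

lemma dirac_rot_left: "dirac (rot_left A D F) b = (\<Sum>q\<in>UNIV. cst (D $ b $ q) * \<rho> (dirac F q))"
proof -
  have "dirac (rot_left A D F) b =
     (cst (A $ 1 $ 1) * cst (A $ 2 $ 2) - cst (A $ 1 $ 2) * cst (A $ 2 $ 1)) * (\<Sum>q\<in>UNIV. cst (D $ b $ q) * \<rho> (dirac F q))"
    by (simp add: dirac_def rot_left_def d_\<rho> sum_2 \<rho>_simps algebra_simps)
  then show ?thesis by (simp only: cst_det mult_1)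
qed

text \<open>The integrand is equivariant because \<open>dirac\<close> picks up \<open>D\<close> where \<open>g\<close> picks up \<open>D\<^sup>-\<^sup>1\<close>, and \<open>Z\<^sup>-\<^sup>1\<close> becomes
  \<open>D\<^sup>-\<^sup>1 Z\<^sup>-\<^sup>1 A\<close>.\<close>

lemma Q_rot: "Q (rot_left A D F) (rot_right A D G) = \<rho> (Q F G)"
proof -
  let ?detD = "cst (D $ 1 $ 1) * cst (D $ 2 $ 2) - cst (D $ 1 $ 2) * cst (D $ 2 $ 1)"
  have 1: "(\<Sum>b\<in>UNIV. deg (rot_right A D G b) * dirac (rot_left A D F) b - rot_right A D G b * deg (dirac (rot_left A D F) b))
    = \<rho> (\<Sum>b\<in>UNIV. deg (G b) * dirac F b - G b * deg (dirac F b))"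
  proof -
    have "(\<Sum>b\<in>UNIV. deg (rot_right A D G b) * dirac (rot_left A D F) b - rot_right A D G b * deg (dirac (rot_left A D F) b))
      = ?detD * \<rho> (\<Sum>b\<in>UNIV. deg (G b) * dirac F b - G b * deg (dirac F b))"
      unfolding dirac_rot_left by (simp add: rot_right_def deg_\<rho> sum_2 \<rho>_simps algebra_simps)
    then show ?thesis by (simp only: cst_det mult_1)
  qed
  have lr: "lap (rot_right A D G b) = (\<Sum>e\<in>UNIV. \<rho> (lap (G e)) * cst (adjm D $ e $ b))" for b
    by (simp add: rot_right_def sum_2 lap_mult mixed_def lap_\<rho>)
  have 2: "row_adj_col (\<lambda>a. lap (rot_right A D G a)) (rot_left A D F) = \<rho> (row_adj_col (\<lambda>a. lap (G a)) F)"
    unfolding lr by (simp add: row_adj_col_def rot_left_def sum_2 \<rho>_simps rot_entry_def algebra_simps)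
  show ?thesis unfolding Q_def 1 2 \<rho>_simps ..
qed

lemma lmat_rot: "qnorm Z \<noteq> 0 \<Longrightarrow> lmat (rot_entry A D) Z = adjm A ** Z ** D"
  by (simp add: lmat_def rot_entry_def vec_eq_iff forall_2 matrix_matrix_mult_def sum_2 algebra_simps)

lemma ev_\<rho>: "ev (\<rho> F) Z = ev F (adjm A ** Z ** D)"
proof (cases "qnorm Z = 0")
  case True
  then show ?thesis by (simp add: det_mul)
next
  case False
  then show ?thesis by (simp only: ev_subst[OF ldet_rot_Ninv False] lmat_rot[OF False])
qed

lemma sint_\<rho>:
  assumes "A \<in> real_quaternions" "D \<in> real_quaternions"
  shows "sint R (\<rho> F) = sint R F"
  unfolding sint_eq ev_\<rho>
  by (rule integral_left_right) (use assms A D in \<open>simp_all add: adjm_real adjm_inverse\<close>)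

end

lemma sum_UNIV_plus: "sum f (UNIV :: ('a::finite + 'b::finite) set) = (\<Sum>i\<in>UNIV. f (Inl i)) + (\<Sum>i\<in>UNIV. f (Inr i))"
  by (subst UNIV_Plus_UNIV[symmetric], subst sum.Plus) simp_all

lemma block_diagonal_inverse:
  fixes h :: "complex^(2 + 2)^(2 + 2)"
  assumes b: "block_b h = 0" "block_c h = 0" and q: "qnorm (block_a h) = 1" "qnorm (block_d h) = 1"
  shows "block_a (matrix_inv h) = adjm (block_a h)" "block_d (matrix_inv h) = adjm (block_d h)"
    "block_b (matrix_inv h) = 0" "block_c (matrix_inv h) = 0"
proof -
  define k :: "complex^(2 + 2)^(2 + 2)" where
    "k = (\<chi> i j. case i of Inl a \<Rightarrow> (case j of Inl b \<Rightarrow> adjm (block_a h) $ a $ b | Inr b \<Rightarrow> 0)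
       | Inr a \<Rightarrow> (case j of Inl b \<Rightarrow> 0 | Inr b \<Rightarrow> adjm (block_d h) $ a $ b))"
  have hb: "h $ Inl i $ Inr j = 0" "h $ Inr i $ Inl j = 0" for i j
    using b by (simp_all add: block_b_def block_c_def vec_eq_iff)
  have ha: "h $ Inl i $ Inl j = block_a h $ i $ j" "h $ Inr i $ Inr j = block_d h $ i $ j" for i j
    by (simp_all add: block_a_def block_d_def)
  note e = adjm_inverse(1,2)[OF q(1)] adjm_inverse(1,2)[OF q(2)]
  have e': "(\<Sum>l\<in>UNIV. X $ i $ l * Y $ l $ j) = (mat 1 :: complex^2^2) $ i $ j" if "X ** Y = mat 1" for X Y :: "complex^2^2" and i j
    using that by (simp add: vec_eq_iff matrix_matrix_mult_def)
  have m: "(mat 1 :: complex^(2 + 2)^(2 + 2)) $ Inl i $ Inl j = mat 1 $ i $ j" "(mat 1 :: complex^(2 + 2)^(2 + 2)) $ Inr i $ Inr j = mat 1 $ i $ j"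
    "(mat 1 :: complex^(2 + 2)^(2 + 2)) $ Inl i $ Inr j = 0" "(mat 1 :: complex^(2 + 2)^(2 + 2)) $ Inr i $ Inl j = 0" for i j :: 2
    by (simp_all add: mat_def)
  have "h ** k = mat 1" "k ** h = mat 1"
    unfolding vec_eq_iff split_sum_all m
    by (simp_all add: matrix_matrix_mult_def sum_UNIV_plus hb ha k_def e'[OF e(1)] e'[OF e(2)] e'[OF e(3)] e'[OF e(4)])
  then have mk: "matrix_inv h = k" by (rule matrix_inv_eqI)
  have kk: "k $ Inl i $ Inl j = adjm (block_a h) $ i $ j" "k $ Inr i $ Inr j = adjm (block_d h) $ i $ j"
    "k $ Inl i $ Inr j = 0" "k $ Inr i $ Inl j = 0" for i j
    by (simp_all add: k_def)
  show "block_a (matrix_inv h) = adjm (block_a h)" "block_d (matrix_inv h) = adjm (block_d h)"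
    "block_b (matrix_inv h) = 0" "block_c (matrix_inv h) = 0"
    unfolding mk vec_eq_iff
    by (simp_all add: block_a_def[of k] block_b_def[of k] block_c_def[of k] block_d_def[of k] kk)
qed

lemma pi_l_fn:
  assumes "h \<in> SU2_SU2"
  shows "pi_l h (fn F) = fn (rot_left (block_a h) (block_d h) F)"
proof
  fix Z
  have q: "qnorm (block_a h) = 1" "qnorm (block_d h) = 1" "block_b h = 0" "block_c h = 0"
    using assms by (simp_all add: SU2_SU2_def)
  have "block_a h - Z ** block_c h = block_a h" by (simp add: q matrix_matrix_mult_def vec_eq_iff)
  then show "pi_l h (fn F) Z = fn (rot_left (block_a h) (block_d h) F) Z"
  proof (cases "qnorm Z = 0")
    case True
    then show ?thesis
      unfolding pi_l_def Let_def \<open>block_a h - Z ** block_c h = block_a h\<close>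
      by (simp add: q adjm_inverse vec_eq_iff matrix_vector_mult_def det_mul)
  next
    case False
    then show ?thesis
      unfolding pi_l_def Let_def \<open>block_a h - Z ** block_c h = block_a h\<close>
      by (simp add: q adjm_inverse vec_eq_iff matrix_vector_mult_def rot_left_def ev_\<rho> matrix_mul_assoc)
  qed
qed

lemma pi_r_fn:
  assumes "h \<in> SU2_SU2"
  shows "pi_r h (fn G) = fn (rot_right (block_a h) (block_d h) G)"
proof
  fix Z
  have q: "qnorm (block_a h) = 1" "qnorm (block_d h) = 1" "block_b h = 0" "block_c h = 0"
    using assms by (simp_all add: SU2_SU2_def)
  note k = block_diagonal_inverse[OF q(3,4,1,2)]
  have W: "block_c (matrix_inv h) ** Z + block_d (matrix_inv h) = adjm (block_d h)"
    "block_a (matrix_inv h) ** Z + block_b (matrix_inv h) = adjm (block_a h) ** Z"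
    unfolding k by (simp_all add: matrix_matrix_mult_def vec_eq_iff)
  have i: "matrix_inv (adjm (block_d h)) = block_d h"
    using adjm_inverse(4)[OF adjm_inverse(3)[OF q(2)]] by (simp add: adjm_adjm)
  show "pi_r h (fn G) Z = fn (rot_right (block_a h) (block_d h) G) Z"
  proof (cases "qnorm Z = 0")
    case True
    then show ?thesis
      unfolding pi_r_def Let_def W i
      by (simp add: q adjm_inverse vec_eq_iff vector_matrix_mult_def det_mul)
  next
    case False
    then show ?thesis
      unfolding pi_r_def Let_def W i
      by (simp add: q adjm_inverse vec_eq_iff vector_matrix_mult_def rot_right_def ev_\<rho> mult.commute)
  qed
qed

lemma QR_pairing_group_invariant:
  assumes h: "h \<in> SU2_SU2" and R: "R > 0"
  shows "QR_pairing R (pi_l h (fn F)) (pi_r h (fn G)) = QR_pairing R (fn F) (fn G)"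
  unfolding pi_l_fn[OF h] pi_r_fn[OF h] QR_pairing_fn[OF R]
  using h by (simp add: SU2_SU2_def Q_rot sint_\<rho>)

section \<open>Linearity and decomposition into degrees\<close>

lemma Q_zero: "Q (\<lambda>a. 0) g = 0" "Q f (\<lambda>a. 0) = 0"
  using Q_cst_left[of 0 f g] Q_cst_right[of f 0 g] by simp_all

lemma Q_sum_left: "Q (\<lambda>a. \<Sum>m\<in>M. f m a) g = (\<Sum>m\<in>M. Q (f m) g)"
  by (induction M rule: infinite_finite_induct) (simp_all add: Q_zero Q_add_left)

lemma Q_sum_right: "Q f (\<lambda>a. \<Sum>m\<in>M. g m a) = (\<Sum>m\<in>M. Q f (g m))"
  by (induction M rule: infinite_finite_induct) (simp_all add: Q_zero Q_add_right)

lemma sint_sum: "R > 0 \<Longrightarrow> sint R (\<Sum>m\<in>M. F m) = (\<Sum>m\<in>M. sint R (F m))"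
  by (induction M rule: infinite_finite_induct) (simp_all add: sint_add)

lemma QR_pairing_bilinear:
  assumes R: "R > 0"
  shows "QR_pairing R (\<lambda>Z. c1 *s fn F1 Z + c2 *s fn F2 Z) (fn G) = c1 * QR_pairing R (fn F1) (fn G) + c2 * QR_pairing R (fn F2) (fn G)"
    and "QR_pairing R (fn F) (\<lambda>Z. c1 *s fn G1 Z + c2 *s fn G2 Z) = c1 * QR_pairing R (fn F) (fn G1) + c2 * QR_pairing R (fn F) (fn G2)"
proof -
  have e: "(\<lambda>Z. c1 *s fn F1 Z + c2 *s fn F2 Z) = fn (\<lambda>a. cst c1 * F1 a + cst c2 * F2 a)" for F1 F2
  proof
    fix Z show "c1 *s fn F1 Z + c2 *s fn F2 Z = fn (\<lambda>a. cst c1 * F1 a + cst c2 * F2 a) Z"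
      by (cases "qnorm Z = 0") (simp_all add: vec_eq_iff)
  qed
  show "QR_pairing R (\<lambda>Z. c1 *s fn F1 Z + c2 *s fn F2 Z) (fn G) = c1 * QR_pairing R (fn F1) (fn G) + c2 * QR_pairing R (fn F2) (fn G)"
    and "QR_pairing R (fn F) (\<lambda>Z. c1 *s fn G1 Z + c2 *s fn G2 Z) = c1 * QR_pairing R (fn F) (fn G1) + c2 * QR_pairing R (fn F) (fn G2)"
    unfolding e QR_pairing_fn[OF R] Q_add_left Q_add_right Q_cst_left Q_cst_right
    using R by (simp_all add: sint_add sint_cst add_divide_distrib distrib_left)
qed

lemma in_U_sum: "(\<And>m. m \<in> M \<Longrightarrow> in_U (f m)) \<Longrightarrow> in_U (\<lambda>a. \<Sum>m\<in>M. cst (c m) * f m a)"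
  by (induction M rule: infinite_finite_induct) (simp_all add: in_U_def)

lemma in_U'_sum: "(\<And>m. m \<in> M \<Longrightarrow> in_U' (f m)) \<Longrightarrow> in_U' (\<lambda>a. \<Sum>m\<in>M. cst (c m) * f m a)"
  by (induction M rule: infinite_finite_induct) (simp_all add: in_U'_def)

lemma hom_zero: "hom n 0" by (simp add: hom_def)

lemma homs_sum: "(\<And>m. m \<in> M \<Longrightarrow> homs n (f m)) \<Longrightarrow> homs n (\<lambda>a. \<Sum>m\<in>M. cst (c m) * f m a)"
  unfolding homs_def
  by (induction M rule: infinite_finite_induct) (simp_all add: hom_zero hom_add hom_cst_mult)

definition graded :: "((2 \<Rightarrow> laurent) \<Rightarrow> bool) \<Rightarrow> int set \<Rightarrow> (int \<Rightarrow> 2 \<Rightarrow> laurent) \<Rightarrow> bool" where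
  "graded P M F \<longleftrightarrow> finite M \<and> (\<forall>m\<in>M. P (F m) \<and> homs m (F m))"

lemma span_homogeneous_graded:
  assumes P: "\<And>(M :: (complex^2^2 \<Rightarrow> complex^2) set) c f. (\<And>m. m \<in> M \<Longrightarrow> P (f m)) \<Longrightarrow> P (\<lambda>a. \<Sum>m\<in>M. cst (c m) * f m a)"
    and f: "f \<in> complex_span {f \<in> X. \<exists>n. n \<in> S \<and> homogeneous n f}"
    and X: "\<And>f. f \<in> X \<Longrightarrow> \<exists>F. f = fn F \<and> P F"
  shows "\<exists>M F. graded P M F \<and> M \<subseteq> S \<and> f = fn (\<lambda>a. \<Sum>m\<in>M. F m a)"
proof -
  obtain T c where T: "finite T" "T \<subseteq> {f \<in> X. \<exists>n. n \<in> S \<and> homogeneous n f}" "f = (\<lambda>Z. \<Sum>u\<in>T. c u *s u Z)"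
    using f unfolding complex_span_def by blast
  have "\<exists>F n. u = fn F \<and> P F \<and> n \<in> S \<and> homs n F" if "u \<in> T" for u
  proof -
    have "u \<in> X" "\<exists>n. n \<in> S \<and> homogeneous n u" using T(2) that by auto
    then show ?thesis using X[of u] homogeneous_fn by auto
  qed
  then obtain F n where Fn: "\<And>u. u \<in> T \<Longrightarrow> u = fn (F u) \<and> P (F u) \<and> n u \<in> S \<and> homs (n u) (F u)"
    by metis
  define H where "H m a = (\<Sum>u\<in>{u\<in>T. n u = m}. cst (c u) * F u a)" for m a
  have "graded P (n ` T) H"
    unfolding graded_def
  proof (intro conjI ballI)
    show "finite (n ` T)" using T(1) by simp
    fix m
    show "P (H m)" unfolding H_def[abs_def] by (rule P) (use Fn in auto)
    show "homs m (H m)" unfolding H_def[abs_def] by (rule homs_sum) (use Fn in auto)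
  qed
  moreover have "n ` T \<subseteq> S" using Fn by auto
  moreover have "f = fn (\<lambda>a. \<Sum>m\<in>n ` T. H m a)"
  proof
    fix Z
    have "f Z $ a = (\<Sum>u\<in>T. c u * ev (F u a) Z)" for a
    proof -
      have "f Z $ a = (\<Sum>u\<in>T. c u * u Z $ a)" by (simp add: T(3))
      also have "\<dots> = (\<Sum>u\<in>T. c u * ev (F u a) Z)"
        by (intro sum.cong refl) (metis Fn fn_nth)
      finally show ?thesis .
    qed
    moreover have "(\<Sum>u\<in>T. c u * ev (F u a) Z) = ev (\<Sum>m\<in>n ` T. H m a) Z" for a
    proof -
      have "(\<Sum>m\<in>n ` T. H m a) = (\<Sum>u\<in>T. cst (c u) * F u a)"
        unfolding H_def by (rule sum.image_gen[OF T(1), symmetric])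
      then show ?thesis by (cases "qnorm Z = 0") simp_all
    qed
    ultimately show "f Z = fn (\<lambda>a. \<Sum>m\<in>n ` T. H m a) Z" by (simp add: vec_eq_iff)
  qed
  ultimately show ?thesis by blast
qed

lemma U_space_ex: "f \<in> U_space \<Longrightarrow> \<exists>F. f = fn F \<and> in_U F"
proof -
  assume f: "f \<in> U_space"
  then obtain F where "f = fn F" using fn_surj[of f] unfolding U_space_def by blast
  then show ?thesis using f U_space_fn by blast
qed

lemma U'_space_ex: "f \<in> U'_space \<Longrightarrow> \<exists>F. f = fn F \<and> in_U' F"
proof -
  assume f: "f \<in> U'_space"
  then obtain F where "f = fn F" using fn_surj[of f] unfolding U'_space_def by blast
  then show ?thesis using f U'_space_fn by blast
qed

definition U_part :: "int set \<Rightarrow> (complex^2^2 \<Rightarrow> complex^2) set" where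
  "U_part S = complex_span {f \<in> U_space. \<exists>n. n \<in> S \<and> homogeneous n f}"

definition U'_part :: "int set \<Rightarrow> (complex^2^2 \<Rightarrow> complex^2) set" where
  "U'_part S = complex_span {f \<in> U'_space. \<exists>n. n \<in> S \<and> homogeneous n f}"

lemma U_part_graded: "f \<in> U_part S \<Longrightarrow> \<exists>M F. graded in_U M F \<and> M \<subseteq> S \<and> f = fn (\<lambda>a. \<Sum>m\<in>M. F m a)"
  unfolding U_part_def by (rule span_homogeneous_graded[OF in_U_sum _ U_space_ex])

lemma U'_part_graded: "f \<in> U'_part S \<Longrightarrow> \<exists>M F. graded in_U' M F \<and> M \<subseteq> S \<and> f = fn (\<lambda>a. \<Sum>m\<in>M. F m a)"
  unfolding U'_part_def by (rule span_homogeneous_graded[OF in_U'_sum _ U'_space_ex])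

lemma complex_span_superset: "u \<in> X \<Longrightarrow> u \<in> complex_span X"
  unfolding complex_span_def by (intro CollectI exI[of _ "{u}"] exI[of _ "\<lambda>_. 1"]) (simp add: vec_eq_iff fun_eq_iff)

lemma fn_in_U_part: "in_U F \<Longrightarrow> homs n F \<Longrightarrow> n \<in> S \<Longrightarrow> fn F \<in> U_part S"
  unfolding U_part_def by (rule complex_span_superset) (auto simp: U_space_fn homogeneous_fn)

lemma fn_in_U'_part: "in_U' F \<Longrightarrow> homs n F \<Longrightarrow> n \<in> S \<Longrightarrow> fn F \<in> U'_part S"
  unfolding U'_part_def by (rule complex_span_superset) (auto simp: U'_space_fn homogeneous_fn)

lemma QR_pairing_graded:
  assumes R: "R > 0" and F: "graded in_U M F" and G: "graded in_U' K G"
  shows "QR_pairing R (fn (\<lambda>a. \<Sum>m\<in>M. F m a)) (fn (\<lambda>a. \<Sum>n\<in>K. G n a)) =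
     1 / (4 * of_real pi ^ 2) * (\<Sum>m\<in>M. \<Sum>n\<in>K. sint 1 (Q (F m) (G n)))"
proof -
  have "sint R (Q (\<lambda>a. \<Sum>m\<in>M. F m a) (\<lambda>a. \<Sum>n\<in>K. G n a)) / of_real R =
     (\<Sum>m\<in>M. \<Sum>n\<in>K. sint R (Q (F m) (G n)) / of_real R)"
    unfolding Q_sum_left Q_sum_right by (simp add: sint_sum R sum_divide_distrib)
  also have "\<dots> = (\<Sum>m\<in>M. \<Sum>n\<in>K. sint 1 (Q (F m) (G n)))"
    using F G by (intro sum.cong refl sint_Q_radius[OF R]) (auto simp: graded_def)
  finally show ?thesis unfolding QR_pairing_fn[OF R] by simp
qed

lemma sint_radius_zero: "R > 0 \<Longrightarrow> hom k F \<Longrightarrow> sint 1 F = 0 \<Longrightarrow> sint R F = 0"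
  using sint_scale[of R k F] by simp

lemma homs_quad:
  assumes "homs m f"
  shows "homs (m + 1) (quad_left C f)" "homs (m + 1) (quad_right C f)"
proof -
  have "quad_left C (inv_left (inv_left f)) b = - inv_left (\<lambda>e. const_field C (inv_left f e)) b" for b
    by (rule quad_left_inv)
  moreover have "inv_left (inv_left f) = f" by (simp add: fun_eq_iff inv_left_involution)
  moreover have "homs (- 1 - m - 1) (\<lambda>e. const_field C (inv_left f e))"
    using homs_inv(1)[OF assms] hom_const_field[of "- 1 - m"] by (simp add: homs_def)
  from homs_inv(1)[OF this] have "homs (m + 1) (inv_left (\<lambda>e. const_field C (inv_left f e)))" by (simp add: add.commute)
  ultimately show "homs (m + 1) (quad_left C f)"
    by (simp add: homs_def hom_uminus)
  have "quad_right C (inv_right (inv_right f)) b = - inv_right (\<lambda>e. const_field C (inv_right f e)) b" for b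
    by (rule quad_right_inv)
  moreover have "inv_right (inv_right f) = f" by (simp add: fun_eq_iff inv_right_involution)
  moreover have "homs (- 1 - m - 1) (\<lambda>e. const_field C (inv_right f e))"
    using homs_inv(2)[OF assms] hom_const_field[of "- 1 - m"] by (simp add: homs_def)
  from homs_inv(2)[OF this] have "homs (m + 1) (inv_right (\<lambda>e. const_field C (inv_right f e)))" by (simp add: add.commute)
  ultimately show "homs (m + 1) (quad_right C f)"
    by (simp add: homs_def hom_uminus)
qed

lemma sint_Q_lie:
  assumes R: "R > 0" and U: "in_U f" "in_U' g" and h: "homs m f" "homs n g"
  shows "sint R (Q (lie_left Y f) g + Q f (lie_right Y g)) = 0"
proof -
  let ?A = "block_a Y" and ?B = "block_b Y" and ?C = "block_c Y" and ?D = "block_d Y"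
  have hQ: "hom (k + l - 1) (Q f' g')" if "homs k f'" "homs l g'" for k l f' g'
    using that by (intro hom_Q) (auto simp: homs_def)
  have e: "Q (lie_left Y f) g + Q f (lie_right Y g) =
    (Q (diag_left ?A ?D f) g + Q f (diag_right ?A ?D g)) + (Q (quad_left ?C f) g + Q f (quad_right ?C g))
     - (Q (\<lambda>e. const_field ?B (f e)) g + Q f (\<lambda>e. const_field ?B (g e)))"
    unfolding lie_left_def[abs_def] lie_right_def[abs_def] diff_conv_add_uminus Q_add_left Q_add_right Q_uminus
    by (simp add: algebra_simps)
  have "hom (m + n - 1) (Q (diag_left ?A ?D f) g + Q f (diag_right ?A ?D g))"
    unfolding Q_diag using hQ[OF h] by (intro hom_add hom_lr_field hom_cst_mult)
  from sint_radius_zero[OF R this sint_Q_diag[OF U h]]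
  have 1: "sint R (Q (diag_left ?A ?D f) g + Q f (diag_right ?A ?D g)) = 0" .
  have "hom (m + n) (Q (quad_left ?C f) g + Q f (quad_right ?C g))"
    using hQ[OF homs_quad(1)[OF h(1)] h(2)] hQ[OF h(1) homs_quad(2)[OF h(2)]] by (intro hom_add) (simp_all add: algebra_simps)
  from sint_radius_zero[OF R this sint_Q_quad[OF U h]]
  have 2: "sint R (Q (quad_left ?C f) g + Q f (quad_right ?C g)) = 0" .
  have "homs (m - 1) (\<lambda>e. const_field ?B (f e))" "homs (n - 1) (\<lambda>e. const_field ?B (g e))"
    using h by (auto simp: homs_def hom_const_field)
  then have "hom (m + n - 2) (Q (\<lambda>e. const_field ?B (f e)) g + Q f (\<lambda>e. const_field ?B (g e)))"
    using hQ[of "m - 1" _ n g] hQ[of m f "n - 1"] h by (intro hom_add) (auto simp: algebra_simps)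
  from sint_radius_zero[OF R this sint_Q_const_field[OF U h]]
  have 3: "sint R (Q (\<lambda>e. const_field ?B (f e)) g + Q f (\<lambda>e. const_field ?B (g e))) = 0" .
  show ?thesis unfolding e sint_diff[OF R] sint_add[OF R] using 1 2 3 unfolding sint_add[OF R] by simp
qed

lemma lie_sum: "lie_left Y (\<lambda>a. \<Sum>m\<in>M. F m a) a = (\<Sum>m\<in>M. lie_left Y (F m) a)"
  "lie_right Y (\<lambda>a. \<Sum>m\<in>M. F m a) a = (\<Sum>m\<in>M. lie_right Y (F m) a)"
proof -
  have z: "lie_left Y (\<lambda>a. 0) a = 0" "lie_right Y (\<lambda>a. 0) a = 0"
    by (simp_all add: lie_left_def lie_right_def diag_left_def diag_right_def quad_left_def quad_right_def
        lr_field_def quad_field_def const_field_def)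
  have add: "lie_left Y (\<lambda>a. f a + g a) a = lie_left Y f a + lie_left Y g a"
    "lie_right Y (\<lambda>a. f a + g a) a = lie_right Y f a + lie_right Y g a" for f g
    by (simp_all add: lie_left_def lie_right_def diag_left_def diag_right_def quad_left_def quad_right_def
        quad_field_add const_field_add sum.distrib algebra_simps)
  show "lie_left Y (\<lambda>a. \<Sum>m\<in>M. F m a) a = (\<Sum>m\<in>M. lie_left Y (F m) a)"
    "lie_right Y (\<lambda>a. \<Sum>m\<in>M. F m a) a = (\<Sum>m\<in>M. lie_right Y (F m) a)"
    by (induction M rule: infinite_finite_induct) (simp_all add: z add)
qed

lemma QR_pairing_lie_invariant:
  assumes R: "R > 0" and F: "graded in_U M F" and G: "graded in_U' K G"
  defines "f \<equiv> fn (\<lambda>a. \<Sum>m\<in>M. F m a)" and "g \<equiv> fn (\<lambda>a. \<Sum>n\<in>K. G n a)"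
  shows "QR_pairing R (pi_l_Lie Y f) g + QR_pairing R f (pi_r_Lie Y g) = 0"
proof -
  have "QR_pairing R (pi_l_Lie Y f) g + QR_pairing R f (pi_r_Lie Y g) = 1 / (4 * of_real pi ^ 2) *
     (sint R (\<Sum>m\<in>M. \<Sum>n\<in>K. Q (lie_left Y (F m)) (G n) + Q (F m) (lie_right Y (G n))) / of_real R)"
    unfolding f_def g_def pi_l_Lie_fn pi_r_Lie_fn QR_pairing_fn[OF R] lie_sum[abs_def] Q_sum_left Q_sum_right sum.distrib
    by (simp add: sint_add R add_divide_distrib distrib_left)
  also have "sint R (\<Sum>m\<in>M. \<Sum>n\<in>K. Q (lie_left Y (F m)) (G n) + Q (F m) (lie_right Y (G n))) = 0"
    unfolding sint_sum[OF R] using F G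
    by (intro sum.neutral ballI sint_Q_lie[OF R]) (auto simp: graded_def)
  finally show ?thesis by simp
qed

lemma graded_singleton: "graded P {n} (\<lambda>_. F) \<longleftrightarrow> P F \<and> homs n F"
  by (simp add: graded_def)

text \<open>An element of degree \<open>-1 - m\<close> sees only the component of degree \<open>m\<close>.\<close>

lemma QR_pairing_nondegenerate:
  assumes R: "R > 0" and S: "\<And>n. n \<in> S \<longleftrightarrow> - 1 - n \<in> S'"
  shows "nondegenerate_on (U_part S) (U'_part S') (QR_pairing R)"
  unfolding nondegenerate_on_def
proof (intro conjI ballI impI)
  have c: "(1 / (4 * of_real pi ^ 2) :: complex) \<noteq> 0" by simp
  fix f assume f: "f \<in> U_part S" and z: "\<forall>g\<in>U'_part S'. QR_pairing R f g = 0"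
  obtain M F where F: "graded in_U M F" "M \<subseteq> S" "f = fn (\<lambda>a. \<Sum>m\<in>M. F m a)"
    using U_part_graded[OF f] by blast
  have fin: "finite M" using F(1) by (simp add: graded_def)
  have "F m = (\<lambda>a. 0)" if m: "m \<in> M" for m
  proof (rule nondegenerate_left)
    show "in_U (F m)" "homs m (F m)" using F(1) m by (auto simp: graded_def)
    fix G assume G: "in_U' G" "homs (- 1 - m) G"
    have "- 1 - m \<in> S'" using F(2) m S by blast
    then have "QR_pairing R f (fn G) = 0" using z fn_in_U'_part[OF G] by blast
    moreover have "QR_pairing R f (fn G) = 1 / (4 * of_real pi ^ 2) * (\<Sum>k\<in>M. sint 1 (Q (F k) G))"
      using QR_pairing_graded[OF R F(1), of "{- 1 - m}" "\<lambda>_. G"] G by (simp add: graded_singleton F(3))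
    moreover have "(\<Sum>k\<in>M. sint 1 (Q (F k) G)) = (\<Sum>k\<in>{m}. sint 1 (Q (F k) G))"
    proof (rule sum.mono_neutral_right[OF fin])
      show "\<forall>k\<in>M - {m}. sint 1 (Q (F k) G) = 0"
      proof
        fix k assume k: "k \<in> M - {m}"
        then have "in_U (F k)" "homs k (F k)" using F(1) by (auto simp: graded_def)
        then show "sint 1 (Q (F k) G) = 0" using k G by (intro sint_Q_degree[of _ _ k "- 1 - m"]) auto
      qed
    qed (use m in simp)
    ultimately show "sint 1 (Q (F m) G) = 0" using c by simp
  qed
  then have "(\<lambda>a. \<Sum>m\<in>M. F m a) = (\<lambda>a. 0)" by (simp add: fun_eq_iff)
  then show "f = (\<lambda>Z. 0)" by (simp add: F(3) fun_eq_iff vec_eq_iff)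
next
  have c: "(1 / (4 * of_real pi ^ 2) :: complex) \<noteq> 0" by simp
  fix g assume g: "g \<in> U'_part S'" and z: "\<forall>f\<in>U_part S. QR_pairing R f g = 0"
  obtain M G where G: "graded in_U' M G" "M \<subseteq> S'" "g = fn (\<lambda>a. \<Sum>m\<in>M. G m a)"
    using U'_part_graded[OF g] by blast
  have fin: "finite M" using G(1) by (simp add: graded_def)
  have "G m = (\<lambda>a. 0)" if m: "m \<in> M" for m
  proof (rule nondegenerate_right)
    show "in_U' (G m)" "homs m (G m)" using G(1) m by (auto simp: graded_def)
    fix F assume F: "in_U F" "homs (- 1 - m) F"
    have "- 1 - m \<in> S" using G(2) m S[of "- 1 - m"] by auto
    then have "QR_pairing R (fn F) g = 0" using z fn_in_U_part[OF F] by blast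
    moreover have "QR_pairing R (fn F) g = 1 / (4 * of_real pi ^ 2) * (\<Sum>k\<in>M. sint 1 (Q F (G k)))"
      using QR_pairing_graded[OF R _ G(1), of "{- 1 - m}" "\<lambda>_. F"] F by (simp add: graded_singleton G(3))
    moreover have "(\<Sum>k\<in>M. sint 1 (Q F (G k))) = (\<Sum>k\<in>{m}. sint 1 (Q F (G k)))"
    proof (rule sum.mono_neutral_right[OF fin])
      show "\<forall>k\<in>M - {m}. sint 1 (Q F (G k)) = 0"
      proof
        fix k assume k: "k \<in> M - {m}"
        then have "in_U' (G k)" "homs k (G k)" using G(1) by (auto simp: graded_def)
        then show "sint 1 (Q F (G k)) = 0" using k F by (intro sint_Q_degree[of _ _ "- 1 - m" k]) auto
      qed
    qed (use m in simp)
    ultimately show "sint 1 (Q F (G m)) = 0" using c by simp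
  qed
  then have "(\<lambda>a. \<Sum>m\<in>M. G m a) = (\<lambda>a. 0)" by (simp add: fun_eq_iff)
  then show "g = (\<lambda>Z. 0)" by (simp add: G(3) fun_eq_iff vec_eq_iff)
qed

lemma QR_pairing_invariant_nondegenerate:
  assumes R: "R > 0" and S: "\<And>n. n \<in> S \<longleftrightarrow> - 1 - n \<in> S'"
  defines "A \<equiv> U_part S" and "B \<equiv> U'_part S'"
  shows "bilinear_on A B (QR_pairing R)
    \<and> (\<forall>h\<in>SU2_SU2. \<forall>f\<in>A. \<forall>g\<in>B. QR_pairing R (pi_l h f) (pi_r h g) = QR_pairing R f g)
    \<and> (\<forall>Y. \<forall>f\<in>A. \<forall>g\<in>B. QR_pairing R (pi_l_Lie Y f) g + QR_pairing R f (pi_r_Lie Y g) = 0)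
    \<and> nondegenerate_on A B (QR_pairing R)
    \<and> (\<forall>R'>0. \<forall>f\<in>A. \<forall>g\<in>B. QR_pairing R' f g = QR_pairing R f g)"
proof (intro conjI ballI allI impI)
  have fA: "\<exists>F. f = fn F" if "f \<in> A" for f using U_part_graded that unfolding A_def by blast
  have gB: "\<exists>G. g = fn G" if "g \<in> B" for g using U'_part_graded that unfolding B_def by blast
  show "bilinear_on A B (QR_pairing R)"
    unfolding bilinear_on_def
  proof (intro conjI ballI allI)
    fix f1 f2 g c1 c2 assume "f1 \<in> A" "f2 \<in> A" "g \<in> B"
    then obtain F1 F2 G where "f1 = fn F1" "f2 = fn F2" "g = fn G" using fA gB by meson
    then show "QR_pairing R (\<lambda>Z. c1 *s f1 Z + c2 *s f2 Z) g = c1 * QR_pairing R f1 g + c2 * QR_pairing R f2 g"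
      by (simp add: QR_pairing_bilinear[OF R])
  next
    fix f g1 g2 c1 c2 assume "f \<in> A" "g1 \<in> B" "g2 \<in> B"
    then obtain F G1 G2 where "f = fn F" "g1 = fn G1" "g2 = fn G2" using fA gB by meson
    then show "QR_pairing R f (\<lambda>Z. c1 *s g1 Z + c2 *s g2 Z) = c1 * QR_pairing R f g1 + c2 * QR_pairing R f g2"
      by (simp add: QR_pairing_bilinear[OF R])
  qed
  show "nondegenerate_on A B (QR_pairing R)"
    unfolding A_def B_def by (rule QR_pairing_nondegenerate[OF R S])
  fix f g assume f: "f \<in> A" and g: "g \<in> B"
  obtain M F where F: "graded in_U M F" "f = fn (\<lambda>a. \<Sum>m\<in>M. F m a)" using U_part_graded f unfolding A_def by blast
  obtain K G where G: "graded in_U' K G" "g = fn (\<lambda>a. \<Sum>n\<in>K. G n a)" using U'_part_graded g unfolding B_def by blast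
  show "QR_pairing R (pi_l h f) (pi_r h g) = QR_pairing R f g" if "h \<in> SU2_SU2" for h
    unfolding F(2) G(2) by (rule QR_pairing_group_invariant[OF that R])
  show "QR_pairing R (pi_l_Lie Y f) g + QR_pairing R f (pi_r_Lie Y g) = 0" for Y
    unfolding F(2) G(2) by (rule QR_pairing_lie_invariant[OF R F(1) G(1)])
  show "QR_pairing R' f g = QR_pairing R f g" if "R' > 0" for R'
    unfolding F(2) G(2) QR_pairing_graded[OF that F(1) G(1)] QR_pairing_graded[OF R F(1) G(1)] ..
qed


lemma signed_parts: "U_plus = U_part {0..}" "U_minus = U_part {..<0}" "U'_plus = U'_part {0..}" "U'_minus = U'_part {..<0}"
  by (simp_all add: U_plus_def U_minus_def U'_plus_def U'_minus_def U_part_def U'_part_def)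

theorem proposition47:
  fixes R :: real
    and A B :: "(complex^2^2 \<Rightarrow> complex^2) set"
  assumes "R > 0"
    and "(A, B) \<in> {(U_plus, U'_minus), (U_minus, U'_plus)}"
  shows "bilinear_on A B (QR_pairing R)
    \<and> (\<forall>h\<in>SU2_SU2. \<forall>f\<in>A. \<forall>g\<in>B. QR_pairing R (pi_l h f) (pi_r h g) = QR_pairing R f g)
    \<and> (\<forall>Y. \<forall>f\<in>A. \<forall>g\<in>B. QR_pairing R (pi_l_Lie Y f) g + QR_pairing R f (pi_r_Lie Y g) = 0)
    \<and> nondegenerate_on A B (QR_pairing R)
    \<and> (\<forall>R'>0. \<forall>f\<in>A. \<forall>g\<in>B. QR_pairing R' f g = QR_pairing R f g)"
proof -
  have deg: "n \<in> {0..} \<longleftrightarrow> - 1 - n \<in> {..<0}" "n \<in> {..<0} \<longleftrightarrow> - 1 - n \<in> {0..}" for n :: int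
    by auto
  from assms(2) consider "A = U_part {0..}" "B = U'_part {..<0}" | "A = U_part {..<0}" "B = U'_part {0..}"
    by (auto simp: signed_parts)
  then show ?thesis
  proof cases
    case 1
    show ?thesis unfolding 1 by (rule QR_pairing_invariant_nondegenerate[OF assms(1) deg(1)])
  next
    case 2
    show ?thesis unfolding 2 by (rule QR_pairing_invariant_nondegenerate[OF assms(1) deg(2)])
  qed
qed

end
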